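(* The map $f_r\colon I\to I$ is of class $C^r$, it is topologically mixing, and $\|f_r'\|_{\infty}=\lambda^r$.
   Context: Mixing: a continuous map $T\colon X\to X$ on a compact metric space is (topologically) mixing if for all non-empty open $U,V\subset X$ there is $N\geq 0$ with $T^{-n}U\cap V\neq\emptyset$ for every $n\geq N$. $\|\cdot\|_\infty$ is the sup norm. Construction of $f_r$. Fix a real number $\lambda\geq 14$ and an integer $r\geq 1$. Put $I=[0,4]$, $\delta=\lambda^{-r}$, $C=\frac{1}{4\delta^2}$, and for $n\geq 1$: $x_n=1+\frac1n$, $y_n=x_n+\frac{1}{2n^2}$ (so $y_1=\frac52$), $M_n=2\left\lfloor\frac{\lambda^n}{2n^2}\right\rfloor-1$ (an odd integer), $m_n=1-\frac{1}{(n+1)^2}$, $k_n=\frac{2\lambda^r}{M_n}$. The map $f_r\colon I\to I$ is obtained as follows (functions not given explicitly are arbitrary subject to the listed conditions); it is $C^\infty$ on $[0,4]\setminus\{1\}$. (a) On $[x_n,y_n]$, $n\geq 1$: $f_r(x)=\lambda^{-nr}\left[x_n+(y_n-x_n)\,s_n\!\left(M_n\frac{x-x_n}{y_n-x_n}\right)\right]$, where the $s_n\colon[0,M_n]\to[-m_n,1]$ are $C^\infty$ functions such that: $s_n(0)=0$, $s_n(M_n)=1$, $s_n$ is increasing on each $[2k,2k+1]$ ($0\leq k\leq (M_n-1)/2$) and decreasing on each $[2k+1,2k+2]$ ($0\leq k\leq (M_n-3)/2$); $s_n(x)=1-C(x-a)^2$ for $|x-a|\leq\delta$ if $a\neq M_n$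 is a local maximum of $s_n$, and $s_n(x)=-m_n+C(x-b)^2$ for $|x-b|\leq\delta$ if $b\neq0$ is a local minimum of $s_n$; $s_n(x)=k_n(x-M_n)+1$ for $M_n-\delta\leq x\leq M_n$; $s_n(x)=k_nx$ for $0\leq x\leq\delta$; for every $k\geq 1$ there is a constant $A_k$ independent of $n$ with $\|s_n^{(k)}\|_\infty\leq A_k$ for all $n$; $\|s_n'\|_\infty\leq\lambda^r$, and $|s_n'(x)|\geq\min\{1/2,k_n\}$ whenever $|x-d|\geq\delta$ for all local extrema $d\in(0,M_n)$. (b) On $[y_{n+1},x_n]$, $n\geq1$: let $w_n=y_{n+1}+\frac{n+2}{2n(n+1)^2M_{n+1}k_{n+1}}\in(y_{n+1},x_n)$. On $[y_{n+1},w_n]$, $f_r$ is affine of slope $\lambda^{-(n+1)r}M_{n+1}k_{n+1}$ with $f_r(y_{n+1})=\lambda^{-(n+1)r}y_{n+1}$. Put $l_n=x_n-w_n$, $h_n=f_r(x_n)-f_r(w_n)$. On $[w_n,x_n]$, $f_r(w_n+l_nt)=f_r(w_n)+h_n\varphi_n(t)$ for $t\in[0,1]$, where the $\varphi_n\colon[0,1]\to[0,1]$ are $C^\infty$ with $\varphi_n(0)=0$, $\varphi_n(1)=1$, $\varphi_n'(0)=2h_n^{-1}l_n\lambda^{-nr}$, $\varphi_n'(1)=2h_n^{-1}l_n\lambda^{-(n-1)r}$, $\varphi_n^{(k)}(0)=\varphi_n^{(k)}(1)=0$ for $k\geq2$, $\frac23\varphi_n'(0)\leq\varphi_n'\leq\lambda^r$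 on $[0,1]$, and for every $k\geq1$ there is $B_k$ independent of $n$ with $\|\varphi_n^{(k)}\|_\infty\leq B_k$ for all $n$. (c) On $[0,1]\cup[y_1,4]$: $f_r(x)=\lambda^rx$ for $0\leq x\leq\frac52\delta$; $f_r(x)=4-\frac32\delta^{-1}(x-\frac12)^2$ for $|x-\frac12|\leq\delta$; $f_r(x)=\delta^{1-2r}(x-1)^{2r}$ for $1-\delta\leq x\leq1$; $f_r(x)=4+\lambda^r(x-4)$ for $4-\frac32\delta\leq x\leq4$; and $f_r$ is completed so that the pieces glue together in a $C^\infty$ way (except at $1$), with $\frac32\leq f_r'\leq\lambda^r$ on $[\frac52\delta,\frac12-\delta]$, $-\lambda^r\leq f_r'\leq-\frac32$ on $[\frac12+\delta,1-\delta]$, and $\frac32\leq f_r'\leq\lambda^r$ on $[y_1,4]$. *)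

theory Defs
  imports "HOL-Analysis.Analysis"
begin

section \<open>Smoothness, sup norm, local extrema and mixing on subsets\<close>

text \<open>
  Derivatives are taken within the set \<open>S\<close>, hence one-sided at the end points of an
  interval. They are meaningful when \<open>S\<close> has no isolated points, and on \<open>S\<close> they depend only on
  the values of \<open>f\<close> on \<open>S\<close>.
\<close>

primrec nderiv_on :: "real set \<Rightarrow> nat \<Rightarrow> (real \<Rightarrow> real) \<Rightarrow> real \<Rightarrow> real" where
  "nderiv_on S 0 f = f"
| "nderiv_on S (Suc k) f = (\<lambda>x. vector_derivative (nderiv_on S k f) (at x within S))"

definition C_k_on :: "nat \<Rightarrow> real set \<Rightarrow> (real \<Rightarrow> real) \<Rightarrow> bool" where
  "C_k_on k S f \<longleftrightarrow>
     (\<forall>j<k. \<forall>x\<in>S. nderiv_on S j f differentiable (at x within S)) \<and>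
     continuous_on S (nderiv_on S k f)"

definition C_infinity_on :: "real set \<Rightarrow> (real \<Rightarrow> real) \<Rightarrow> bool" where
  "C_infinity_on S f \<longleftrightarrow> (\<forall>k. C_k_on k S f)"

text \<open>
  The supremum is taken in \<open>real\<close>, so it is meaningful only for functions bounded on \<open>S\<close>. Below it
  is applied only to functions that are continuous on a compact interval.
\<close>

definition sup_norm_on :: "real set \<Rightarrow> (real \<Rightarrow> real) \<Rightarrow> real" where
  "sup_norm_on S g = (SUP x\<in>S. \<bar>g x\<bar>)"

definition local_max_on :: "real set \<Rightarrow> (real \<Rightarrow> real) \<Rightarrow> real \<Rightarrow> bool" where
  "local_max_on S g a \<longleftrightarrow> a \<in> S \<and> (\<exists>e>0. \<forall>x\<in>S. \<bar>x - a\<bar> < e \<longrightarrow> g x \<le> g a)"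

definition local_min_on :: "real set \<Rightarrow> (real \<Rightarrow> real) \<Rightarrow> real \<Rightarrow> bool" where
  "local_min_on S g b \<longleftrightarrow> b \<in> S \<and> (\<exists>e>0. \<forall>x\<in>S. \<bar>x - b\<bar> < e \<longrightarrow> g b \<le> g x)"

text \<open>
  Topological mixing of a self-map \<open>T\<close> of the compact metric space \<open>X\<close>, given as a
  subset of an ambient space; open sets are those of the subspace topology.
\<close>

definition topologically_mixing_on :: "'a::metric_space set \<Rightarrow> ('a \<Rightarrow> 'a) \<Rightarrow> bool" where
  "topologically_mixing_on X T \<longleftrightarrow>
     compact X \<and> T ` X \<subseteq> X \<and> continuous_on X T \<and>
     (\<forall>U V. openin (top_of_set X) U \<and> U \<noteq> {} \<and> openin (top_of_set X) V \<and> V \<noteq> {} \<longrightarrow>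
       (\<exists>N. \<forall>n\<ge>N. {x \<in> X. (T ^^ n) x \<in> U} \<inter> V \<noteq> {}))"


section \<open>The construction of the maps\<close>

text \<open>
  The letter \<open>\<lambda>\<close> is written \<open>l\<close>; \<open>len\<close> and \<open>height\<close> are the length of $[w_n,x_n]$ and the increment
  $h_n$ of \<open>f\<close> over it. The index \<open>n\<close> is at least \<open>1\<close> wherever these are used.
\<close>

definition I :: "real set" where
  "I = {0..4}"

definition \<delta> :: "real \<Rightarrow> nat \<Rightarrow> real" where
  "\<delta> l r = l powi (- int r)"

definition C_const :: "real \<Rightarrow> nat \<Rightarrow> real" where
  "C_const l r = 1 / (4 * (\<delta> l r)^2)"

definition xpt :: "nat \<Rightarrow> real" where
  "xpt n = 1 + 1 / real n"

definition ypt :: "nat \<Rightarrow> real" where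
  "ypt n = xpt n + 1 / (2 * real n ^ 2)"

definition M_seq :: "real \<Rightarrow> nat \<Rightarrow> real" where
  "M_seq l n = real_of_int (2 * \<lfloor>l ^ n / (2 * real n ^ 2)\<rfloor> - 1)"

definition m_seq :: "nat \<Rightarrow> real" where
  "m_seq n = 1 - 1 / (real n + 1)^2"

definition k_seq :: "real \<Rightarrow> nat \<Rightarrow> nat \<Rightarrow> real" where
  "k_seq l r n = 2 * l ^ r / M_seq l n"

definition wpt :: "real \<Rightarrow> nat \<Rightarrow> nat \<Rightarrow> real" where
  "wpt l r n = ypt (n + 1) +
     (real n + 2) / (2 * real n * (real n + 1)^2 * M_seq l (n + 1) * k_seq l r (n + 1))"

definition len :: "real \<Rightarrow> nat \<Rightarrow> nat \<Rightarrow> real" where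
  "len l r n = xpt n - wpt l r n"

definition height :: "real \<Rightarrow> nat \<Rightarrow> (real \<Rightarrow> real) \<Rightarrow> nat \<Rightarrow> real" where
  "height l r f n = f (xpt n) - f (wpt l r n)"

definition s_conditions :: "real \<Rightarrow> nat \<Rightarrow> (nat \<Rightarrow> real \<Rightarrow> real) \<Rightarrow> bool" where
  "s_conditions l r s \<longleftrightarrow>
     (\<forall>n\<ge>1.
        s n ` {0..M_seq l n} \<subseteq> {- m_seq n..1} \<and>
        C_infinity_on {0..M_seq l n} (s n) \<and>
        s n 0 = 0 \<and> s n (M_seq l n) = 1 \<and>
        (\<forall>j::nat. real j \<le> (M_seq l n - 1) / 2 \<longrightarrow>
           mono_on {2 * real j..2 * real j + 1} (s n)) \<and>
        (\<forall>j::nat. real j \<le> (M_seq l n - 3) / 2 \<longrightarrow>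
           antimono_on {2 * real j + 1..2 * real j + 2} (s n)) \<and>
        (\<forall>a. local_max_on {0..M_seq l n} (s n) a \<and> a \<noteq> M_seq l n \<longrightarrow>
           (\<forall>x\<in>{0..M_seq l n}. \<bar>x - a\<bar> \<le> \<delta> l r \<longrightarrow> s n x = 1 - C_const l r * (x - a)^2)) \<and>
        (\<forall>b. local_min_on {0..M_seq l n} (s n) b \<and> b \<noteq> 0 \<longrightarrow>
           (\<forall>x\<in>{0..M_seq l n}. \<bar>x - b\<bar> \<le> \<delta> l r \<longrightarrow> s n x = - m_seq n + C_const l r * (x - b)^2)) \<and>
        (\<forall>x\<in>{M_seq l n - \<delta> l r..M_seq l n}. s n x = k_seq l r n * (x - M_seq l n) + 1) \<and>
        (\<forall>x\<in>{0..\<delta> l r}. s n x = k_seq l r n * x) \<and>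
        sup_norm_on {0..M_seq l n} (nderiv_on {0..M_seq l n} 1 (s n)) \<le> l ^ r \<and>
        (\<forall>x\<in>{0..M_seq l n}.
           (\<forall>d\<in>{0<..<M_seq l n}.
              local_max_on {0..M_seq l n} (s n) d \<or> local_min_on {0..M_seq l n} (s n) d \<longrightarrow>
              \<bar>x - d\<bar> \<ge> \<delta> l r) \<longrightarrow>
           \<bar>nderiv_on {0..M_seq l n} 1 (s n) x\<bar> \<ge> min (1/2) (k_seq l r n))) \<and>
     (\<forall>j\<ge>1. \<exists>A. \<forall>n\<ge>1. sup_norm_on {0..M_seq l n} (nderiv_on {0..M_seq l n} j (s n)) \<le> A)"

definition phi_conditions ::
    "real \<Rightarrow> nat \<Rightarrow> (real \<Rightarrow> real) \<Rightarrow> (nat \<Rightarrow> real \<Rightarrow> real) \<Rightarrow> bool" where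
  "phi_conditions l r f \<phi> \<longleftrightarrow>
     (\<forall>n\<ge>1.
        \<phi> n ` {0..1} \<subseteq> {0..1} \<and>
        C_infinity_on {0..1} (\<phi> n) \<and>
        \<phi> n 0 = 0 \<and> \<phi> n 1 = 1 \<and>
        nderiv_on {0..1} 1 (\<phi> n) 0 =
          2 * inverse (height l r f n) * len l r n * l powi (- (int n * int r)) \<and>
        nderiv_on {0..1} 1 (\<phi> n) 1 =
          2 * inverse (height l r f n) * len l r n * l powi (- ((int n - 1) * int r)) \<and>
        (\<forall>j\<ge>2. nderiv_on {0..1} j (\<phi> n) 0 = 0 \<and> nderiv_on {0..1} j (\<phi> n) 1 = 0) \<and>
        (\<forall>t\<in>{0..1}. 2/3 * nderiv_on {0..1} 1 (\<phi> n) 0 \<le> nderiv_on {0..1} 1 (\<phi> n) t \<and>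
                    nderiv_on {0..1} 1 (\<phi> n) t \<le> l ^ r)) \<and>
     (\<forall>j\<ge>1. \<exists>B. \<forall>n\<ge>1. sup_norm_on {0..1} (nderiv_on {0..1} j (\<phi> n)) \<le> B)"

text \<open>
  \<open>is_fr l r f\<close>: the restriction of \<open>f\<close> to \<open>I\<close> is one of the maps produced by the construction, for
  some admissible choice of the auxiliary functions. That \<open>f\<close> maps \<open>I\<close> into itself is not assumed.
\<close>

definition is_fr :: "real \<Rightarrow> nat \<Rightarrow> (real \<Rightarrow> real) \<Rightarrow> bool" where
  "is_fr l r f \<longleftrightarrow>
     C_infinity_on (I - {1}) f \<and>
     (\<exists>s. s_conditions l r s \<and>
        (\<forall>n\<ge>1. \<forall>x\<in>{xpt n..ypt n}.
           f x = l powi (- (int n * int r)) *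
             (xpt n + (ypt n - xpt n) * s n (M_seq l n * ((x - xpt n) / (ypt n - xpt n)))))) \<and>
     (\<forall>n\<ge>1. \<forall>x\<in>{ypt (n + 1)..wpt l r n}.
        f x = l powi (- (int (n + 1) * int r)) * ypt (n + 1) +
          l powi (- (int (n + 1) * int r)) * M_seq l (n + 1) * k_seq l r (n + 1) * (x - ypt (n + 1))) \<and>
     (\<exists>\<phi>. phi_conditions l r f \<phi> \<and>
        (\<forall>n\<ge>1. \<forall>t\<in>{0..1}.
           f (wpt l r n + len l r n * t) = f (wpt l r n) + height l r f n * \<phi> n t)) \<and>
     (\<forall>x\<in>{0..5/2 * \<delta> l r}. f x = l ^ r * x) \<and>
     (\<forall>x. \<bar>x - 1/2\<bar> \<le> \<delta> l r \<longrightarrow> f x = 4 - 3/2 * inverse (\<delta> l r) * (x - 1/2)^2) \<and>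
     (\<forall>x\<in>{1 - \<delta> l r..1}. f x = \<delta> l r powi (1 - 2 * int r) * (x - 1) ^ (2 * r)) \<and>
     (\<forall>x\<in>{4 - 3/2 * \<delta> l r..4}. f x = 4 + l ^ r * (x - 4)) \<and>
     (\<forall>x\<in>{5/2 * \<delta> l r..1/2 - \<delta> l r}.
        3/2 \<le> nderiv_on I 1 f x \<and> nderiv_on I 1 f x \<le> l ^ r) \<and>
     (\<forall>x\<in>{1/2 + \<delta> l r..1 - \<delta> l r}.
        - (l ^ r) \<le> nderiv_on I 1 f x \<and> nderiv_on I 1 f x \<le> - 3/2) \<and>
     (\<forall>x\<in>{ypt 1..4}. 3/2 \<le> nderiv_on I 1 f x \<and> nderiv_on I 1 f x \<le> l ^ r)"

end

theory Submission
  imports Defs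
begin

text \<open>
  Write \<open>L = l ^ r\<close>, \<open>d = 1 / L\<close>, and \<open>g_n = y_n - x_n = 1 / (2 n^2)\<close>.

  Smoothness. Away from \<open>1\<close> the map is smooth by construction, so everything happens at \<open>1\<close>. On
  \<open>[x_n, y_n]\<close> the \<open>j\<close>-th derivative is \<open>d^n g_n (M_n / g_n)^j\<close> times the \<open>j\<close>-th derivative of \<open>s_n\<close>.
  Since \<open>M_n / g_n \<le> 2 l^n\<close>, this is at most a constant times \<open>l^(n (j - r)) g_n\<close>, which tends to \<open>0\<close> as
  long as \<open>j \<le> r\<close>; the factor \<open>1 / n^2\<close> saves the case \<open>j = r\<close>. On \<open>[y_(n+1), x_n]\<close> the factor \<open>d^n\<close>
  beats every power of \<open>n\<close>, and left of \<open>1\<close> the map is a multiple of \<open>(x - 1)^(2 r)\<close>. So the derivatives of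
  order \<open>1, \<dots>, r\<close> tend to \<open>0\<close> at \<open>1\<close> (\<open>nderiv_tendsto_0_at_1\<close>), and the mean value theorem makes them
  derivatives at \<open>1\<close> too (\<open>has_derivative_from_limit\<close>). The same formulas with \<open>j = 1\<close> give \<open>|f'| \<le> L\<close>,
  and \<open>f' = L\<close> near \<open>0\<close>.

  Mixing. The stronger property \<open>eventually_onto\<close> holds: some iterate of every nondegenerate segment is
  all of \<open>I\<close>. Since \<open>0\<close> is a repelling fixed point, \<open>[0, 1/2]\<close> is mapped onto \<open>I\<close>, and no iterate of \<open>f\<close> is
  constant on a segment, it is enough that the iterates of every segment reach \<open>0\<close>; a segment
  with this property is said to hit. Lengths are bounded by \<open>4\<close>, so it suffices that a segment that does not
  hit has an iterate containing a segment longer by the factor \<open>4/3\<close> (\<open>hits_by_growth\<close>). Two facts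
  provide this.

  \<^item> There are points \<open>z\<close> all of whose one-sided neighbourhoods hit: \<open>0\<close>, \<open>1\<close>, \<open>4\<close>, all \<open>x_n\<close> and \<open>y_n\<close>,
    and all points whose orbits meet these (\<open>covers_preimage\<close>). The points \<open>x_n\<close> and \<open>y_n\<close> are
    fixed points of \<open>f^(n+1)\<close>, because \<open>f(x) = d^n z\<close> with \<open>0 \<le> z \<le> 5/2\<close> implies \<open>f^(n+1)(x) = z\<close>
    (\<open>funpow_scale\<close>), and they are repelling. A one-sided neighbourhood of one of them grows until
    it contains some \<open>[w_n, x_n]\<close>, whose end points are sent to \<open>d x_n < 1\<close> and \<open>x_n > 1\<close> by \<open>f^(n+1)\<close>; only to
    the right of \<open>y_1\<close>, the point \<open>1\<close> is reached by way of the interval \<open>[5/2, 4]\<close>.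

  \<^item> Such points cut \<open>I - {1}\<close> into pieces, and some iterate of each segment in a piece contains a
    segment longer by the factor \<open>4/3\<close> (\<open>piece_expands\<close>). The only danger is at the folds:
    near \<open>1/2\<close>, left of \<open>1\<close>, and at the extrema of \<open>s_n\<close>, where the derivative of \<open>f\<close> is small. But the
    fold is always sent to a fixed point \<open>p\<close> of some iterate that is linear on the relevant side of
    \<open>p\<close> up to a distance \<open>e\<close>, with slope \<open>\<kappa> > 1\<close>. A point at distance \<open>v\<close> from the fold
    lands at distance \<open>c v^m\<close> from \<open>p\<close>; after the \<open>j\<close> steps that it needs to get farther than \<open>e\<close> from \<open>p\<close>, the
    total expansion is at least \<open>\<kappa>^j c v^(m-1) > e / v\<close> (\<open>fold_escape\<close>). This is large enough, at the
    maxima of \<open>s_n\<close> sometimes only after one further return to \<open>[x_n, y_n]\<close>.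
\<close>

section \<open>Iterated derivatives within a set\<close>

lemma C_k_on_has_derivative:
  assumes "C_k_on k S f" "j < k" "x \<in> S"
  shows "(nderiv_on S j f has_real_derivative nderiv_on S (Suc j) f x) (at x within S)"
  using assms unfolding C_k_on_def
  by (simp add: has_real_derivative_iff_has_vector_derivative vector_derivative_works[symmetric])

lemma C_infinity_on_has_derivative:
  assumes "C_infinity_on S f" "x \<in> S"
  shows "(nderiv_on S j f has_real_derivative nderiv_on S (Suc j) f x) (at x within S)"
  using assms C_k_on_has_derivative[of "Suc j"] by (simp add: C_infinity_on_def)

lemma C_infinity_on_continuous:
  "C_infinity_on S f \<Longrightarrow> continuous_on S (nderiv_on S j f)"
  by (auto simp: C_infinity_on_def C_k_on_def)

lemma has_derivative_eq_on:
  assumes "x \<in> S" "\<And>y. y \<in> S \<Longrightarrow> g y = f y" "(f has_real_derivative D) (at x within S)"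
  shows "(g has_real_derivative D) (at x within S)"
  using assms by (simp add: has_real_derivative_iff_has_vector_derivative has_vector_derivative_transform)

lemma nderiv_on_SucI:
  assumes "(nderiv_on S j f has_real_derivative D) (at x within S)" "at x within S \<noteq> bot"
  shows "nderiv_on S (Suc j) f x = D"
  using assms by (simp add: has_real_derivative_iff_has_vector_derivative vector_derivative_within)

text \<open>The smaller set must have no isolated points: there every number would be a derivative, and the
  chosen one is arbitrary.\<close>

lemma nderiv_on_subset:
  assumes f: "C_infinity_on T f" and "S \<subseteq> T" and nt: "\<And>x. x \<in> S \<Longrightarrow> at x within S \<noteq> bot"
    and "x \<in> S"
  shows "nderiv_on S j f x = nderiv_on T j f x"
  using \<open>x \<in> S\<close>
proof (induction j arbitrary: x)
  case (Suc j)
  have "(nderiv_on T j f has_real_derivative nderiv_on T (Suc j) f x) (at x within S)"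
    using C_infinity_on_has_derivative[OF f] Suc.prems \<open>S \<subseteq> T\<close> by (blast intro: DERIV_subset)
  then have "(nderiv_on S j f has_real_derivative nderiv_on T (Suc j) f x) (at x within S)"
    by (rule has_derivative_eq_on[rotated 2]) (use Suc in auto)
  then show ?case
    using nt[OF Suc.prems] by (rule nderiv_on_SucI)
qed simp

lemma nderiv_on_Int_open:
  assumes "open U" and "x \<in> T \<inter> U"
  shows "nderiv_on (T \<inter> U) j f x = nderiv_on T j f x"
  using \<open>x \<in> T \<inter> U\<close>
proof (induction j arbitrary: x)
  case (Suc j)
  have at: "at x within (T \<inter> U) = at x within T"
    using Suc.prems \<open>open U\<close> by (intro at_within_nhd[of x U]) auto
  have "\<forall>\<^sub>F y in nhds x. y \<in> U"
    using Suc.prems \<open>open U\<close> by (intro eventually_nhds_in_open) auto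
  then have "vector_derivative (nderiv_on (T \<inter> U) j f) (at x within T)
      = vector_derivative (nderiv_on T j f) (at x within T)"
    using Suc by (intro vector_derivative_cong_eq) (auto elim!: eventually_mono)
  then show ?case
    by (simp add: at)
qed simp

lemma nderiv_on_affine:
  assumes g: "C_infinity_on T g"
    and f: "\<And>x. x \<in> S \<Longrightarrow> f x = A + B * g (c * (x - p))"
    and sub: "\<And>x. x \<in> S \<Longrightarrow> c * (x - p) \<in> T"
    and nt: "\<And>x. x \<in> S \<Longrightarrow> at x within S \<noteq> bot"
    and "x \<in> S"
  shows "nderiv_on S j f x = (if j = 0 then A else 0) + B * c ^ j * nderiv_on T j g (c * (x - p))"
  using \<open>x \<in> S\<close>
proof (induction j arbitrary: x)
  case 0
  then show ?case by (simp add: f)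
next
  case (Suc j)
  let ?u = "\<lambda>x. c * (x - p)"
  have "(nderiv_on T j g has_real_derivative nderiv_on T (Suc j) g (?u x)) (at (?u x) within ?u ` S)"
    using C_infinity_on_has_derivative[OF g] Suc.prems sub by (blast intro: DERIV_subset)
  moreover have "(?u has_real_derivative c) (at x within S)"
    by (auto intro!: derivative_eq_intros)
  ultimately have "(nderiv_on T j g \<circ> ?u has_real_derivative nderiv_on T (Suc j) g (?u x) * c) (at x within S)"
    by (rule DERIV_image_chain)
  then have "((\<lambda>x. (if j = 0 then A else 0) + B * c ^ j * (nderiv_on T j g \<circ> ?u) x)
      has_real_derivative 0 + B * c ^ j * (nderiv_on T (Suc j) g (?u x) * c)) (at x within S)"
    by (intro DERIV_add DERIV_const DERIV_cmult)
  then have "(nderiv_on S j f has_real_derivative 0 + B * c ^ j * (nderiv_on T (Suc j) g (?u x) * c)) (at x within S)"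
    by (rule has_derivative_eq_on[rotated 2]) (use Suc in auto)
  from nderiv_on_SucI[OF this nt[OF Suc.prems]] show ?case
    by (simp add: mult_ac)
qed

lemma nderiv_on_affine_map:
  assumes f: "\<And>x. x \<in> S \<Longrightarrow> f x = A + B * x"
    and nt: "\<And>x. x \<in> S \<Longrightarrow> at x within S \<noteq> bot" and "x \<in> S"
  shows "nderiv_on S (Suc j) f x = (if j = 0 then B else 0)"
  using \<open>x \<in> S\<close>
proof (induction j arbitrary: x)
  case 0
  have "((\<lambda>x. A + B * x) has_real_derivative B) (at x within S)"
    by (auto intro!: derivative_eq_intros)
  then have "(nderiv_on S 0 f has_real_derivative B) (at x within S)"
    by (rule has_derivative_eq_on[rotated 2]) (use f 0 in auto)
  from nderiv_on_SucI[OF this nt[OF 0]] show ?case by simp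
next
  case (Suc j)
  have "((\<lambda>x. if j = 0 then B else 0) has_real_derivative 0) (at x within S)"
    by simp
  then have "(nderiv_on S (Suc j) f has_real_derivative 0) (at x within S)"
    by (rule has_derivative_eq_on[rotated 2]) (use Suc in auto)
  from nderiv_on_SucI[OF this nt[OF Suc.prems]] show ?case by simp
qed

lemma nderiv_on_shifted_power:
  assumes f: "\<And>x. x \<in> S \<Longrightarrow> f x = B * (x - p) ^ m"
    and nt: "\<And>x. x \<in> S \<Longrightarrow> at x within S \<noteq> bot" and "x \<in> S"
  shows "nderiv_on S j f x = B * (\<Prod>i<j. real (m - i)) * (x - p) ^ (m - j)"
  using \<open>x \<in> S\<close>
proof (induction j arbitrary: x)
  case (Suc j)
  have "((\<lambda>x. B * (\<Prod>i<j. real (m - i)) * (x - p) ^ (m - j)) has_real_derivative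
      B * (\<Prod>i<j. real (m - i)) * (real (m - j) * (x - p) ^ (m - j - 1))) (at x within S)"
    by (rule DERIV_cmult) (auto intro!: derivative_eq_intros)
  then have "(nderiv_on S j f has_real_derivative
      B * (\<Prod>i<j. real (m - i)) * (real (m - j) * (x - p) ^ (m - j - 1))) (at x within S)"
    by (rule has_derivative_eq_on[rotated 2]) (use Suc in auto)
  from nderiv_on_SucI[OF this nt[OF Suc.prems]] show ?case
    by simp
qed (simp add: f)

lemma at_within_Icc_nontrivial:
  fixes x :: real
  assumes "a < b" "x \<in> {a..b}"
  shows "at x within {a..b} \<noteq> bot"
  using assms by (simp add: trivial_limit_within islimpt_Icc)

lemma at_within_Icc_diff_nontrivial:
  fixes x :: real
  assumes "a < b" "x \<in> {a..b} - {p}"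
  shows "at x within ({a..b} - {p}) \<noteq> bot"
proof -
  have "at x within ({a..b} - {p}) = at x within {a..b}"
    using assms by (intro at_within_nhd[of x "- {p}"]) auto
  then show ?thesis
    using assms at_within_Icc_nontrivial by auto
qed

lemma C_infinity_on_mvt:
  assumes f: "C_infinity_on T f" and "{a..b} \<subseteq> T" "a < b"
  shows "\<exists>\<xi>\<in>{a<..<b}. f b - f a = (b - a) * nderiv_on T 1 f \<xi>"
proof -
  have "continuous_on T f"
    using C_infinity_on_continuous[OF f, of 0] by simp
  then have "continuous_on {a..b} f"
    using \<open>{a..b} \<subseteq> T\<close> continuous_on_subset by blast
  moreover have D: "(f has_real_derivative nderiv_on T 1 f x) (at x)" if "a < x" "x < b" for x
  proof -
    have "x \<in> interior T"
      using that interior_mono[OF \<open>{a..b} \<subseteq> T\<close>] by (auto simp: interior_atLeastAtMost_real)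
    then show ?thesis
      using C_infinity_on_has_derivative[OF f, of x 0] interior_subset
      by (metis One_nat_def at_within_interior nderiv_on.simps(1) subsetD)
  qed
  ultimately obtain \<xi> where "a < \<xi>" "\<xi> < b" "f b - f a = (b - a) * nderiv_on T 1 f \<xi>"
    using MVT[of a b f] D \<open>a < b\<close> by (metis DERIV_unique real_differentiable_def)
  then show ?thesis by auto
qed

lemma sup_norm_on_nderiv_bound:
  assumes "C_infinity_on {a..b} g" "x \<in> {a..b}"
  shows "\<bar>nderiv_on {a..b} j g x\<bar> \<le> sup_norm_on {a..b} (nderiv_on {a..b} j g)"
proof -
  have "continuous_on {a..b} (\<lambda>x. \<bar>nderiv_on {a..b} j g x\<bar>)"
    using C_infinity_on_continuous[OF assms(1)] by (intro continuous_intros)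
  then have "bdd_above ((\<lambda>x. \<bar>nderiv_on {a..b} j g x\<bar>) ` {a..b})"
    by (intro compact_imp_bounded[THEN bounded_imp_bdd_above] compact_continuous_image) auto
  then show ?thesis
    unfolding sup_norm_on_def using assms(2) by (intro cSUP_upper)
qed

text \<open>By the mean value theorem between \<open>a\<close> and \<open>x\<close>, the difference quotient at \<open>a\<close> is a value of \<open>g'\<close> at a point
  even closer to \<open>a\<close>. This is how smoothness is extended over the exceptional point \<open>1\<close>.\<close>

lemma has_derivative_from_limit:
  fixes g g' :: "real \<Rightarrow> real"
  assumes a: "a \<in> {p..q}"
    and deriv: "\<And>x. x \<in> {p..q} - {a} \<Longrightarrow> (g has_real_derivative g' x) (at x within {p..q})"
    and cont: "(g \<longlongrightarrow> g a) (at a within {p..q})"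
    and lim: "(g' \<longlongrightarrow> 0) (at a within {p..q})"
  shows "(g has_real_derivative 0) (at a within {p..q})"
proof -
  have C: "continuous_on {p..q} g"
    unfolding continuous_on_def
    using cont deriv DERIV_continuous by (metis DiffI a continuous_within singletonD)
  have "((\<lambda>x. (g x - g a) / (x - a)) \<longlongrightarrow> 0) (at a within {p..q})"
  proof (rule tendstoI)
    fix e :: real assume "e > 0"
    with lim obtain \<eta> where \<eta>: "\<eta> > 0"
      "\<And>x. x \<in> {p..q} \<Longrightarrow> x \<noteq> a \<Longrightarrow> \<bar>x - a\<bar> < \<eta> \<Longrightarrow> \<bar>g' x\<bar> < e"
      by (force simp: tendsto_iff eventually_at dist_real_def)
    have "\<bar>(g x - g a) / (x - a)\<bar> < e" if x: "x \<in> {p..q}" "x \<noteq> a" "\<bar>x - a\<bar> < \<eta>" for x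
    proof -
      define u v where "u = min x a" and "v = max x a"
      have uv: "u < v" "{u..v} \<subseteq> {p..q}" "\<And>z. u < z \<Longrightarrow> z < v \<Longrightarrow> z \<noteq> a \<and> \<bar>z - a\<bar> < \<eta>"
        using x a by (auto simp: u_def v_def min_def max_def split: if_splits)
      have D: "(g has_real_derivative g' z) (at z)" if "u < z" "z < v" for z
      proof -
        have "z \<in> interior {p..q}"
          using that interior_mono[OF uv(2)] by (auto simp: interior_atLeastAtMost_real)
        then show ?thesis
          using deriv[of z] uv(3)[OF that] interior_subset at_within_interior
          by (metis DiffI singletonD subsetD)
      qed
      obtain l z where z: "u < z" "z < v" "(g has_real_derivative l) (at z)" "g v - g u = (v - u) * l"
        using MVT[of u v g] D uv continuous_on_subset[OF C uv(2)] by (metis real_differentiable_def)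
      then have "l = g' z"
        using D DERIV_unique by blast
      moreover have "\<bar>g' z\<bar> < e"
        using \<eta>(2)[of z] uv z by auto
      moreover have "(g x - g a) / (x - a) = (g v - g u) / (v - u)"
        by (cases "x \<le> a") (auto simp: u_def v_def divide_simps mult_ac algebra_simps)
      ultimately show ?thesis
        using z uv by simp
    qed
    then show "\<forall>\<^sub>F x in at a within {p..q}. dist ((g x - g a) / (x - a)) 0 < e"
      using \<eta>(1) by (auto simp: eventually_at dist_real_def)
  qed
  then show ?thesis
    by (simp add: has_field_derivative_iff)
qed

lemma power_times_geometric_tendsto_0:
  fixes q :: real
  assumes "0 < q" "q < 1"
  shows "(\<lambda>n. real n ^ m * q ^ n) \<longlonglongrightarrow> 0"
proof (cases "m = 0")
  case True
  then show ?thesis using LIMSEQ_power_zero[of q] assms by simp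
next
  case False
  define p where "p = root m q"
  have p: "0 \<le> p" "p < 1" "p ^ m = q"
    using False assms by (auto simp: p_def)
  have "(\<lambda>n. (real n * p ^ n) ^ m) \<longlonglongrightarrow> 0 ^ m"
    using powser_times_n_limit_0[of p] p by (intro tendsto_power) auto
  moreover have "(real n * p ^ n) ^ m = real n ^ m * q ^ n" for n
    by (simp add: power_mult_distrib p(3)[symmetric] flip: power_mult) (simp add: mult.commute)
  ultimately show ?thesis using False by (simp add: power_0_left)
qed

lemma mem_segment_iff: "(x::real) \<in> closed_segment p q \<longleftrightarrow> p \<le> x \<and> x \<le> q \<or> q \<le> x \<and> x \<le> p"
  by (auto simp: closed_segment_eq_real_ivl)

section \<open>Parameters and marked points\<close>

text \<open>The locale names the auxiliary functions \<open>s\<close> and \<open>\<phi>\<close>, over which \<open>is_fr\<close> quantifies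
  existentially; its other assumptions are the conjuncts of \<open>is_fr\<close>.\<close>

locale ruette_map =
  fixes l :: real and r :: nat and f :: "real \<Rightarrow> real"
    and s \<phi> :: "nat \<Rightarrow> real \<Rightarrow> real"
  assumes l_ge: "l \<ge> 14" and r_ge: "r \<ge> 1"
    and smooth: "C_infinity_on (I - {1}) f"
    and s_cond: "s_conditions l r s"
    and f_osc: "\<forall>n\<ge>1. \<forall>x\<in>{xpt n..ypt n}.
           f x = l powi (- (int n * int r)) *
             (xpt n + (ypt n - xpt n) * s n (M_seq l n * ((x - xpt n) / (ypt n - xpt n))))"
    and f_aff: "\<forall>n\<ge>1. \<forall>x\<in>{ypt (n + 1)..wpt l r n}.
        f x = l powi (- (int (n + 1) * int r)) * ypt (n + 1) +
          l powi (- (int (n + 1) * int r)) * M_seq l (n + 1) * k_seq l r (n + 1) * (x - ypt (n + 1))"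
    and phi_cond: "phi_conditions l r f \<phi>"
    and f_phi: "\<forall>n\<ge>1. \<forall>t\<in>{0..1}.
           f (wpt l r n + len l r n * t) = f (wpt l r n) + height l r f n * \<phi> n t"
    and f_zero: "\<forall>x\<in>{0..5/2 * \<delta> l r}. f x = l ^ r * x"
    and f_half: "\<forall>x. \<bar>x - 1/2\<bar> \<le> \<delta> l r \<longrightarrow> f x = 4 - 3/2 * inverse (\<delta> l r) * (x - 1/2)^2"
    and f_one: "\<forall>x\<in>{1 - \<delta> l r..1}. f x = \<delta> l r powi (1 - 2 * int r) * (x - 1) ^ (2 * r)"
    and f_four: "\<forall>x\<in>{4 - 3/2 * \<delta> l r..4}. f x = 4 + l ^ r * (x - 4)"
    and df_left: "\<forall>x\<in>{5/2 * \<delta> l r..1/2 - \<delta> l r}.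
        3/2 \<le> nderiv_on I 1 f x \<and> nderiv_on I 1 f x \<le> l ^ r"
    and df_mid: "\<forall>x\<in>{1/2 + \<delta> l r..1 - \<delta> l r}.
        - (l ^ r) \<le> nderiv_on I 1 f x \<and> nderiv_on I 1 f x \<le> - 3/2"
    and df_right: "\<forall>x\<in>{ypt 1..4}. 3/2 \<le> nderiv_on I 1 f x \<and> nderiv_on I 1 f x \<le> l ^ r"
begin

abbreviation "L \<equiv> l ^ r"
abbreviation "d \<equiv> \<delta> l r"
abbreviation "M \<equiv> M_seq l"
abbreviation "w \<equiv> wpt l r"
abbreviation "gap n \<equiv> ypt n - xpt n"

lemma l_le_L: "l \<le> L"
  using self_le_power[of l r] l_ge r_ge by simp

lemma L_ge: "14 \<le> L"
  using l_le_L l_ge by simp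

lemma d_eq: "d = 1 / L"
  by (simp add: \<delta>_def power_int_minus field_simps)

lemma d_L: "d * L = 1" "L * d = 1"
proof -
  have "L \<noteq> 0" using L_ge by linarith
  then show "d * L = 1" "L * d = 1" unfolding d_eq by (auto simp del: power_eq_0_iff)
qed

lemma d_pos: "0 < d"
  using L_ge by (simp add: d_eq)

lemma d_le: "d \<le> 1 / 14"
  using L_ge by (simp add: d_eq field_simps)

lemma d_power_L: "d ^ Suc n * L = d ^ n"
proof -
  have "d ^ Suc n * L = (d * L) * d ^ n" by (simp only: power_Suc mult_ac)
  then show ?thesis by (simp add: d_L)
qed

lemma d_power_pos: "0 < d ^ n"
  using d_pos by simp

lemma d_power_le_1: "d ^ n \<le> 1"
  using d_pos d_le by (intro power_le_one) auto

lemma powi_eq: "l powi (- (int n * int r)) = d ^ n"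
proof -
  have "l powi (- (int n * int r)) = inverse (l ^ (n * r))"
    by (simp add: power_int_minus flip: of_nat_mult power_int_of_nat)
  also have "\<dots> = d ^ n"
    by (simp add: d_eq power_mult[symmetric] power_one_over mult.commute inverse_eq_divide)
  finally show ?thesis .
qed

lemma powi_Suc_eq: "l powi (- (int (n + 1) * int r)) = d ^ Suc n"
  using powi_eq[of "Suc n"] by simp

lemma gap_eq: "gap n = 1 / (2 * real n ^ 2)"
  by (simp add: ypt_def)

lemma gap_pos: "n \<ge> 1 \<Longrightarrow> 0 < gap n"
  by (simp add: gap_eq)

lemma xpt_bounds: "n \<ge> 1 \<Longrightarrow> 1 < xpt n \<and> xpt n \<le> 2"
  by (simp add: xpt_def)

lemma ypt_bounds:
  assumes "n \<ge> 1" shows "1 < ypt n \<and> ypt n \<le> 5/2"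
proof -
  have "1 / (2 * real n ^ 2) \<le> 1 / 2"
    using assms by (simp add: field_simps one_le_power)
  moreover have "1 / real n \<le> 1" "1 / real n > 0" "1 / (2 * real n ^ 2) > 0"
    using assms by simp_all
  ultimately show ?thesis unfolding ypt_def xpt_def by linarith
qed

lemma ypt_1: "ypt 1 = 5/2" "ypt (Suc 0) = 5/2"
  by (simp_all add: ypt_def xpt_def)

lemma m_bounds: "n \<ge> 1 \<Longrightarrow> 3/4 \<le> m_seq n \<and> m_seq n < 1"
  using power_mono[of 2 "real n + 1" 2] by (simp add: m_seq_def field_simps)

text \<open>The minimum \<open>- m_n\<close> of \<open>s_n\<close> is chosen so that \<open>x_n + g_n s_n\<close> has minimum \<open>y_(n+1)\<close>: one return of a
  fold of \<open>[x_n, y_n]\<close> ends at a marked point again.\<close>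

lemma ypt_Suc: "n \<ge> 1 \<Longrightarrow> ypt (Suc n) = xpt n - m_seq n * gap n"
proof -
  assume "n \<ge> 1"
  then have "real n \<noteq> 0" "real n + 1 \<noteq> 0" by auto
  then show ?thesis
    unfolding ypt_def xpt_def m_seq_def
    by (simp add: divide_simps power2_eq_square add.commute) algebra
qed

lemma l_power_ge: "n \<ge> 1 \<Longrightarrow> 14 * real n ^ 2 \<le> l ^ n"
proof (induction n rule: dec_induct)
  case base
  then show ?case using l_ge by simp
next
  case (step n)
  have "real (Suc n) \<le> 2 * real n"
    using step by simp
  then have "real (Suc n) ^ 2 \<le> (2 * real n) ^ 2"
    by (intro power_mono) auto
  then have "14 * real (Suc n) ^ 2 \<le> 14 * (14 * real n ^ 2)"
  proof -
    have "(2 * real n) ^ 2 = 4 * real n ^ 2" by simp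
    then show ?thesis
      using \<open>real (Suc n) ^ 2 \<le> (2 * real n) ^ 2\<close> zero_le_power2[of "real n"] by linarith
  qed
  also have "\<dots> \<le> l * l ^ n"
    using step l_ge by (intro mult_mono) auto
  finally show ?case by simp
qed

text \<open>The natural number whose image in the reals is \<open>M_seq l n\<close>; it is used to index the laps.\<close>

definition "laps n = nat (2 * \<lfloor>l ^ n / (2 * real n ^ 2)\<rfloor> - 1)"

lemma floor_ge:
  assumes "n \<ge> 1" shows "7 \<le> \<lfloor>l ^ n / (2 * real n ^ 2)\<rfloor>"
  using l_power_ge[OF assms] assms by (simp add: le_floor_iff field_simps)

lemma M_eq: "n \<ge> 1 \<Longrightarrow> M n = real (laps n)"
  using floor_ge[of n] by (simp add: M_seq_def laps_def of_nat_nat del: numeral_le_floor)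

lemma laps_ge: "n \<ge> 1 \<Longrightarrow> 13 \<le> laps n"
  using floor_ge[of n] unfolding laps_def by linarith

lemma laps_odd: "n \<ge> 1 \<Longrightarrow> odd (laps n)"
proof -
  assume "n \<ge> 1"
  define F where "F = \<lfloor>l ^ n / (2 * real n ^ 2)\<rfloor>"
  have "7 \<le> F" using floor_ge[OF \<open>n \<ge> 1\<close>] by (simp only: F_def)
  then have "nat (2 * F - 1) = 2 * nat (F - 1) + 1" by linarith
  then show ?thesis by (simp add: laps_def flip: F_def)
qed

lemma M_ge: "n \<ge> 1 \<Longrightarrow> 13 \<le> M n"
  using laps_ge[of n] by (simp add: M_eq)

lemma M_le: "n \<ge> 1 \<Longrightarrow> M n \<le> l ^ n / real n ^ 2"
proof -
  have "2 * (l ^ n / (2 * real n ^ 2)) = l ^ n / real n ^ 2" by simp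
  then show ?thesis
    using of_int_floor_le[of "l ^ n / (2 * real n ^ 2)"] unfolding M_seq_def by linarith
qed

lemma M_k: "n \<ge> 1 \<Longrightarrow> M n * k_seq l r n = 2 * L"
  using M_ge[of n] by (simp add: k_seq_def)

text \<open>Away from its folds, the return map \<open>f^(n+1)\<close> of \<open>[x_n, y_n]\<close> has slope at least this product. The
  bound rests on \<open>M_n \<ge> 13\<close>, a consequence of \<open>l \<ge> 14\<close>.\<close>

lemma M_slope: "n \<ge> 1 \<Longrightarrow> 13/2 \<le> M n * min (1/2) (k_seq l r n)"
  using M_ge[of n] M_k[of n] L_ge by (auto simp: min_def)

lemma m_gap: "n \<ge> 1 \<Longrightarrow> m_seq n * gap n = (real n + 2) / (2 * real n * (real n + 1)^2)"
proof -
  assume "n \<ge> 1"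
  then have "real n \<noteq> 0" "real n + 1 \<noteq> 0" by auto
  then have "m_seq n = real n * (real n + 2) / (real n + 1)^2"
    by (simp add: m_seq_def divide_simps) (simp add: power2_eq_square algebra_simps)
  with \<open>real n \<noteq> 0\<close> show ?thesis
    by (simp add: gap_eq power2_eq_square)
qed

text \<open>In this form the role of \<open>w_n\<close> is visible: as \<open>x_n - y_(n+1) = m_n * gap n\<close>, it is the point that the
  affine piece of slope \<open>2 d^n\<close> starting at \<open>(y_(n+1), d^(n+1) y_(n+1))\<close> sends to \<open>d^(n+1) x_n\<close>.\<close>

lemma w_eq: 
  assumes "n \<ge> 1"
  shows "w n = ypt (Suc n) + m_seq n * gap n * d / 2"
proof -
  have "M (Suc n) * k_seq l r (Suc n) = 2 * L"
    by (rule M_k) simp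
  then have "w n = ypt (Suc n) + (real n + 2) / (2 * real n * (real n + 1)^2 * (2 * L))"
    unfolding wpt_def by (simp add: mult.assoc)
  also have "(real n + 2) / (2 * real n * (real n + 1)^2 * (2 * L)) = m_seq n * gap n * d / 2"
    unfolding m_gap[OF assms] d_eq by simp
  finally show ?thesis .
qed

lemma order_points:
  assumes "n \<ge> 1"
  shows "ypt (Suc n) < w n" "w n < xpt n" "xpt n < ypt n"
    "w n - ypt (Suc n) = m_seq n * gap n * d / 2"
    "xpt n - ypt (Suc n) = m_seq n * gap n"
proof -
  have "0 < m_seq n * gap n"
    using gap_pos m_bounds[OF assms] assms by simp
  moreover from this have "m_seq n * gap n * d < m_seq n * gap n * 2"
    using d_le by (intro mult_strict_left_mono) auto
  ultimately show "ypt (Suc n) < w n" "w n < xpt n"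
    using d_pos by (auto simp: w_eq[OF assms] ypt_Suc[OF assms])
  show "xpt n < ypt n" using gap_pos[OF assms] by simp
qed (use assms in \<open>auto simp: w_eq ypt_Suc\<close>)

section \<open>The oscillating functions\<close>

lemma s_range:
  assumes "n \<ge> 1" "0 \<le> t" "t \<le> M n"
  shows "- m_seq n \<le> s n t" "s n t \<le> 1"
  using s_cond assms unfolding s_conditions_def by (fastforce simp: image_subset_iff)+

lemma s_smooth: "n \<ge> 1 \<Longrightarrow> C_infinity_on {0..M n} (s n)"
  and s_0: "n \<ge> 1 \<Longrightarrow> s n 0 = 0"
  and s_M: "n \<ge> 1 \<Longrightarrow> s n (M n) = 1"
  and s_start: "n \<ge> 1 \<Longrightarrow> 0 \<le> t \<Longrightarrow> t \<le> d \<Longrightarrow> s n t = k_seq l r n * t"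
  and s_end: "n \<ge> 1 \<Longrightarrow> M n - d \<le> t \<Longrightarrow> t \<le> M n \<Longrightarrow> s n t = k_seq l r n * (t - M n) + 1"
  and s_deriv_bound: "j \<ge> 1 \<Longrightarrow> \<exists>A. \<forall>n\<ge>1. sup_norm_on {0..M n} (nderiv_on {0..M n} j (s n)) \<le> A"
  and s_deriv_le: "n \<ge> 1 \<Longrightarrow> sup_norm_on {0..M n} (nderiv_on {0..M n} 1 (s n)) \<le> L"
  using s_cond unfolding s_conditions_def by (auto simp del: nderiv_on.simps)

lemma s_lap_mono:
  assumes "n \<ge> 1" "even i" "i < laps n"
  shows "mono_on {real i..real i + 1} (s n)"
proof -
  from \<open>even i\<close> obtain j where j: "i = 2 * j" by blast
  from laps_odd[OF assms(1)] obtain K where K: "laps n = 2 * K + 1" by (blast elim: oddE)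
  have "real j \<le> (M n - 1) / 2"
    using assms j K by (simp add: M_eq)
  then have "mono_on {2 * real j..2 * real j + 1} (s n)"
    using s_cond assms(1) unfolding s_conditions_def by blast
  then show ?thesis by (simp add: j)
qed

lemma s_lap_antimono:
  assumes "n \<ge> 1" "odd i" "i < laps n"
  shows "antimono_on {real i..real i + 1} (s n)"
proof -
  from \<open>odd i\<close> obtain j where j: "i = 2 * j + 1" by (blast elim: oddE)
  from laps_odd[OF assms(1)] obtain K where K: "laps n = 2 * K + 1" by (blast elim: oddE)
  have "real j \<le> (M n - 3) / 2"
    using assms j K by (simp add: M_eq)
  then have "antimono_on {2 * real j + 1..2 * real j + 2} (s n)"
    using s_cond assms(1) unfolding s_conditions_def by blast
  then show ?thesis by (simp add: j add_ac)
qed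

lemma s_local_max:
  assumes "n \<ge> 1" "local_max_on {0..M n} (s n) a" "a \<noteq> M n" "x \<in> {0..M n}" "\<bar>x - a\<bar> \<le> d"
  shows "s n x = 1 - C_const l r * (x - a)^2"
  using s_cond assms unfolding s_conditions_def by blast

lemma s_local_min:
  assumes "n \<ge> 1" "local_min_on {0..M n} (s n) a" "a \<noteq> 0" "x \<in> {0..M n}" "\<bar>x - a\<bar> \<le> d"
  shows "s n x = - m_seq n + C_const l r * (x - a)^2"
  using s_cond assms unfolding s_conditions_def by blast

text \<open>Monotonicity on the two adjacent laps makes an odd integer a local maximum, to which the
  prescribed quadratic shape applies; even integers are treated in the same way.\<close>

lemma s_near_odd:
  assumes n: "n \<ge> 1" and i: "odd i" "i < laps n" and x: "\<bar>x - real i\<bar> \<le> d"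
  shows "s n x = 1 - C_const l r * (x - real i)^2"
proof (rule s_local_max[OF n])
  have i0: "i \<ge> 1" using i(1) by (cases i) auto
  have "real i + 1 \<le> M n" using i(2) n by (simp add: M_eq)
  then show "x \<in> {0..M n}" "real i \<noteq> M n"
    using x d_le i0 by (auto simp: abs_le_iff)
  have "s n y \<le> s n i" if "y \<in> {0..M n}" "\<bar>y - real i\<bar> < 1" for y
  proof (cases "y \<le> i")
    case True
    moreover have "mono_on {real (i - 1)..real (i - 1) + 1} (s n)"
      using i by (intro s_lap_mono[OF n]) auto
    moreover have "real (i - 1) = real i - 1" using i0 by simp
    ultimately show ?thesis
      using that mono_onD[of "{real i - 1..real i}" "s n" y "real i"] by simp
  next
    case False
    then show ?thesis
      using monotone_onD[OF s_lap_antimono[OF n i], of "real i" y] that by auto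
  qed
  then show "local_max_on {0..M n} (s n) (real i)"
    unfolding local_max_on_def using \<open>real i + 1 \<le> M n\<close>
    by (auto intro!: exI[of _ 1])
qed (use x in auto)

lemma s_near_even:
  assumes n: "n \<ge> 1" and i: "even i" "0 < i" "i < laps n" and x: "\<bar>x - real i\<bar> \<le> d"
  shows "s n x = - m_seq n + C_const l r * (x - real i)^2"
proof (rule s_local_min[OF n])
  have "real i + 1 \<le> M n" using i(3) n by (simp add: M_eq)
  then show "x \<in> {0..M n}" "real i \<noteq> 0"
    using x d_le i(2) by (auto simp: abs_le_iff)
  have "s n i \<le> s n y" if "y \<in> {0..M n}" "\<bar>y - real i\<bar> < 1" for y
  proof (cases "y \<le> i")
    case True
    moreover have "antimono_on {real (i - 1)..real (i - 1) + 1} (s n)"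
      using i by (intro s_lap_antimono[OF n]) auto
    moreover have "real (i - 1) = real i - 1" using i(2) by simp
    ultimately show ?thesis
      using that monotone_onD[of "{real i - 1..real i}" "(\<le>)" "(\<ge>)" "s n" y "real i"] by simp
  next
    case False
    then show ?thesis
      using monotone_onD[OF s_lap_mono[OF n i(1,3)], of "real i" y] that by auto
  qed
  then show "local_min_on {0..M n} (s n) (real i)"
    unfolding local_min_on_def using \<open>real i + 1 \<le> M n\<close>
    by (auto intro!: exI[of _ 1])
qed (use x in auto)

text \<open>A nonstrict local extremum inside a lap would, by monotonicity, come with a constant stretch
  of \<open>s n\<close>, which the prescribed strict quadratic shape around it excludes. So the lower bound on \<open>|s_n'|\<close>
  is available at distance \<open>d\<close> from the integers.\<close>

lemma s_extremum_integer:
  assumes n: "n \<ge> 1" and x: "0 < x" "x < M n"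
    and ex: "local_max_on {0..M n} (s n) x \<or> local_min_on {0..M n} (s n) x"
  shows "\<exists>i. x = real i"
proof (rule ccontr)
  assume non: "\<nexists>i. x = real i"
  define i where "i = nat \<lfloor>x\<rfloor>"
  have "real i \<le> x" "x < real i + 1"
    using x unfolding i_def by (auto simp: of_nat_nat)
  with non have i: "real i < x" "x < real i + 1" by (auto simp: less_le)
  then have il: "i < laps n" using x n by (simp add: M_eq)
  then have iM: "real i + 1 \<le> M n" using n by (simp add: M_eq)
  have C: "C_const l r > 0"
    using d_pos by (simp add: C_const_def)
  obtain e where e: "e > 0" "(\<forall>y\<in>{0..M n}. \<bar>y - x\<bar> < e \<longrightarrow> s n y \<le> s n x) \<or>
      (\<forall>y\<in>{0..M n}. \<bar>y - x\<bar> < e \<longrightarrow> s n x \<le> s n y)"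
    using ex unfolding local_max_on_def local_min_on_def by blast
  \<comment> \<open>A distance within which \<open>x\<close> is extremal, the quadratic formula holds and the lap is not left.\<close>
  define h where "h = min (e / 2) (min d (min (x - i) (i + 1 - x))) "
  have h: "0 < h" "h < e" "h \<le> d" "h \<le> x - i" "h \<le> i + 1 - x"
    using e i d_pos unfolding h_def by auto
  have neq: "s n (x + h) \<noteq> s n x" "s n (x - h) \<noteq> s n x"
  proof -
    have *: "x + h \<in> {0..M n}" "x - h \<in> {0..M n}" "x \<in> {0..M n}" using h i iM by auto
    have "s n (x + h) \<noteq> s n x \<and> s n (x - h) \<noteq> s n x"
      using ex
    proof
      assume "local_max_on {0..M n} (s n) x"
      from s_local_max[OF n this] * x h C show ?thesis by auto
    next
      assume "local_min_on {0..M n} (s n) x"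
      from s_local_min[OF n this] * x h C show ?thesis by auto
    qed
    then show "s n (x + h) \<noteq> s n x" "s n (x - h) \<noteq> s n x" by auto
  qed
  have in_lap: "x \<in> {real i..real i + 1}" "x + h \<in> {real i..real i + 1}" "x - h \<in> {real i..real i + 1}"
    using h i by auto
  have "(s n (x - h) \<le> s n x \<and> s n x \<le> s n (x + h)) \<or> (s n (x - h) \<ge> s n x \<and> s n x \<ge> s n (x + h))"
  proof (cases "even i")
    case True
    note mono_onD[OF s_lap_mono[OF n True il]]
    from this[OF in_lap(3,1)] this[OF in_lap(1,2)] h(1) show ?thesis by auto
  next
    case False
    note monotone_onD[OF s_lap_antimono[OF n False il]]
    from this[OF in_lap(3,1)] this[OF in_lap(1,2)] h(1) show ?thesis by auto
  qed
  moreover have "\<bar>(x + h) - x\<bar> < e" "\<bar>(x - h) - x\<bar> < e" "x + h \<in> {0..M n}" "x - h \<in> {0..M n}"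
    using h i iM by auto
  ultimately show False
    using e(2) neq by (meson antisym)
qed

text \<open>The end points \<open>0\<close> and \<open>M_n\<close> are no folds, so nothing has to be cut off there.\<close>

lemma s_expand_middle:
  assumes n: "n \<ge> 1" and i: "i < laps n" and ab: "real i \<le> a" "a < b" "b \<le> real i + 1"
    and lo: "i \<noteq> 0 \<Longrightarrow> real i + d \<le> a" and hi: "i + 1 \<noteq> laps n \<Longrightarrow> b \<le> real i + 1 - d"
  shows "min (1/2) (k_seq l r n) * (b - a) \<le> \<bar>s n b - s n a\<bar>"
proof -
  have iM: "real i + 1 \<le> M n" using i n by (simp add: M_eq)
  obtain x where x: "a < x" "x < b" "s n b - s n a = (b - a) * nderiv_on {0..M n} 1 (s n) x"
    using C_infinity_on_mvt[OF s_smooth[OF n], of a b] ab iM by auto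
  have "d \<le> \<bar>x - y\<bar>" if y: "y \<in> {0<..<M n}"
    "local_max_on {0..M n} (s n) y \<or> local_min_on {0..M n} (s n) y" for y
  proof -
    obtain k where k: "y = real k" using s_extremum_integer[OF n _ _ y(2)] y(1) by auto
    show ?thesis
    proof (cases "k \<le> i")
      case True
      then have "i \<noteq> 0" using y(1) k by auto
      then show ?thesis using lo x True k by (auto simp: abs_if)
    next
      case False
      then have "i + 1 \<noteq> laps n" using y(1) k n by (auto simp: M_eq)
      moreover have "real i + 1 \<le> real k" using False by auto
      ultimately show ?thesis using hi x k by (auto simp: abs_if)
    qed
  qed
  then have "min (1/2) (k_seq l r n) \<le> \<bar>nderiv_on {0..M n} 1 (s n) x\<bar>"
    using s_cond n x ab iM unfolding s_conditions_def by (auto simp del: nderiv_on.simps)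
  then show ?thesis
    using x(3) ab(2) by (simp add: abs_mult mult.commute)
qed

section \<open>The shape of \<open>f\<close> to the right of 1\<close>

lemma phi_smooth: "n \<ge> 1 \<Longrightarrow> C_infinity_on {0..1} (\<phi> n)"
  and phi_deriv_0: "n \<ge> 1 \<Longrightarrow> nderiv_on {0..1} 1 (\<phi> n) 0 = 2 * inverse (height l r f n) * len l r n * d ^ n"
  and phi_deriv: "n \<ge> 1 \<Longrightarrow> t \<in> {0..1} \<Longrightarrow> 2/3 * nderiv_on {0..1} 1 (\<phi> n) 0 \<le> nderiv_on {0..1} 1 (\<phi> n) t
      \<and> nderiv_on {0..1} 1 (\<phi> n) t \<le> L"
  and phi_deriv_bound: "j \<ge> 1 \<Longrightarrow> \<exists>B. \<forall>n\<ge>1. sup_norm_on {0..1} (nderiv_on {0..1} j (\<phi> n)) \<le> B"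
  using phi_cond unfolding phi_conditions_def by (auto simp add: powi_eq simp del: nderiv_on.simps)

text \<open>The inverse of the rescaling \<open>t = M_n (x - x_n) / g_n\<close> that is used to define \<open>f\<close> on \<open>[x_n, y_n]\<close>: the laps
  of \<open>f\<close> are the images of the intervals between consecutive integers.\<close>

definition node :: "nat \<Rightarrow> real \<Rightarrow> real" where
  "node n t = xpt n + gap n * t / M n"

lemma node_0: "node n 0 = xpt n"
  by (simp add: node_def)

lemma node_M: "n \<ge> 1 \<Longrightarrow> node n (M n) = ypt n"
  using M_ge[of n] by (simp add: node_def)

lemma node_diff: "node n t - node n u = gap n / M n * (t - u)"
  by (simp add: node_def algebra_simps add_divide_distrib diff_divide_distrib)

lemma gap_over_M_pos: "n \<ge> 1 \<Longrightarrow> 0 < gap n / M n"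
  using gap_pos[of n] M_ge[of n] by simp

lemma node_mono: "n \<ge> 1 \<Longrightarrow> t \<le> u \<longleftrightarrow> node n t \<le> node n u"
  using gap_over_M_pos[of n] node_diff[of n u t] by (metis diff_ge_0_iff_ge zero_le_mult_iff less_le_not_le order_less_imp_le)

lemma node_coord:
  assumes "n \<ge> 1" "x \<in> {xpt n..ypt n}"
  obtains t where "0 \<le> t" "t \<le> M n" "x = node n t"
proof
  let ?t = "M n * ((x - xpt n) / gap n)"
  show "x = node n ?t"
    using M_ge[OF assms(1)] gap_pos[OF assms(1)] by (simp add: node_def)
  then show "0 \<le> ?t" "?t \<le> M n"
    using assms node_mono[of n 0 ?t] node_mono[of n ?t "M n"] node_0[of n] node_M[of n] by auto
qed

lemma f_node:
  assumes n: "n \<ge> 1" and t: "0 \<le> t" "t \<le> M n"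
  shows "f (node n t) = d ^ n * (xpt n + gap n * s n t)"
proof -
  have "node n t \<in> {xpt n..ypt n}"
    using node_mono[OF n, of 0 t] node_mono[OF n, of t "M n"] t node_0 node_M[OF n] by auto
  moreover have "M n * ((node n t - xpt n) / gap n) = t"
    using M_ge[OF n] gap_pos[OF n] by (simp add: node_def)
  ultimately show ?thesis
    using f_osc n by (simp add: powi_eq)
qed

lemma f_xpt: "n \<ge> 1 \<Longrightarrow> f (xpt n) = d ^ n * xpt n"
  using f_node[of n 0] s_0[of n] M_ge[of n] by (simp add: node_0)

lemma f_ypt: "n \<ge> 1 \<Longrightarrow> f (ypt n) = d ^ n * ypt n"
  using f_node[of n "M n"] s_M[of n] M_ge[of n] by (simp add: node_M)

lemma f_affine_piece:
  assumes "n \<ge> 1" "x \<in> {ypt (Suc n)..w n}"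
  shows "f x = d ^ Suc n * (ypt (Suc n) + 2 * L * (x - ypt (Suc n)))"
proof -
  have "f x = d ^ Suc n * ypt (Suc n) + d ^ Suc n * M (Suc n) * k_seq l r (Suc n) * (x - ypt (Suc n))"
    using f_aff assms powi_Suc_eq[of n] by simp
  also have "d ^ Suc n * M (Suc n) * k_seq l r (Suc n) = d ^ Suc n * (2 * L)"
    using M_k[of "Suc n"] by (simp only: mult.assoc)
  finally show ?thesis by (simp only: distrib_left mult.assoc)
qed

lemma f_w: 
  assumes "n \<ge> 1" shows "f (w n) = d ^ Suc n * xpt n"
proof -
  have "2 * L * (w n - ypt (Suc n)) = (d * L) * (xpt n - ypt (Suc n))"
    unfolding order_points[OF assms] by simp
  then show ?thesis
    using f_affine_piece[of n "w n"] order_points(1)[OF assms] assms by (simp add: d_L)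
qed

lemma height_eq: "n \<ge> 1 \<Longrightarrow> height l r f n = xpt n * d ^ n * (1 - d)"
  by (simp add: height_def f_xpt f_w algebra_simps)

lemma height_bounds: "n \<ge> 1 \<Longrightarrow> 0 < height l r f n \<and> height l r f n \<le> 2 * d ^ n"
proof -
  assume n: "n \<ge> 1"
  have "xpt n * d ^ n * (1 - d) \<le> (2 * d ^ n) * 1"
    using xpt_bounds[OF n] d_power_pos[of n] d_pos d_le by (intro mult_mono) auto
  then show ?thesis
    using xpt_bounds[OF n] d_power_pos[of n] d_le unfolding height_eq[OF n] by simp
qed

lemma len_ge: 
  assumes "n \<ge> 1" shows "1 / (3 * real n ^ 2) \<le> len l r n"
proof -
  have "len l r n = m_seq n * gap n * (1 - d / 2)"
    using order_points(4,5)[OF assms] by (simp add: len_def algebra_simps)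
  moreover have "3/4 * gap n * (27/28) \<le> m_seq n * gap n * (1 - d / 2)"
    using m_bounds[OF assms] gap_pos[OF assms] d_le by (intro mult_mono) auto
  moreover have "1 / (3 * real n ^ 2) \<le> 3/4 * gap n * (27/28)"
    unfolding gap_eq using assms by (simp add: field_simps)
  ultimately show ?thesis by linarith
qed

lemma len_pos: "n \<ge> 1 \<Longrightarrow> 0 < len l r n"
  using order_points[of n] by (simp add: len_def)

lemma f_phi_piece:
  assumes "n \<ge> 1" "x \<in> {w n..xpt n}"
  shows "f x = f (w n) + height l r f n * \<phi> n (1 / len l r n * (x - w n))"
    and "1 / len l r n * (x - w n) \<in> {0..1}"
proof -
  show *: "1 / len l r n * (x - w n) \<in> {0..1}"
    using len_pos[OF assms(1)] assms(2) by (auto simp: len_def divide_simps)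
  have "w n + len l r n * (1 / len l r n * (x - w n)) = x"
    using len_pos[OF assms(1)] by simp
  then show "f x = f (w n) + height l r f n * \<phi> n (1 / len l r n * (x - w n))"
    using f_phi assms(1) * by metis
qed

text \<open>The lower bound on \<open>\<phi>_n'\<close> is relative to \<open>\<phi>_n'(0)\<close>, whose prescribed value makes the slope of \<open>f\<close> at \<open>w_n\<close>
  equal to \<open>2 d^n\<close>.\<close>

lemma f_expand_phi:
  assumes n: "n \<ge> 1" and ab: "w n \<le> a" "a < b" "b \<le> xpt n"
  shows "4/3 * d ^ n * (b - a) \<le> f b - f a"
proof -
  let ?c = "1 / len l r n" and ?h = "height l r f n"
  let ?t = "\<lambda>x. ?c * (x - w n)"
  have t: "?t a \<in> {0..1}" "?t b \<in> {0..1}" "?t a < ?t b"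
    using f_phi_piece(2)[OF n, of a] f_phi_piece(2)[OF n, of b] ab len_pos[OF n]
    by (auto simp: divide_strict_right_mono)
  obtain z where z: "?t a < z" "z < ?t b"
      "\<phi> n (?t b) - \<phi> n (?t a) = (?t b - ?t a) * nderiv_on {0..1} 1 (\<phi> n) z"
    using C_infinity_on_mvt[OF phi_smooth[OF n], of "?t a" "?t b"] t by auto
  have h: "0 < ?h" using height_bounds[OF n] by simp
  have "f b - f a = ?h * (\<phi> n (?t b) - \<phi> n (?t a))"
    using f_phi_piece(1)[OF n, of a] f_phi_piece(1)[OF n, of b] ab by (simp add: algebra_simps)
  also have "\<dots> = ?h * (?t b - ?t a) * nderiv_on {0..1} 1 (\<phi> n) z"
    using z(3) by simp
  also have "\<dots> \<ge> ?h * (?t b - ?t a) * (2/3 * nderiv_on {0..1} 1 (\<phi> n) 0)"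
    using phi_deriv[OF n, of z] z t h by (intro mult_left_mono) auto
  also have "?h * (?t b - ?t a) * (2/3 * nderiv_on {0..1} 1 (\<phi> n) 0) = 4/3 * d ^ n * (b - a)"
    unfolding phi_deriv_0[OF n] using h len_pos[OF n] by (simp add: field_simps)
  finally show ?thesis .
qed

lemma piece_cover:
  assumes "N \<ge> 1" "1 < x" "x \<le> ypt N"
  obtains n where "n \<ge> N" "ypt (Suc n) \<le> x" "x \<le> ypt n"
proof -
  have "ypt \<longlonglongrightarrow> 1 + 0 + 0"
    unfolding ypt_def xpt_def
    by (intro tendsto_add tendsto_const lim_1_over_n)
       (rule tendsto_eq_rhs[OF tendsto_mult[OF tendsto_const[of "1/2"] tendsto_power[OF lim_1_over_n, of 2]], 
          THEN tendsto_cong[THEN iffD1, rotated]], auto simp: power_divide)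
  then have "\<forall>\<^sub>F n in sequentially. ypt n < x"
    using assms(2) order_tendstoD(2) by fastforce
  then obtain m where m: "ypt m < x" "m \<ge> N"
    by (metis eventually_sequentially linorder_le_cases order_refl)
  then have ex: "\<exists>k. k \<ge> N \<and> ypt (Suc k) \<le> x"
    using assms(3) by (intro exI[of _ "m - 1"]) (cases m; cases "m = N"; auto)
  define k where "k = (LEAST k. k \<ge> N \<and> ypt (Suc k) \<le> x)"
  have k: "k \<ge> N" "ypt (Suc k) \<le> x"
    using LeastI_ex[OF ex] by (auto simp: k_def)
  have "x \<le> ypt k"
  proof (cases "k = N")
    case False
    then have "\<not> (k - 1 \<ge> N \<and> ypt (Suc (k - 1)) \<le> x)"
      using not_less_Least[of "k - 1" "\<lambda>k. k \<ge> N \<and> ypt (Suc k) \<le> x"] k(1) assms(1) by (auto simp: k_def[symmetric])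
    then show ?thesis using False k(1) assms(1) by auto
  qed (use assms in simp)
  with k that show thesis by blast
qed

section \<open>Derivatives of \<open>f\<close>\<close>

lemma nderiv_I_eq: "x \<in> I - {1} \<Longrightarrow> nderiv_on I j f x = nderiv_on (I - {1}) j f x"
  using nderiv_on_Int_open[of "- {1}" x I j f] by (simp add: Diff_eq open_Compl)

lemma nderiv_I_piece:
  assumes "p < q" "{p..q} \<subseteq> I - {1}" "x \<in> {p..q}"
  shows "nderiv_on I j f x = nderiv_on {p..q} j f x"
  using assms nderiv_I_eq[of x j] nderiv_on_subset[OF smooth, of "{p..q}" x j] at_within_Icc_nontrivial[OF \<open>p < q\<close>]
  by (metis subsetD)

lemma has_derivative_I:
  assumes "x \<in> I - {1}"
  shows "(nderiv_on I j f has_real_derivative nderiv_on I (Suc j) f x) (at x within I)"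
proof -
  have "(nderiv_on (I - {1}) j f has_real_derivative nderiv_on I (Suc j) f x) (at x within (I - {1}))"
    unfolding nderiv_I_eq[OF assms] by (rule C_infinity_on_has_derivative[OF smooth assms])
  then have "(nderiv_on I j f has_real_derivative nderiv_on I (Suc j) f x) (at x within (I - {1}))"
    by (rule has_derivative_eq_on[rotated 2]) (use assms nderiv_I_eq in auto)
  moreover have "at x within (I - {1}) = at x within I"
    using assms by (intro at_within_nhd[of x "- {1}"]) auto
  ultimately show ?thesis by simp
qed

lemma f_mvt:
  assumes "a < b" "{a..b} \<subseteq> I - {1}"
  obtains \<xi> where "a < \<xi>" "\<xi> < b" "f b - f a = (b - a) * nderiv_on I 1 f \<xi>"
proof -
  from C_infinity_on_mvt[OF smooth assms(2,1)] obtain \<xi> where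
    "\<xi> \<in> {a<..<b}" "f b - f a = (b - a) * nderiv_on (I - {1}) 1 f \<xi>" by blast
  moreover from this have "\<xi> \<in> I - {1}"
    using assms(2) by (meson atLeastAtMost_iff greaterThanLessThan_iff less_imp_le subsetD)
  then have "nderiv_on (I - {1}) 1 f \<xi> = nderiv_on I 1 f \<xi>"
    by (rule nderiv_I_eq[symmetric])
  ultimately show thesis using that by auto
qed

lemma f_one_eq: "1 - d \<le> x \<Longrightarrow> x \<le> 1 \<Longrightarrow> f x = 1 / d ^ (2 * r - 1) * (x - 1) ^ (2 * r)"
proof -
  assume "1 - d \<le> x" "x \<le> 1"
  moreover have "1 - 2 * int r = - int (2 * r - 1)"
    using r_ge by simp
  ultimately show ?thesis
    using f_one by (simp add: power_int_minus inverse_eq_divide del: of_nat_diff)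
qed

lemma f_1: "f 1 = 0"
  using f_one_eq[of 1] d_pos r_ge by simp

lemma nderiv_left_of_1:
  assumes "1 - d \<le> x" "x < 1"
  shows "nderiv_on I j f x = 1 / d ^ (2 * r - 1) * (\<Prod>i<j. real (2 * r - i)) * (x - 1) ^ (2 * r - j)"
proof -
  let ?S = "{1 - d..1} - {1}"
  have nt: "at y within ?S \<noteq> bot" if "y \<in> ?S" for y
    using that d_pos by (intro at_within_Icc_diff_nontrivial) auto
  have "nderiv_on I j f x = nderiv_on (I - {1}) j f x"
    using assms d_le by (intro nderiv_I_eq) (auto simp: I_def)
  also have "\<dots> = nderiv_on ?S j f x"
    using assms d_le nt by (intro nderiv_on_subset[OF smooth, symmetric]) (auto simp: I_def)
  also have "\<dots> = 1 / d ^ (2 * r - 1) * (\<Prod>i<j. real (2 * r - i)) * (x - 1) ^ (2 * r - j)"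
    using assms nt f_one_eq by (intro nderiv_on_shifted_power) auto
  finally show ?thesis .
qed

lemma nderiv_osc:
  assumes n: "n \<ge> 1" and x: "x \<in> {xpt n..ypt n}" and j: "j \<ge> 1"
  shows "\<bar>nderiv_on I j f x\<bar> \<le> d ^ n * gap n * (M n / gap n) ^ j *
    sup_norm_on {0..M n} (nderiv_on {0..M n} j (s n))"
proof -
  let ?c = "M n / gap n"
  have c: "0 \<le> ?c" using M_ge[OF n] gap_pos[OF n] by simp
  have sub: "{xpt n..ypt n} \<subseteq> I - {1}"
    using xpt_bounds[OF n] ypt_bounds[OF n] by (auto simp: I_def)
  have T: "?c * (y - xpt n) \<in> {0..M n}" if "y \<in> {xpt n..ypt n}" for y
  proof -
    have "?c * (y - xpt n) \<le> ?c * gap n" using that c by (intro mult_left_mono) auto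
    moreover have "0 \<le> ?c * (y - xpt n)" using that c by (intro mult_nonneg_nonneg) auto
    ultimately show ?thesis using gap_pos[OF n] by simp
  qed
  have "nderiv_on I j f x = nderiv_on {xpt n..ypt n} j f x"
    using nderiv_I_piece[OF order_points(3)[OF n] sub x] .
  also have "\<dots> = (if j = 0 then d ^ n * xpt n else 0) + d ^ n * gap n * ?c ^ j *
      nderiv_on {0..M n} j (s n) (?c * (x - xpt n))"
    using f_osc n T x at_within_Icc_nontrivial[OF order_points(3)[OF n]]
    by (intro nderiv_on_affine[OF s_smooth[OF n]]) (auto simp: powi_eq distrib_left mult.assoc)
  finally have "\<bar>nderiv_on I j f x\<bar> = d ^ n * gap n * ?c ^ j * \<bar>nderiv_on {0..M n} j (s n) (?c * (x - xpt n))\<bar>"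
    using j c d_power_pos[of n] gap_pos[OF n] by (simp add: abs_mult)
  also have "\<dots> \<le> d ^ n * gap n * ?c ^ j * sup_norm_on {0..M n} (nderiv_on {0..M n} j (s n))"
    using c d_power_pos[of n] gap_pos[OF n] sup_norm_on_nderiv_bound[OF s_smooth[OF n] T[OF x]]
    by (intro mult_left_mono) auto
  finally show ?thesis .
qed

lemma nderiv_affine_piece:
  assumes n: "n \<ge> 1" and x: "x \<in> {ypt (Suc n)..w n}" and j: "j \<ge> 1"
  shows "\<bar>nderiv_on I j f x\<bar> \<le> 2 * d ^ n"
proof -
  obtain i where i: "j = Suc i" using j by (cases j) auto
  have sub: "{ypt (Suc n)..w n} \<subseteq> I - {1}"
    using xpt_bounds[OF n] ypt_bounds[of "Suc n"] order_points[OF n] by (auto simp: I_def)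
  have "nderiv_on I j f x = nderiv_on {ypt (Suc n)..w n} j f x"
    using nderiv_I_piece[OF order_points(1)[OF n] sub x] .
  also have "\<dots> = (if i = 0 then 2 * (d ^ Suc n * L) else 0)"
    unfolding i using x at_within_Icc_nontrivial[OF order_points(1)[OF n]] f_affine_piece[OF n]
    by (intro nderiv_on_affine_map[where A = "d ^ Suc n * ypt (Suc n) - 2 * (d ^ Suc n * L) * ypt (Suc n)"])
       (auto simp: algebra_simps)
  finally show ?thesis
    using d_power_pos[of n] unfolding d_power_L by (auto split: if_splits)
qed

lemma nderiv_phi_piece:
  assumes n: "n \<ge> 1" and x: "x \<in> {w n..xpt n}" and j: "j \<ge> 1"
  shows "\<exists>t\<in>{0..1}. nderiv_on I j f x = height l r f n * (1 / len l r n) ^ j * nderiv_on {0..1} j (\<phi> n) t"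
proof -
  have sub: "{w n..xpt n} \<subseteq> I - {1}"
    using xpt_bounds[OF n] ypt_bounds[of "Suc n"] order_points[OF n] by (auto simp: I_def)
  have "nderiv_on I j f x = nderiv_on {w n..xpt n} j f x"
    using nderiv_I_piece[OF order_points(2)[OF n] sub x] .
  also have "\<dots> = (if j = 0 then f (w n) else 0) + height l r f n * (1 / len l r n) ^ j *
      nderiv_on {0..1} j (\<phi> n) (1 / len l r n * (x - w n))"
    using f_phi_piece[OF n] x at_within_Icc_nontrivial[OF order_points(2)[OF n]]
    by (intro nderiv_on_affine[OF phi_smooth[OF n]]) blast+
  finally show ?thesis
    using j f_phi_piece(2)[OF n x] by auto
qed

lemma l_power_le_L: "l ^ n \<le> L ^ n"
  using l_le_L l_ge by (intro power_mono) auto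

lemma d_power_L_power: "d ^ n * L ^ n = 1"
  using d_L by (simp flip: power_mult_distrib)

text \<open>The bound has one summand for each of the three kinds of pieces. On the oscillating ones the
  powers of \<open>l\<close> cancel for \<open>j = r\<close> and only \<open>g_n = 1 / (2 n^2)\<close> remains.\<close>

lemma nderiv_estimate:
  assumes j: "1 \<le> j" "j \<le> r"
  shows "\<exists>E. E \<longlonglongrightarrow> 0 \<and> (\<forall>n\<ge>1. \<forall>x\<in>{ypt (Suc n)..ypt n}. \<bar>nderiv_on I j f x\<bar> \<le> E n)"
proof -
  obtain A where A: "\<And>n. n \<ge> 1 \<Longrightarrow> sup_norm_on {0..M n} (nderiv_on {0..M n} j (s n)) \<le> A"
    using s_deriv_bound[OF j(1)] by blast
  obtain B where B: "\<And>n. n \<ge> 1 \<Longrightarrow> sup_norm_on {0..1} (nderiv_on {0..1} j (\<phi> n)) \<le> B"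
    using phi_deriv_bound[OF j(1)] by blast
  define E where "E n = \<bar>A\<bar> * 2 ^ j * (1/2) * (1 / real n) ^ 2 + 2 * d ^ n + \<bar>B\<bar> * 2 * 3 ^ j * (real n ^ (2 * j) * d ^ n)" for n
  have "E \<longlonglongrightarrow> \<bar>A\<bar> * 2 ^ j * (1/2) * 0 ^ 2 + 2 * 0 + \<bar>B\<bar> * 2 * 3 ^ j * 0"
    unfolding E_def using d_pos d_le
    by (intro tendsto_intros lim_1_over_n LIMSEQ_power_zero power_times_geometric_tendsto_0) auto
  then have lim: "E \<longlonglongrightarrow> 0" by simp
  have "\<bar>nderiv_on I j f x\<bar> \<le> E n" if n: "n \<ge> 1" and x: "x \<in> {ypt (Suc n)..ypt n}" for n x
  proof -
    have nonneg: "0 \<le> \<bar>A\<bar> * 2 ^ j * (1/2) * (1 / real n) ^ 2" "0 \<le> 2 * d ^ n"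
      "0 \<le> \<bar>B\<bar> * 2 * 3 ^ j * (real n ^ (2 * j) * d ^ n)"
      using d_power_pos[of n] by simp_all
    consider "x \<in> {xpt n..ypt n}" | "x \<in> {ypt (Suc n)..w n}" | "x \<in> {w n..xpt n}"
      using x by fastforce
    then show ?thesis
    proof cases
      case 1
      \<comment> \<open>Here \<open>j \<le> r\<close> is needed: it gives \<open>l^(n j) \<le> L^n\<close>, which \<open>d^n\<close> cancels.\<close>
      have "M n / gap n \<le> 2 * l ^ n"
        using M_le[OF n] n unfolding gap_eq by (simp add: field_simps)
      then have "(M n / gap n) ^ j \<le> (2 * l ^ n) ^ j"
        using M_ge[OF n] gap_pos[OF n] by (intro power_mono) auto
      also have "\<dots> \<le> 2 ^ j * L ^ n"
      proof -
        have "(l ^ n) ^ j \<le> (l ^ n) ^ r"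
          using j(2) l_ge by (intro power_increasing) (auto intro: one_le_power)
        then show ?thesis by (simp add: power_mult_distrib mult.commute flip: power_mult)
      qed
      finally have c: "(M n / gap n) ^ j \<le> 2 ^ j * L ^ n" .
      have "\<bar>nderiv_on I j f x\<bar> \<le> d ^ n * gap n * (M n / gap n) ^ j * sup_norm_on {0..M n} (nderiv_on {0..M n} j (s n))"
        by (rule nderiv_osc[OF n 1 j(1)])
      also have "\<dots> \<le> d ^ n * gap n * (M n / gap n) ^ j * \<bar>A\<bar>"
        using A[OF n] d_power_pos[of n] gap_pos[OF n] M_ge[OF n] by (intro mult_left_mono) auto
      also have "\<dots> \<le> d ^ n * gap n * (2 ^ j * L ^ n) * \<bar>A\<bar>"
        using c d_power_pos[of n] gap_pos[OF n] by (intro mult_left_mono mult_right_mono) auto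
      also have "\<dots> = (d ^ n * L ^ n) * gap n * 2 ^ j * \<bar>A\<bar>" by (simp only: mult_ac)
      also have "\<dots> = \<bar>A\<bar> * 2 ^ j * (1/2) * (1 / real n) ^ 2"
        unfolding d_power_L_power gap_eq by (simp add: power_divide)
      also have "\<dots> \<le> E n" using nonneg unfolding E_def by linarith
      finally show ?thesis .
    next
      case 2
      from nderiv_affine_piece[OF n this j(1)] nonneg show ?thesis
        unfolding E_def by linarith
    next
      case 3
      from nderiv_phi_piece[OF n this j(1)] obtain t where t: "t \<in> {0..1}"
        and eq: "nderiv_on I j f x = height l r f n * (1 / len l r n) ^ j * nderiv_on {0..1} j (\<phi> n) t"
        by blast
      have "\<bar>nderiv_on {0..1} j (\<phi> n) t\<bar> \<le> \<bar>B\<bar>"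
        using sup_norm_on_nderiv_bound[OF phi_smooth[OF n] t, of j] B[OF n] by linarith
      moreover have "1 / len l r n \<le> 3 * real n ^ 2"
        using len_ge[OF n] len_pos[OF n] n by (simp add: field_simps)
      then have "(1 / len l r n) ^ j \<le> (3 * real n ^ 2) ^ j"
        using len_pos[OF n] by (intro power_mono) auto
      moreover have "height l r f n \<le> 2 * d ^ n" "0 \<le> height l r f n"
        using height_bounds[OF n] by auto
      ultimately have "height l r f n * (1 / len l r n) ^ j * \<bar>nderiv_on {0..1} j (\<phi> n) t\<bar>
          \<le> (2 * d ^ n) * (3 * real n ^ 2) ^ j * \<bar>B\<bar>"
        using len_pos[OF n] d_power_pos[of n] by (intro mult_mono) auto
      also have "\<dots> = \<bar>B\<bar> * 2 * 3 ^ j * (real n ^ (2 * j) * d ^ n)"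
        by (simp add: power_mult_distrib power_mult)
      also have "\<dots> \<le> E n" using nonneg unfolding E_def by linarith
      finally show ?thesis
        unfolding eq using height_bounds[OF n] len_pos[OF n] by (simp add: abs_mult)
    qed
  qed
  with lim show ?thesis by blast
qed

section \<open>Smoothness at 1 and the norm of the derivative\<close>

lemma I_cases:
  assumes "x \<in> I"
  obtains "x \<in> {0..5/2 * d}" | "x \<in> {5/2 * d..1/2 - d}" | "\<bar>x - 1/2\<bar> \<le> d"
    | "x \<in> {1/2 + d..1 - d}" | "1 - d \<le> x" "x < 1" | "x = 1" | "1 < x" "x \<le> 5/2" | "x \<in> {5/2..4}"
proof -
  have "0 \<le> x" "x \<le> 4" using assms by (auto simp: I_def)
  then have "x \<in> {0..5/2 * d} \<or> x \<in> {5/2 * d..1/2 - d} \<or> \<bar>x - 1/2\<bar> \<le> d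
    \<or> x \<in> {1/2 + d..1 - d} \<or> (1 - d \<le> x \<and> x < 1) \<or> x = 1 \<or> (1 < x \<and> x \<le> 5/2) \<or> x \<in> {5/2..4}"
    unfolding atLeastAtMost_iff abs_le_iff by linarith
  then show thesis using that by blast
qed

lemma f_bounds_right_of_1:
  assumes n: "n \<ge> 1" and x: "x \<in> {ypt (Suc n)..ypt n}"
  shows "0 < f x" "f x \<le> 5/2 * d ^ n"
proof -
  consider "x \<in> {xpt n..ypt n}" | "x \<in> {ypt (Suc n)..w n}" | "x \<in> {w n..xpt n}"
    using x by fastforce
  then have "0 < f x \<and> f x \<le> d ^ n * (5/2)"
  proof cases
    case 1
    then obtain t where t: "0 \<le> t" "t \<le> M n" "x = node n t" using node_coord[OF n] by blast
    have "gap n * (- m_seq n) \<le> gap n * s n t" "gap n * s n t \<le> gap n * 1"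
      using s_range[OF n t(1,2)] gap_pos[OF n] by (intro mult_left_mono; simp)+
    then have "ypt (Suc n) \<le> xpt n + gap n * s n t" "xpt n + gap n * s n t \<le> ypt n"
      using ypt_Suc[OF n] by (simp_all add: mult.commute)
    then have "0 < xpt n + gap n * s n t" "xpt n + gap n * s n t \<le> 5/2"
      using ypt_bounds[OF n] ypt_bounds[of "Suc n"] by auto
    then show ?thesis
      unfolding t(3) f_node[OF n t(1,2)] using d_power_pos[of n] by (auto intro!: mult_left_mono)
  next
    case 2
    have "f x \<le> d ^ Suc n * (ypt (Suc n) + 2 * L * (w n - ypt (Suc n)))"
      unfolding f_affine_piece[OF n 2] using 2 d_power_pos[of "Suc n"] L_ge
      by (intro mult_left_mono add_left_mono) auto
    also have "\<dots> = f (w n)"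
      using f_affine_piece[OF n, of "w n"] order_points(1)[OF n] by simp
    also have "\<dots> = (d * d ^ n) * xpt n" by (simp add: f_w[OF n])
    also have "\<dots> \<le> (1 * d ^ n) * (5/2)"
      using d_pos d_le d_power_pos[of n] xpt_bounds[OF n] by (intro mult_mono mult_right_mono) auto
    finally have "f x \<le> d ^ n * (5/2)" by simp
    moreover have "0 < f x"
      unfolding f_affine_piece[OF n 2] using 2 d_power_pos[of "Suc n"] L_ge ypt_bounds[of "Suc n"]
      by (intro mult_pos_pos add_pos_nonneg) auto
    ultimately show ?thesis by simp
  next
    case 3
    have "f (w n) \<le> f x" "f x \<le> f (xpt n)"
    proof -
      have mono: "f a \<le> f b" if "w n \<le> a" "a < b" "b \<le> xpt n" for a b
      proof -
        have "0 \<le> 4/3 * d ^ n * (b - a)" using that d_power_pos[of n] by simp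
        then show ?thesis using f_expand_phi[OF n that] by linarith
      qed
      show "f (w n) \<le> f x" using mono[of "w n" x] 3 by (cases "x = w n") auto
      show "f x \<le> f (xpt n)" using mono[of x "xpt n"] 3 by (cases "x = xpt n") auto
    qed
    moreover have "0 < f (w n)"
      unfolding f_w[OF n] using d_power_pos[of "Suc n"] xpt_bounds[OF n] by (intro mult_pos_pos) auto
    moreover have "f (xpt n) \<le> d ^ n * (5/2)"
      unfolding f_xpt[OF n] using d_power_pos[of n] xpt_bounds[OF n] by (intro mult_left_mono) auto
    ultimately show ?thesis by simp
  qed
  then show "0 < f x" "f x \<le> 5/2 * d ^ n" by simp_all
qed

text \<open>The convergence holds up to order \<open>r\<close> on the right by the estimates on the pieces, and up to order
  \<open>2 r - 1\<close> on the left, where \<open>f\<close> is a multiple of \<open>(x - 1)^(2 r)\<close>.\<close>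

lemma nderiv_tendsto_0_at_1:
  assumes "j \<le> r"
  shows "(nderiv_on I j f \<longlongrightarrow> 0) (at 1 within I)"
proof -
  have "\<exists>E. E \<longlonglongrightarrow> 0 \<and> (\<forall>n\<ge>1. \<forall>x\<in>{ypt (Suc n)..ypt n}. \<bar>nderiv_on I j f x\<bar> \<le> E n)"
  proof (cases "j = 0")
    case True
    have "(\<lambda>n. 5/2 * d ^ n) \<longlonglongrightarrow> 5/2 * 0"
      using d_pos d_le by (intro tendsto_intros LIMSEQ_power_zero) auto
    then show ?thesis
      using True f_bounds_right_of_1 by (intro exI[of _ "\<lambda>n. 5/2 * d ^ n"]) (auto simp: abs_of_pos)
  qed (use nderiv_estimate assms in auto)
  then obtain E where E: "E \<longlonglongrightarrow> 0"
    "\<And>n x. n \<ge> 1 \<Longrightarrow> x \<in> {ypt (Suc n)..ypt n} \<Longrightarrow> \<bar>nderiv_on I j f x\<bar> \<le> E n" by blast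
  have "(nderiv_on I j f \<longlongrightarrow> 0) (at_right 1)"
  proof (rule tendstoI)
    fix e :: real assume "e > 0"
    then have "\<forall>\<^sub>F n in sequentially. E n < e" using E(1) order_tendstoD(2) by blast
    then obtain N where N: "\<And>n. n \<ge> N \<Longrightarrow> E n < e" by (auto simp: eventually_sequentially)
    define N' where "N' = max N 1"
    have "\<bar>nderiv_on I j f x\<bar> < e" if x: "1 < x" "x < ypt N'" for x
    proof -
      obtain n where "n \<ge> N'" "ypt (Suc n) \<le> x" "x \<le> ypt n"
        using piece_cover[of N' x] x by (auto simp: N'_def)
      then show ?thesis using E(2)[of n x] N[of n] by (auto simp: N'_def)
    qed
    then show "\<forall>\<^sub>F x in at_right 1. dist (nderiv_on I j f x) 0 < e"
      using ypt_bounds[of N'] unfolding eventually_at_right_field N'_def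
      by (intro exI[of _ "ypt (max N 1)"]) (auto simp: dist_real_def)
  qed
  moreover have "(nderiv_on I j f \<longlongrightarrow> 0) (at_left 1)"
  proof -
    define c where "c = 1 / d ^ (2 * r - 1) * (\<Prod>i<j. real (2 * r - i))"
    have "((\<lambda>x. c * (x - 1) ^ (2 * r - j)) \<longlongrightarrow> c * (1 - 1) ^ (2 * r - j)) (at_left (1::real))"
      by (intro tendsto_intros)
    then have "((\<lambda>x. c * (x - 1) ^ (2 * r - j)) \<longlongrightarrow> 0) (at_left (1::real))"
      using zero_power[of "2 * r - j", where 'a = real] assms r_ge by simp
    moreover have "\<forall>\<^sub>F x in at_left 1. c * (x - 1) ^ (2 * r - j) = nderiv_on I j f x"
      unfolding eventually_at_left_field c_def using d_pos nderiv_left_of_1[of _ j]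
      by (intro exI[of _ "1 - d"]) auto
    ultimately show ?thesis
      by (rule Lim_transform_eventually)
  qed
  ultimately have "(nderiv_on I j f \<longlongrightarrow> 0) (at 1)"
    by (simp add: filterlim_at_split)
  then show ?thesis by (rule tendsto_within_subset[of _ _ _ UNIV]) simp
qed

lemma has_derivative_I_at_1_step:
  assumes "j < r" "nderiv_on I j f 1 = 0"
  shows "(nderiv_on I j f has_real_derivative 0) (at 1 within I)"
proof -
  have I: "{0..4} = I" and one_in: "1 \<in> I" by (auto simp: I_def)
  show ?thesis
    using has_derivative_from_limit[of 1 0 4 "nderiv_on I j f" "nderiv_on I (Suc j) f", unfolded I]
      has_derivative_I[of _ j] nderiv_tendsto_0_at_1[of j] nderiv_tendsto_0_at_1[of "Suc j"] assms one_in
    by (simp del: nderiv_on.simps)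
qed

lemma nderiv_at_1: "j \<le> r \<Longrightarrow> nderiv_on I j f 1 = 0"
proof (induction j)
  case (Suc j)
  have "at 1 within I \<noteq> bot"
    unfolding I_def by (rule at_within_Icc_nontrivial) auto
  then show ?case
    using Suc has_derivative_I_at_1_step[of j] nderiv_on_SucI by simp
qed (simp add: f_1)

lemma has_derivative_I_at_1: "j < r \<Longrightarrow> (nderiv_on I j f has_real_derivative 0) (at 1 within I)"
  using has_derivative_I_at_1_step nderiv_at_1 by simp

theorem f_C_r: "C_k_on r I f"
  unfolding C_k_on_def
proof safe
  fix j x assume jx: "j < r" "x \<in> I"
  show "nderiv_on I j f differentiable (at x within I)"
    unfolding real_differentiable_def
    using has_derivative_I[of x j] has_derivative_I_at_1[of j] jx by (cases "x = 1") blast+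
next
  show "continuous_on I (nderiv_on I r f)"
    unfolding continuous_on_def
  proof
    fix x assume "x \<in> I"
    show "(nderiv_on I r f \<longlongrightarrow> nderiv_on I r f x) (at x within I)"
    proof (cases "x = 1")
      case True
      then show ?thesis using nderiv_tendsto_0_at_1[of r] nderiv_at_1[of r] by simp
    next
      case False
      then have "(nderiv_on I r f has_real_derivative nderiv_on I (Suc r) f x) (at x within I)"
        using \<open>x \<in> I\<close> by (intro has_derivative_I) auto
      then show ?thesis
        using DERIV_continuous continuous_within by blast
    qed
  qed
qed

lemma f_continuous: "continuous_on I f"
  unfolding continuous_on_eq_continuous_within
proof
  fix x assume "x \<in> I"
  then have "\<exists>D. (f has_real_derivative D) (at x within I)"
    using has_derivative_I[of x 0] has_derivative_I_at_1[of 0] r_ge by (cases "x = 1") auto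
  then show "continuous (at x within I) f"
    using DERIV_continuous by blast
qed

lemma nderiv_zero_piece: 
  assumes "x \<in> {0..5/2 * d}" shows "nderiv_on I 1 f x = L"
proof -
  have "nderiv_on I 1 f x = nderiv_on {0..5/2 * d} 1 f x"
    using assms d_pos d_le by (intro nderiv_I_piece) (auto simp: I_def)
  also have "\<dots> = (if (0::nat) = 0 then L else 0)"
    unfolding One_nat_def
    using assms d_pos f_zero by (intro nderiv_on_affine_map[where A = 0] at_within_Icc_nontrivial) auto
  finally show ?thesis by simp
qed

lemma nderiv_half_piece: 
  assumes "\<bar>x - 1/2\<bar> \<le> d" shows "\<bar>nderiv_on I 1 f x\<bar> \<le> 3"
proof -
  let ?S = "{1/2 - d..1/2 + d}"
  have *: "\<bar>- 3 * inverse e * u\<bar> = 3 * (\<bar>u\<bar> / e)" if "0 < e" for e u :: real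
    using that by (simp add: abs_mult inverse_eq_divide)
  have x: "x \<in> ?S" using assms by (auto simp: abs_le_iff)
  have "((\<lambda>x. 4 - 3/2 * inverse d * (x - 1/2)^2) has_real_derivative - 3 * inverse d * (x - 1/2)) (at x within ?S)"
    by (auto intro!: derivative_eq_intros)
  then have "(nderiv_on ?S 0 f has_real_derivative - 3 * inverse d * (x - 1/2)) (at x within ?S)"
    by (rule has_derivative_eq_on[rotated 2]) (use x f_half in \<open>auto simp: abs_le_iff\<close>)
  then have "nderiv_on ?S 1 f x = - 3 * inverse d * (x - 1/2)"
    unfolding One_nat_def using x d_pos by (intro nderiv_on_SucI at_within_Icc_nontrivial) auto
  moreover have "nderiv_on I 1 f x = nderiv_on ?S 1 f x"
    using x d_pos d_le by (intro nderiv_I_piece) (auto simp: I_def)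
  ultimately have "nderiv_on I 1 f x = - 3 * inverse d * (x - 1/2)"
    by (simp only:)
  then have "\<bar>nderiv_on I 1 f x\<bar> = 3 * (\<bar>x - 1/2\<bar> / d)"
    using * d_pos by (simp only:)
  also have "\<bar>x - 1/2\<bar> / d \<le> 1"
    using assms d_pos by simp
  finally show ?thesis by simp
qed

lemma two_r_le_L: "2 * real r \<le> L"
proof -
  have "real r \<le> 2 ^ r" using of_nat_less_two_power[of r, where 'a = real] by simp
  moreover have "(2::real) \<le> 2 ^ r" using r_ge self_le_power[of "2::real" r] by simp
  ultimately have "2 * real r \<le> 2 ^ r * 2 ^ r" by (intro mult_mono) auto
  also have "\<dots> = (2 * 2) ^ r" by (simp only: power_mult_distrib)
  also have "\<dots> \<le> L" using l_ge by (intro power_mono) auto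
  finally show ?thesis .
qed

lemma nderiv_le_L:
  assumes "x \<in> I" shows "\<bar>nderiv_on I 1 f x\<bar> \<le> L"
proof -
  from I_cases[OF assms] show ?thesis
  proof cases
    case 1 then show ?thesis using nderiv_zero_piece L_ge by (simp del: nderiv_on.simps)
  next
    case 2
    from df_left[rule_format, OF this] show ?thesis by linarith
  next
    case 3
    from nderiv_half_piece[OF this] L_ge show ?thesis by linarith
  next
    case 4
    from df_mid[rule_format, OF this] show ?thesis by linarith
  next
    case 5
    have e: "2 * r - 1 = Suc (2 * r - 2)" using r_ge by simp
    have "\<bar>x - 1\<bar> ^ (2 * r - 1) \<le> d ^ (2 * r - 1)"
      using 5 by (intro power_mono) auto
    then have "\<bar>x - 1\<bar> ^ (2 * r - 1) / d ^ (2 * r - 1) \<le> 1"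
      using d_power_pos[of "2 * r - 1"] by (simp add: divide_le_eq)
    then have "2 * real r * (\<bar>x - 1\<bar> ^ (2 * r - 1) / d ^ (2 * r - 1)) \<le> 2 * real r * 1"
      by (intro mult_left_mono) auto
    moreover have "\<bar>nderiv_on I 1 f x\<bar> = 2 * real r * (\<bar>x - 1\<bar> ^ (2 * r - 1) / d ^ (2 * r - 1))"
      unfolding nderiv_left_of_1[OF 5] using d_power_pos[of "2 * r - 1"] d_pos
      by (simp add: abs_mult power_abs)
    ultimately show ?thesis using two_r_le_L by linarith
  next
    case 6
    have "nderiv_on I 1 f x = 0" unfolding 6 using nderiv_at_1[of 1] r_ge by simp
    then show ?thesis using L_ge by simp
  next
    case 7
    then obtain n where n: "n \<ge> 1" "x \<in> {ypt (Suc n)..ypt n}"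
      using piece_cover[of 1 x] ypt_1 by auto
    then consider "x \<in> {xpt n..ypt n}" | "x \<in> {ypt (Suc n)..w n}" | "x \<in> {w n..xpt n}"
      by fastforce
    then show ?thesis
    proof cases
      case 1
      have "d ^ n * M n \<le> d ^ n * L ^ n"
      proof (intro mult_left_mono)
        have "l ^ n / real n ^ 2 \<le> l ^ n / 1"
          using n(1) l_ge by (intro divide_left_mono) (auto intro: one_le_power)
        then show "M n \<le> L ^ n" using M_le[OF n(1)] l_power_le_L[of n] by simp
      qed (use d_power_pos[of n] in simp)
      then have dM: "d ^ n * M n \<le> 1" by (simp add: d_power_L_power)
      have "\<bar>nderiv_on I 1 f x\<bar> \<le> d ^ n * gap n * (M n / gap n) ^ 1 *
          sup_norm_on {0..M n} (nderiv_on {0..M n} 1 (s n))"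
        by (rule nderiv_osc[OF n(1) 1]) simp
      also have "\<dots> \<le> d ^ n * gap n * (M n / gap n) ^ 1 * L"
        using s_deriv_le[OF n(1)] d_power_pos[of n] gap_pos[OF n(1)] M_ge[OF n(1)]
        by (intro mult_left_mono) auto
      also have "\<dots> = (d ^ n * M n) * L" using gap_pos[OF n(1)] by simp
      also have "\<dots> \<le> 1 * L" using dM L_ge by (intro mult_right_mono) auto
      finally show ?thesis by simp
    next
      case 2
      from nderiv_affine_piece[OF n(1) this, of 1] d_power_le_1[of n] L_ge show ?thesis by linarith
    next
      case 3
      from nderiv_phi_piece[OF n(1) this, of 1] obtain t where t: "t \<in> {0..1}"
        and eq: "nderiv_on I 1 f x = height l r f n * (1 / len l r n) * nderiv_on {0..1} 1 (\<phi> n) t"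
        by auto
      have h: "0 < height l r f n" "height l r f n \<le> 2 * d ^ n" using height_bounds[OF n(1)] by auto
      have "2 * d ^ n \<le> 1 / (3 * real n ^ 2)"
      proof -
        have "14 * real n ^ 2 \<le> L ^ n" using l_power_ge[OF n(1)] l_power_le_L[of n] by linarith
        then have "d ^ n * (14 * real n ^ 2) \<le> d ^ n * L ^ n"
          using d_power_pos[of n] by (intro mult_left_mono) auto
        then have "6 * (d ^ n * real n ^ 2) \<le> 1"
          unfolding d_power_L_power using d_power_pos[of n] n(1) by simp
        then show ?thesis using n(1) by (simp add: field_simps)
      qed
      then have "height l r f n * (1 / len l r n) \<le> 1"
        using h len_ge[OF n(1)] len_pos[OF n(1)] by simp
      moreover have "0 \<le> nderiv_on {0..1} 1 (\<phi> n) 0"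
        unfolding phi_deriv_0[OF n(1)] using h len_pos[OF n(1)] d_power_pos[of n] by simp
      then have "0 \<le> nderiv_on {0..1} 1 (\<phi> n) t" "nderiv_on {0..1} 1 (\<phi> n) t \<le> L"
        using phi_deriv[OF n(1) t] by auto
      moreover have "0 \<le> height l r f n * (1 / len l r n)" using h len_pos[OF n(1)] by simp
      ultimately have "0 \<le> nderiv_on I 1 f x" "nderiv_on I 1 f x \<le> 1 * L"
        unfolding eq by (rule_tac mult_nonneg_nonneg mult_mono; simp)+
      then show ?thesis by linarith
    qed
  next
    case 8
    then have "x \<in> {ypt 1..4}" by (simp add: ypt_1)
    from df_right[rule_format, OF this] show ?thesis by linarith
  qed
qed

theorem sup_norm_derivative: "sup_norm_on I (nderiv_on I 1 f) = L"
  unfolding sup_norm_on_def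
proof (rule cSup_eq_maximum)
  have "nderiv_on I 1 f 0 = L"
    by (rule nderiv_zero_piece) (use d_pos in simp)
  then have "L = \<bar>nderiv_on I 1 f 0\<bar>" using L_ge by linarith
  moreover have "0 \<in> I" by (simp add: I_def)
  ultimately show "L \<in> (\<lambda>x. \<bar>nderiv_on I 1 f x\<bar>) ` I" by (rule image_eqI)
next
  fix y assume "y \<in> (\<lambda>x. \<bar>nderiv_on I 1 f x\<bar>) ` I"
  then obtain x where "x \<in> I" "y = \<bar>nderiv_on I 1 f x\<bar>" by (rule imageE)
  then show "y \<le> L" using nderiv_le_L by (simp only:)
qed

section \<open>Values and growth of \<open>f\<close> on its outer pieces\<close>

lemma f_left_expand:
  assumes "5/2 * d \<le> a" "a \<le> b" "b \<le> 1/2 - d"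
  shows "3/2 * (b - a) \<le> f b - f a"
proof (cases "a = b")
  case False
  then have "a < b" using assms by simp
  have "{a..b} \<subseteq> I - {1}" using assms d_pos by (auto simp: I_def)
  obtain z where z: "a < z" "z < b" "f b - f a = (b - a) * nderiv_on I 1 f z"
    by (rule f_mvt[OF \<open>a < b\<close> \<open>{a..b} \<subseteq> I - {1}\<close>])
  have "z \<in> {5/2 * d..1/2 - d}" using z(1,2) assms by (simp)
  then have "3/2 \<le> nderiv_on I 1 f z"
    using df_left by blast
  then have "(b - a) * (3/2) \<le> (b - a) * nderiv_on I 1 f z"
    using \<open>a < b\<close> by (intro mult_left_mono) simp_all
  then show ?thesis using z(3) by linarith
qed simp

lemma f_mid_expand:
  assumes "1/2 + d \<le> a" "a \<le> b" "b \<le> 1 - d"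
  shows "3/2 * (b - a) \<le> f a - f b"
proof (cases "a = b")
  case False
  then have "a < b" using assms by simp
  have "{a..b} \<subseteq> I - {1}" using assms d_pos by (auto simp: I_def)
  obtain z where z: "a < z" "z < b" "f b - f a = (b - a) * nderiv_on I 1 f z"
    by (rule f_mvt[OF \<open>a < b\<close> \<open>{a..b} \<subseteq> I - {1}\<close>])
  have "z \<in> {1/2 + d..1 - d}" using z(1,2) assms by (simp)
  then have "nderiv_on I 1 f z \<le> - 3/2"
    using df_mid by blast
  then have "(b - a) * nderiv_on I 1 f z \<le> (b - a) * (- 3/2)"
    using \<open>a < b\<close> by (intro mult_left_mono) simp_all
  then show ?thesis using z(3) by linarith
qed simp

lemma f_right_expand:
  assumes "5/2 \<le> a" "a \<le> b" "b \<le> 4"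
  shows "3/2 * (b - a) \<le> f b - f a"
proof (cases "a = b")
  case False
  then have "a < b" using assms by simp
  have "{a..b} \<subseteq> I - {1}" using assms d_pos by (auto simp: I_def)
  obtain z where z: "a < z" "z < b" "f b - f a = (b - a) * nderiv_on I 1 f z"
    by (rule f_mvt[OF \<open>a < b\<close> \<open>{a..b} \<subseteq> I - {1}\<close>])
  have "z \<in> {ypt 1..4}" using z(1,2) assms by (simp add: ypt_1)
  then have "3/2 \<le> nderiv_on I 1 f z"
    using df_right by blast
  then have "(b - a) * (3/2) \<le> (b - a) * nderiv_on I 1 f z"
    using \<open>a < b\<close> by (intro mult_left_mono) simp_all
  then show ?thesis using z(3) by linarith
qed simp

lemma f_near_0: "0 \<le> x \<Longrightarrow> x \<le> 5/2 * d \<Longrightarrow> f x = L * x"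
  using f_zero by simp

lemma f_near_half: "\<bar>u\<bar> \<le> d \<Longrightarrow> f (1/2 + u) = 4 - 3/2 * L * u^2"
  using f_half[rule_format, of "1/2 + u"] by (simp add: d_eq)

lemma f_left_of_1: "0 \<le> u \<Longrightarrow> u \<le> d \<Longrightarrow> f (1 - u) = 1 / d ^ (2 * r - 1) * u ^ (2 * r)"
  using f_one_eq[of "1 - u"] by simp

lemma f_near_4: "0 \<le> v \<Longrightarrow> v \<le> 3/2 * d \<Longrightarrow> f (4 - v) = 4 - L * v"
  using f_four[rule_format, of "4 - v"] by simp

text \<open>The points where the formulas for \<open>f\<close> change are sent, after at most two steps, to \<open>5/2 = y_1\<close>, \<open>1\<close> or \<open>4\<close>.\<close>

lemma f_special_values:
  "f (5/2 * d) = 5/2" "f (1/2 - d) = 4 - 3/2 * d" "f (1/2 + d) = 4 - 3/2 * d" "f (1/2) = 4"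
  "f (1 - d) = d" "f d = 1" "f 4 = 4" "f (4 - 3/2 * d) = 5/2" "f 0 = 0" "f (5/2) = 5/2 * d"
proof -
  have "L * d^2 = (L * d) * d" by (simp only: power2_eq_square mult.assoc)
  then have dd: "L * d^2 = d" by (simp add: d_L)
  show "f (5/2 * d) = 5/2" using f_near_0[of "5/2 * d"] d_pos d_L by simp
  show "f (1/2 - d) = 4 - 3/2 * d" using f_near_half[of "- d"] d_pos dd by simp
  show "f (1/2 + d) = 4 - 3/2 * d" using f_near_half[of d] d_pos dd by simp
  show "f (1/2) = 4" using f_near_half[of 0] d_pos by simp
  show "f (1 - d) = d"
  proof -
    have "d ^ (2 * r) = d ^ (2 * r - 1) * d"
      using r_ge power_minus_mult[of "2 * r" d] by simp
    then show ?thesis using f_left_of_1[of d] d_pos by simp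
  qed
  show "f d = 1" using f_near_0[of d] d_pos d_L by simp
  show "f 4 = 4" using f_near_4[of 0] d_pos by simp
  show "f (4 - 3/2 * d) = 5/2" using f_near_4[of "3/2 * d"] d_pos d_L by simp
  show "f 0 = 0" using f_near_0[of 0] d_pos by simp
  show "f (5/2) = 5/2 * d" using f_ypt[of 1] by (simp add: ypt_1)
qed

lemma f_maps_I:
  assumes "x \<in> I" shows "f x \<in> I"
proof -
  from I_cases[OF assms] have "0 \<le> f x \<and> f x \<le> 4"
  proof cases
    case 1
    then have "L * x \<le> L * (5/2 * d)" using L_ge by (intro mult_left_mono) auto
    also have "L * (5/2 * d) = 5/2 * (L * d)" by simp
    finally show ?thesis using f_near_0[of x] 1 L_ge by (simp add: d_L)
  next
    case 2
    have "f (5/2 * d) \<le> f x" "f x \<le> f (1/2 - d)"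
      using f_left_expand[of "5/2 * d" x] f_left_expand[of x "1/2 - d"] 2 by auto
    then show ?thesis using f_special_values(1,2) d_pos by simp
  next
    case 3
    then have "(x - 1/2)^2 \<le> d^2" using abs_le_square_iff[of "x - 1/2" d] d_pos by simp
    then have "3/2 * L * (x - 1/2)^2 \<le> 3/2 * L * d^2" using L_ge by (intro mult_left_mono) auto
    also have "\<dots> = 3/2 * ((L * d) * d)" by (simp only: power2_eq_square mult.assoc)
    also have "\<dots> = 3/2 * d" by (simp add: d_L)
    finally show ?thesis using f_near_half[of "x - 1/2"] 3 d_le L_ge by simp
  next
    case 4
    have "f x \<le> f (1/2 + d)" "f (1 - d) \<le> f x"
      using f_mid_expand[of "1/2 + d" x] f_mid_expand[of x "1 - d"] 4 by auto
    then show ?thesis using f_special_values(3,5) d_pos by simp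
  next
    case 5
    have "(1 - x) ^ (2 * r) \<le> d ^ (2 * r)" using 5 by (intro power_mono) auto
    also have "\<dots> = d ^ (2 * r - 1) * d"
      using r_ge power_minus_mult[of "2 * r" d] by simp
    finally have "1 / d ^ (2 * r - 1) * (1 - x) ^ (2 * r) \<le> d"
      using d_power_pos[of "2 * r - 1"] by (simp add: divide_le_eq mult.commute)
    then show ?thesis
      using f_left_of_1[of "1 - x"] 5 d_power_pos[of "2 * r - 1"] d_le by simp
  next
    case 6
    then show ?thesis by (simp add: f_1)
  next
    case 7
    then obtain n where n: "n \<ge> 1" "x \<in> {ypt (Suc n)..ypt n}"
      using piece_cover[of 1 x] ypt_1 by auto
    then show ?thesis using f_bounds_right_of_1[OF n] d_power_le_1[of n] by simp
  next
    case 8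
    have "f (5/2) \<le> f x" "f x \<le> f 4"
      using f_right_expand[of "5/2" x] f_right_expand[of x 4] 8 by auto
    then show ?thesis using f_special_values(7,10) d_pos by simp
  qed
  then show ?thesis by (simp add: I_def)
qed

lemma zero_in_I: "0 \<in> I" and four_in_I: "4 \<in> I" and one_in_I: "1 \<in> I" and half_in_I: "1/2 \<in> I"
  by (auto simp: I_def)

lemma funpow_in_I: "x \<in> I \<Longrightarrow> (f ^^ n) x \<in> I"
  by (induction n) (auto simp: f_maps_I)

lemma funpow_continuous: "continuous_on I (f ^^ n)"
proof (induction n)
  case (Suc n)
  have "continuous_on I (f \<circ> (f ^^ n))"
    using Suc funpow_in_I by (intro continuous_on_compose continuous_on_subset[OF f_continuous]) auto
  then show ?case by simp
qed (simp add: continuous_on_id)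

lemma segment_in_I: "p \<in> I \<Longrightarrow> q \<in> I \<Longrightarrow> closed_segment p q \<subseteq> I"
  unfolding I_def by (intro closed_segment_subset) auto

lemma segment_subset_funpow_image:
  assumes "p \<in> I" "q \<in> I" and "p' \<in> closed_segment p q" "q' \<in> closed_segment p q"
  shows "closed_segment ((f ^^ n) p') ((f ^^ n) q') \<subseteq> (f ^^ n) ` closed_segment p q"
proof (rule closed_segment_subset)
  have "connected ((f ^^ n) ` closed_segment p q)"
    using continuous_on_subset[OF funpow_continuous segment_in_I[OF assms(1,2)]]
    by (intro connected_continuous_image) auto
  then show "convex ((f ^^ n) ` closed_segment p q)"
    by (simp add: is_interval_connected_1[symmetric] is_interval_convex_1[symmetric])
qed (use assms in auto)

section \<open>Segments whose iterates reach the fixed point 0\<close>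

text \<open>Unordered segments are used because the branches of \<open>f\<close> may reverse the orientation.\<close>

definition hits :: "real \<Rightarrow> real \<Rightarrow> bool" where
  "hits p q \<longleftrightarrow> (\<exists>n. 0 \<in> (f ^^ n) ` closed_segment p q)"

text \<open>A condition on both one-sided neighbourhoods of \<open>z\<close>, as \<open>q\<close> may lie on either side.\<close>

definition covers :: "real \<Rightarrow> bool" where
  "covers z \<longleftrightarrow> (\<forall>q\<in>I. q \<noteq> z \<longrightarrow> hits z q)"

lemma hits_commute: "hits p q \<longleftrightarrow> hits q p"
  by (simp add: hits_def closed_segment_commute)

lemma hits_mono:
  assumes "hits p' q'" "p' \<in> closed_segment p q" "q' \<in> closed_segment p q"
  shows "hits p q"
  using assms subset_closed_segment[of p' q' p q] unfolding hits_def by blast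

lemma hits_image:
  assumes "hits ((f ^^ n) p') ((f ^^ n) q')" "p \<in> I" "q \<in> I"
    and "p' \<in> closed_segment p q" "q' \<in> closed_segment p q"
  shows "hits p q"
proof -
  obtain m where "0 \<in> (f ^^ m) ` closed_segment ((f ^^ n) p') ((f ^^ n) q')"
    using assms(1) by (auto simp: hits_def)
  also have "\<dots> \<subseteq> (f ^^ m) ` (f ^^ n) ` closed_segment p q"
    using segment_subset_funpow_image[OF assms(2-5)] by (intro image_mono)
  also have "\<dots> = (f ^^ (m + n)) ` closed_segment p q"
    by (simp add: funpow_add image_comp)
  finally show ?thesis unfolding hits_def by blast
qed

lemma hits_1: "1 \<in> closed_segment p q \<Longrightarrow> hits p q"
  unfolding hits_def by (intro exI[of _ 1]) (force simp: f_1)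

text \<open>Lengths in \<open>I\<close> are at most \<open>4\<close>, so growth by a constant factor cannot be repeated forever without hitting.
  The relation \<open>D\<close> restricts the kind of segments considered and has to be reproduced by the step.\<close>

lemma hits_by_growth:
  assumes "1 < \<kappa>" and pq: "D p q" "p \<in> I" "q \<in> I" "p \<noteq> q"
    and step: "\<And>p q. D p q \<Longrightarrow> p \<in> I \<Longrightarrow> q \<in> I \<Longrightarrow> p \<noteq> q \<Longrightarrow> \<not> hits p q \<Longrightarrow>
      \<exists>n p' q'. p' \<in> closed_segment p q \<and> q' \<in> closed_segment p q \<and>
        D ((f ^^ n) p') ((f ^^ n) q') \<and> \<kappa> * \<bar>p - q\<bar> \<le> \<bar>(f ^^ n) p' - (f ^^ n) q'\<bar>"
  shows "hits p q"
proof (rule ccontr)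
  assume no: "\<not> hits p q"
  have "\<exists>a b. D a b \<and> a \<in> I \<and> b \<in> I \<and> \<not> hits a b \<and> \<kappa> ^ k * \<bar>p - q\<bar> \<le> \<bar>a - b\<bar>" for k
  proof (induction k)
    case 0
    then show ?case using pq no by auto
  next
    case (Suc k)
    then obtain a b where ab: "D a b" "a \<in> I" "b \<in> I" "\<not> hits a b" "\<kappa> ^ k * \<bar>p - q\<bar> \<le> \<bar>a - b\<bar>" by blast
    have "0 < \<kappa> ^ k * \<bar>p - q\<bar>" using assms by simp
    then have "a \<noteq> b" using ab(5) by auto
    from step[OF ab(1-3) this ab(4)] obtain n p' q' where n:
      "p' \<in> closed_segment a b" "q' \<in> closed_segment a b" "D ((f ^^ n) p') ((f ^^ n) q')"
      "\<kappa> * \<bar>a - b\<bar> \<le> \<bar>(f ^^ n) p' - (f ^^ n) q'\<bar>" by blast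
    moreover have "p' \<in> I" "q' \<in> I" using n segment_in_I[OF ab(2,3)] by auto
    moreover have "\<not> hits ((f ^^ n) p') ((f ^^ n) q')"
      using hits_image[OF _ ab(2,3) n(1,2)] ab(4) by blast
    moreover have "\<kappa> * (\<kappa> ^ k * \<bar>p - q\<bar>) \<le> \<kappa> * \<bar>a - b\<bar>"
      using ab(5) assms(1) by (intro mult_left_mono) auto
    then have "\<kappa> ^ Suc k * \<bar>p - q\<bar> \<le> \<bar>(f ^^ n) p' - (f ^^ n) q'\<bar>"
      using n(4) by simp
    ultimately show ?case using funpow_in_I by blast
  qed
  note grow = this
  obtain k where "4 / \<bar>p - q\<bar> < \<kappa> ^ k"
    using real_arch_pow[OF assms(1)] by blast
  then have "4 < \<kappa> ^ k * \<bar>p - q\<bar>" using pq by (simp add: divide_less_eq)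
  moreover obtain a b where "a \<in> I" "b \<in> I" "\<kappa> ^ k * \<bar>p - q\<bar> \<le> \<bar>a - b\<bar>"
    using grow by blast
  ultimately show False by (auto simp: I_def)
qed

text \<open>The version for segments that start at a periodic point \<open>z\<close>; the predicate \<open>P\<close> selects one side of \<open>z\<close>.\<close>

lemma hits_by_growth_at:
  assumes "1 < \<kappa>" and z: "z \<in> I" and q: "q \<in> I" "P q" "q \<noteq> z"
    and step: "\<And>q. q \<in> I \<Longrightarrow> P q \<Longrightarrow> q \<noteq> z \<Longrightarrow> \<not> hits z q \<Longrightarrow>
      \<exists>n. (f ^^ n) z = z \<and> P ((f ^^ n) q) \<and> \<kappa> * \<bar>q - z\<bar> \<le> \<bar>(f ^^ n) q - z\<bar>"
  shows "hits z q"
proof (rule hits_by_growth[of \<kappa> "\<lambda>a b. a = z \<and> P b"])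
  fix a b assume ab: "a = z \<and> P b" "b \<in> I" "a \<noteq> b" "\<not> hits a b"
  then obtain n where n: "(f ^^ n) z = z" "P ((f ^^ n) b)" "\<kappa> * \<bar>b - z\<bar> \<le> \<bar>(f ^^ n) b - z\<bar>"
    using step[of b] by auto
  then show "\<exists>n p' q'. p' \<in> closed_segment a b \<and> q' \<in> closed_segment a b \<and>
        ((f ^^ n) p' = z \<and> P ((f ^^ n) q')) \<and> \<kappa> * \<bar>a - b\<bar> \<le> \<bar>(f ^^ n) p' - (f ^^ n) q'\<bar>"
    using ab by (intro exI[of _ n] exI[of _ a] exI[of _ b]) (auto simp: abs_minus_commute)
qed (use assms in auto)

section \<open>Return maps\<close>

lemma funpow_Suc_apply: "(f ^^ Suc n) x = (f ^^ n) (f x)"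
  by (simp add: funpow_swap1)

text \<open>All the points \<open>d^n z, \<dots>, d z\<close> lie in the interval \<open>[0, 5/2 d]\<close> on which \<open>f\<close> is multiplication by \<open>L\<close>. This
  turns the factor \<open>d^n\<close> in the definition of \<open>f\<close> on \<open>[x_n, y_n]\<close> into a return after \<open>n + 1\<close> steps.\<close>

lemma funpow_scale: "0 \<le> z \<Longrightarrow> z \<le> 5/2 \<Longrightarrow> (f ^^ n) (d ^ n * z) = z"
proof (induction n)
  case (Suc n)
  have "d ^ n * z \<le> 1 * (5/2)"
    using Suc.prems d_power_le_1 by (intro mult_mono) auto
  then have "d * (d ^ n * z) \<le> d * (5/2)"
    using d_pos by (intro mult_left_mono) auto
  moreover have "0 \<le> d ^ Suc n * z" using Suc.prems d_power_pos[of "Suc n"] by simp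
  ultimately have "f (d ^ Suc n * z) = L * (d ^ Suc n * z)"
    by (intro f_near_0) (simp_all add: mult.assoc)
  also have "\<dots> = (d ^ Suc n * L) * z" by (simp only: mult_ac)
  also have "\<dots> = d ^ n * z" by (simp only: d_power_L)
  finally show ?case
    using Suc by (simp only: funpow_Suc_apply)
qed simp

lemma return_node:
  assumes n: "n \<ge> 1" and t: "0 \<le> t" "t \<le> M n"
  shows "(f ^^ Suc n) (node n t) = xpt n + gap n * s n t"
proof -
  have "gap n * (- m_seq n) \<le> gap n * s n t" "gap n * s n t \<le> gap n * 1"
    using s_range[OF n t] gap_pos[OF n] by (intro mult_left_mono; simp)+
  then have "ypt (Suc n) \<le> xpt n + gap n * s n t" "xpt n + gap n * s n t \<le> ypt n"
    using ypt_Suc[OF n] by (simp_all add: mult.commute)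
  then have "0 \<le> xpt n + gap n * s n t" "xpt n + gap n * s n t \<le> 5/2"
    using ypt_bounds[OF n] ypt_bounds[of "Suc n"] by auto
  from funpow_scale[OF this] show ?thesis
    by (simp only: funpow_Suc_apply f_node[OF n t])
qed

lemma return_node_odd:
  assumes n: "n \<ge> 1" and i: "odd i" "i < laps n" and u: "\<bar>u\<bar> \<le> d"
  shows "(f ^^ Suc n) (node n (real i + u)) = ypt n - gap n * C_const l r * u^2"
proof -
  have "1 \<le> real i" "real i + 1 \<le> M n" using i n by (cases i; simp add: M_eq)+
  then have "0 \<le> real i + u" "real i + u \<le> M n" using u d_le by (simp_all add: abs_le_iff)
  moreover have "s n (real i + u) = 1 - C_const l r * u^2"
    using s_near_odd[OF n i, of "real i + u"] u by simp
  ultimately have "(f ^^ Suc n) (node n (real i + u)) = xpt n + gap n * (1 - C_const l r * u^2)"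
    using return_node[OF n] by (simp only:)
  then show ?thesis by (simp only: right_diff_distrib mult.assoc) simp
qed

lemma return_node_even:
  assumes n: "n \<ge> 1" and i: "even i" "0 < i" "i < laps n" and u: "\<bar>u\<bar> \<le> d"
  shows "(f ^^ Suc n) (node n (real i + u)) = ypt (Suc n) + gap n * C_const l r * u^2"
proof -
  have "1 \<le> real i" "real i + 1 \<le> M n" using i n by (cases i; simp add: M_eq)+
  then have "0 \<le> real i + u" "real i + u \<le> M n" using u d_le by (simp_all add: abs_le_iff)
  moreover have "s n (real i + u) = - m_seq n + C_const l r * u^2"
    using s_near_even[OF n i, of "real i + u"] u by simp
  ultimately have "(f ^^ Suc n) (node n (real i + u)) = xpt n + gap n * (- m_seq n + C_const l r * u^2)"
    using return_node[OF n] by (simp only:)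
  then show ?thesis unfolding ypt_Suc[OF n] by (simp only: distrib_left mult.assoc) simp
qed

lemma return_ypt: "n \<ge> 1 \<Longrightarrow> (f ^^ Suc n) (ypt n) = ypt n"
  using return_node[of n "M n"] M_ge[of n] by (simp add: node_M s_M)

lemma return_xpt: "n \<ge> 1 \<Longrightarrow> (f ^^ Suc n) (xpt n) = xpt n"
  using return_node[of n 0] M_ge[of n] by (simp add: node_0 s_0)

lemma return_affine:
  assumes n: "n \<ge> 1" and x: "ypt (Suc n) \<le> x" "x \<le> w n"
  shows "(f ^^ Suc (Suc n)) x = ypt (Suc n) + 2 * L * (x - ypt (Suc n))"
proof -
  let ?z = "ypt (Suc n) + 2 * L * (x - ypt (Suc n))"
  have "2 * L * (x - ypt (Suc n)) \<le> 2 * L * (w n - ypt (Suc n))"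
    using x L_ge by (intro mult_left_mono) auto
  also have "\<dots> = (d * L) * (xpt n - ypt (Suc n))"
    unfolding order_points[OF n] by simp
  finally have "?z \<le> xpt n" by (simp add: d_L)
  moreover have "0 \<le> 2 * L * (x - ypt (Suc n))" using x L_ge by simp
  ultimately have "0 \<le> ?z" "?z \<le> 5/2"
    using xpt_bounds[OF n] ypt_bounds[of "Suc n"] by auto
  from funpow_scale[OF this, of "Suc n"] show ?thesis
    using f_affine_piece[OF n, of x] x by (simp only: funpow_Suc_apply[of "Suc n"] atLeastAtMost_iff)
qed

lemma return_w: "n \<ge> 1 \<Longrightarrow> (f ^^ Suc n) (w n) = d * xpt n" "n \<ge> 1 \<Longrightarrow> (f ^^ Suc (Suc n)) (w n) = xpt n"
proof -
  assume n: "n \<ge> 1"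
  have b: "0 \<le> d * xpt n" "d * xpt n \<le> 5/2"
    using mult_mono[of d 1 "xpt n" "5/2"] xpt_bounds[OF n] d_pos d_le by auto
  have "f (w n) = d ^ n * (d * xpt n)" by (simp add: f_w[OF n])
  then show "(f ^^ Suc n) (w n) = d * xpt n"
    using funpow_scale[OF b, of n] by (simp only: funpow_Suc_apply)
  show "(f ^^ Suc (Suc n)) (w n) = xpt n"
    using funpow_scale[of "xpt n" "Suc n"] xpt_bounds[OF n] f_w[OF n]
    by (simp add: funpow_Suc_apply[of "Suc n"] del: funpow.simps)
qed

lemma return_phi_expand:
  assumes n: "n \<ge> 1" and ab: "w n \<le> a" "a < b" "b \<le> xpt n"
  shows "4/3 * (b - a) \<le> (f ^^ Suc n) b - (f ^^ Suc n) a"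
proof -
  have R: "(f ^^ Suc n) x = L ^ n * f x" if "w n \<le> x" "x \<le> xpt n" for x
  proof -
    have "f x \<le> f (xpt n)"
    proof (cases "x = xpt n")
      case False
      then have "4/3 * d ^ n * (xpt n - x) \<le> f (xpt n) - f x"
        using f_expand_phi[OF n, of x "xpt n"] that by simp
      moreover have "0 \<le> 4/3 * d ^ n * (xpt n - x)" using that d_power_pos[of n] by simp
      ultimately show ?thesis by linarith
    qed simp
    then have "L ^ n * f x \<le> L ^ n * (d ^ n * xpt n)"
      using L_ge f_xpt[OF n] by (intro mult_left_mono) auto
    also have "\<dots> = (d ^ n * L ^ n) * xpt n" by (simp only: mult_ac)
    finally have "L ^ n * f x \<le> xpt n" by (simp add: d_power_L_power)
    moreover have "0 \<le> f x"
    proof -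
      have "xpt n \<le> ypt n" "ypt (Suc n) \<le> w n" using order_points[OF n] by auto
      then show ?thesis using f_bounds_right_of_1(1)[OF n, of x] that by simp
    qed
    then have "0 \<le> L ^ n * f x" using L_ge by simp
    ultimately have "(f ^^ n) (d ^ n * (L ^ n * f x)) = L ^ n * f x"
      using xpt_bounds[OF n] by (intro funpow_scale) auto
    moreover have "d ^ n * (L ^ n * f x) = (d ^ n * L ^ n) * f x" by (simp only: mult.assoc)
    ultimately show ?thesis by (simp add: d_power_L_power funpow_Suc_apply del: funpow.simps)
  qed
  have "L ^ n * (4/3 * d ^ n * (b - a)) \<le> L ^ n * (f b - f a)"
    using f_expand_phi[OF n ab] L_ge by (intro mult_left_mono) auto
  moreover have "L ^ n * (4/3 * d ^ n * (b - a)) = (d ^ n * L ^ n) * (4/3 * (b - a))"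
    by (simp only: mult_ac)
  ultimately show ?thesis
    using R[of a] R[of b] ab by (simp add: d_power_L_power right_diff_distrib del: funpow.simps)
qed

lemma points_in_I: 
  assumes "n \<ge> 1" shows "xpt n \<in> I" "ypt n \<in> I" "ypt (Suc n) \<in> I" "w n \<in> I"
  using xpt_bounds[OF assms] ypt_bounds[OF assms] ypt_bounds[of "Suc n"] order_points[OF assms]
  by (auto simp: I_def)

lemma node_in_I: "n \<ge> 1 \<Longrightarrow> 0 \<le> t \<Longrightarrow> t \<le> M n \<Longrightarrow> node n t \<in> I"
  using node_mono[of n 0 t] node_mono[of n t "M n"] xpt_bounds[of n] ypt_bounds[of n]
  by (auto simp: I_def node_0 node_M)

lemma funpow_2: "(f ^^ 2) x = f (f x)"
  by (simp add: numeral_2_eq_2)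

section \<open>The marked periodic points\<close>

text \<open>\<open>w n\<close> and \<open>xpt n\<close> are brought by \<open>f^(n+1)\<close> to the two sides of \<open>1\<close>.\<close>

lemma hits_w_xpt:
  assumes "n \<ge> 1" shows "hits (w n) (xpt n)"
proof (rule hits_image[where n = "Suc n" and p' = "w n" and q' = "xpt n"])
  have "d * xpt n \<le> 1 / 14 * 2"
    using d_le d_pos xpt_bounds[OF assms] by (intro mult_mono) auto
  then show "hits ((f ^^ Suc n) (w n)) ((f ^^ Suc n) (xpt n))"
    unfolding return_w(1)[OF assms] return_xpt[OF assms] using xpt_bounds[OF assms]
    by (intro hits_1) (simp add: mem_segment_iff)
qed (use points_in_I[OF assms] in auto)

lemma hits_beyond_xpt:
  assumes "n \<ge> 1" "p \<le> w n" "xpt n \<le> q" shows "hits p q"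
  using assms order_points(1-3)[OF assms(1)]
  by (intro hits_mono[OF hits_w_xpt[OF assms(1)]]) (auto simp: mem_segment_iff)

text \<open>Left of \<open>x_n\<close> the return map \<open>f^(n+1)\<close> has slope at least \<open>4/3\<close> as long as \<open>w_n\<close> is not reached.\<close>

lemma hits_left_of_xpt:
  assumes n: "n \<ge> 1" and q: "q \<in> I" "q < xpt n" shows "hits (xpt n) q"
proof (rule hits_by_growth_at[where \<kappa> = "4/3" and P = "\<lambda>q. q \<le> xpt n"])
  fix q assume q: "q \<in> I" "q \<le> xpt n" "q \<noteq> xpt n" "\<not> hits (xpt n) q"
  have "w n < q"
    using hits_beyond_xpt[OF n, of q "xpt n"] q(4) hits_commute by force
  then have "4/3 * (xpt n - q) \<le> xpt n - (f ^^ Suc n) q"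
    using return_phi_expand[OF n, of q "xpt n"] q return_xpt[OF n] by (simp del: funpow.simps)
  then show "\<exists>k. (f ^^ k) (xpt n) = xpt n \<and> (f ^^ k) q \<le> xpt n \<and> 4/3 * \<bar>q - xpt n\<bar> \<le> \<bar>(f ^^ k) q - xpt n\<bar>"
    using q return_xpt[OF n] by (intro exI[of _ "Suc n"]) (simp del: funpow.simps)
qed (use q points_in_I[OF n] in auto)

text \<open>Right of \<open>y_(n+1)\<close> the map \<open>f^(n+2)\<close> is linear with slope \<open>2 L\<close> up to \<open>w_n\<close>, which it sends to \<open>x_n\<close>.\<close>

lemma hits_right_of_ypt_Suc:
  assumes n: "n \<ge> 1" and q: "q \<in> I" "ypt (Suc n) < q" shows "hits (ypt (Suc n)) q"
proof (rule hits_by_growth_at[where \<kappa> = "2 * L" and P = "\<lambda>q. ypt (Suc n) \<le> q"])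
  fix q assume q: "q \<in> I" "ypt (Suc n) \<le> q" "q \<noteq> ypt (Suc n)" "\<not> hits (ypt (Suc n)) q"
  have fixp: "(f ^^ Suc (Suc n)) (ypt (Suc n)) = ypt (Suc n)"
    using return_ypt[of "Suc n"] by simp
  have "q < w n"
  proof (rule ccontr)
    assume "\<not> q < w n"
    then have "w n \<in> closed_segment (ypt (Suc n)) q"
      using order_points[OF n] by (simp add: mem_segment_iff)
    moreover have "hits ((f ^^ Suc (Suc n)) (ypt (Suc n))) ((f ^^ Suc (Suc n)) (w n))"
      unfolding fixp return_w(2)[OF n] using order_points(1)[OF n] by (intro hits_beyond_xpt[OF n]) auto
    ultimately have "hits (ypt (Suc n)) q"
      using points_in_I[OF n] q(1) hits_image by (metis ends_in_segment(1))
    then show False using q(4) by simp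
  qed
  then have R: "(f ^^ Suc (Suc n)) q = ypt (Suc n) + 2 * L * (q - ypt (Suc n))"
    using return_affine[OF n, of q] q by simp
  have "0 \<le> 2 * L * (q - ypt (Suc n))" using q L_ge by simp
  then show "\<exists>k. (f ^^ k) (ypt (Suc n)) = ypt (Suc n) \<and> ypt (Suc n) \<le> (f ^^ k) q
      \<and> 2 * L * \<bar>q - ypt (Suc n)\<bar> \<le> \<bar>(f ^^ k) q - ypt (Suc n)\<bar>"
    using fixp R q(2) by (intro exI[of _ "Suc (Suc n)"]) (simp del: funpow.simps)
qed (use q points_in_I[OF n] L_ge in auto)

lemma node_M_minus: "n \<ge> 1 \<Longrightarrow> node n (M n - t) = ypt n - gap n / M n * t"
proof -
  assume "n \<ge> 1"
  moreover have "gap n / M n * (M n - t - M n) = - (gap n / M n * t)" by simp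
  ultimately show ?thesis
    using node_diff[of n "M n - t" "M n"] node_M[of n] by linarith
qed

lemma node_eq: "node n t = xpt n + gap n / M n * t"
  by (simp add: node_def)

lemma hits_between_ypts: "n \<ge> 1 \<Longrightarrow> hits (ypt n) (ypt (Suc n))"
  using hits_beyond_xpt[of n "ypt (Suc n)" "ypt n"] order_points(1-3)[of n] hits_commute by simp

text \<open>Hence every lap except the first is sent onto \<open>[y_(n+1), y_n]\<close> by \<open>f^(n+1)\<close>.\<close>

lemma return_node_integer:
  assumes n: "n \<ge> 1" and i: "i \<le> laps n"
  shows "(f ^^ Suc n) (node n (real i)) = (if i = 0 then xpt n else if even i then ypt (Suc n) else ypt n)"
proof -
  consider "i = 0" | "i = laps n" | "odd i" "i < laps n" | "even i" "0 < i" "i < laps n"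
    using i by force
  then show ?thesis
  proof cases
    case 1 then show ?thesis using return_xpt[OF n] by (simp add: node_0 del: funpow.simps)
  next
    case 2
    then have "node n (real i) = ypt n" using node_M[OF n] M_eq[OF n] by simp
    then show ?thesis using return_ypt[OF n] 2 laps_odd[OF n] by (auto simp del: funpow.simps)
  next
    case 3
    then show ?thesis using return_node_odd[OF n 3, of 0] d_pos by (auto simp del: funpow.simps)
  next
    case 4
    then show ?thesis using return_node_even[OF n 4, of 0] d_pos by (simp del: funpow.simps)
  qed
qed

lemma hits_lap:
  assumes n: "n \<ge> 1" and i: "0 < i" "i < laps n" 
    and pq: "p \<in> I" "q \<in> I" "node n (real i) \<in> closed_segment p q" "node n (real (Suc i)) \<in> closed_segment p q"
  shows "hits p q"
proof (rule hits_image[OF _ pq(1,2) pq(3,4)])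
  show "hits ((f ^^ Suc n) (node n (real i))) ((f ^^ Suc n) (node n (real (Suc i))))"
    using return_node_integer[OF n, of i] return_node_integer[OF n, of "Suc i"] i
      hits_between_ypts[OF n] hits_commute by (auto simp del: funpow.simps)
qed

text \<open>Left of \<open>y_n\<close> the map \<open>f^(n+1)\<close> is linear with slope \<open>2 L\<close> over the distance \<open>d\<close> (measured in laps). Where this
  stretch ends, the image is two laps away from \<open>y_n\<close>, so it contains the last lap, which is sent
  onto \<open>[y_(n+1), y_n]\<close>. The argument to
  the right of \<open>x_n\<close> is the mirror image; there the second lap is used because the first one is sent
  onto \<open>[x_n, y_n]\<close> only.\<close>

lemma hits_left_of_ypt:
  assumes n: "n \<ge> 1" and q: "q \<in> I" "q < ypt n" shows "hits (ypt n) q"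
proof (rule hits_by_growth_at[where \<kappa> = "2 * L" and P = "\<lambda>q. q \<le> ypt n"])
  fix q assume q: "q \<in> I" "q \<le> ypt n" "q \<noteq> ypt n" "\<not> hits (ypt n) q"
  define g where "g = gap n / M n"
  have g: "0 < g" "g * M n = gap n" using gap_over_M_pos[OF n] M_ge[OF n] by (auto simp: g_def)
  have last_lap: "hits (ypt n) p" if "p \<in> I" "p \<le> node n (M n - 1)" for p
  proof (rule hits_lap[OF n])
    show "0 < laps n - 1" "laps n - 1 < laps n" using laps_ge[OF n] by auto
    have "real (laps n - 1) = M n - 1" "real (Suc (laps n - 1)) = M n"
      using laps_ge[OF n] M_eq[OF n] by auto
    moreover have "node n (M n - 1) \<le> ypt n" using node_M_minus[OF n, of 1] g g_def by simp
    ultimately show "node n (real (laps n - 1)) \<in> closed_segment (ypt n) p"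
        "node n (real (Suc (laps n - 1))) \<in> closed_segment (ypt n) p"
      using that node_M[OF n] by (auto simp: mem_segment_iff)
  qed (use that points_in_I[OF n] in auto)
  have near: "node n (M n - d) < q"
  proof (rule ccontr)
    assume "\<not> node n (M n - d) < q"
    then have "node n (M n - d) \<in> closed_segment (ypt n) q"
      using node_M_minus[OF n, of d] g d_pos unfolding g_def[symmetric] by (simp add: mem_segment_iff)
    moreover have "(f ^^ Suc n) (node n (M n - d)) = node n (M n - 2)"
    proof -
      have "k_seq l r n * d = 2 / M n" using d_L by (simp add: k_seq_def)
      then have "s n (M n - d) = 1 - 2 / M n" using s_end[OF n, of "M n - d"] d_pos by simp
      then have "(f ^^ Suc n) (node n (M n - d)) = xpt n + gap n * (1 - 2 / M n)"
        using return_node[OF n, of "M n - d"] M_ge[OF n] d_pos d_le by simp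
      then show ?thesis using M_ge[OF n] by (simp add: node_def field_simps del: funpow.simps)
    qed
    moreover have "hits (ypt n) (node n (M n - 2))"
      using node_mono[OF n, of "M n - 2" "M n - 1"] M_ge[OF n]
      by (intro last_lap node_in_I[OF n]) auto
    ultimately have "hits (ypt n) q"
      using hits_image[of "Suc n" "ypt n" "node n (M n - d)" "ypt n" q] return_ypt[OF n] q(1) points_in_I[OF n]
      by (simp del: funpow.simps)
    then show False using q(4) by simp
  qed
  define t where "t = (ypt n - q) / g"
  have t: "q = node n (M n - t)" using node_M_minus[OF n, of t] g by (simp add: t_def g_def[symmetric])
  have tb: "0 \<le> t" "t \<le> d"
    using near g q(2) unfolding t node_M_minus[OF n] g_def[symmetric] by (auto simp: zero_le_mult_iff)
  have "s n (M n - t) = 1 - k_seq l r n * t" using s_end[OF n, of "M n - t"] tb by simp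
  then have "(f ^^ Suc n) q = xpt n + gap n * (1 - k_seq l r n * t)"
    unfolding t using return_node[OF n, of "M n - t"] tb d_le M_ge[OF n] by simp
  also have "\<dots> = ypt n - gap n * (k_seq l r n * t)" by (simp only: right_diff_distrib) simp
  also have "gap n * (k_seq l r n * t) = g * (M n * k_seq l r n) * t"
    unfolding g(2)[symmetric] by (simp only: mult.assoc)
  also have "\<dots> = 2 * L * (ypt n - q)"
    using M_k[OF n] g by (simp add: t_def)
  finally have R: "(f ^^ Suc n) q = ypt n - 2 * L * (ypt n - q)" .
  have "0 \<le> 2 * L * (ypt n - q)" using q L_ge by simp
  then show "\<exists>k. (f ^^ k) (ypt n) = ypt n \<and> (f ^^ k) q \<le> ypt n \<and> 2 * L * \<bar>q - ypt n\<bar> \<le> \<bar>(f ^^ k) q - ypt n\<bar>"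
    using return_ypt[OF n] R q(2) by (intro exI[of _ "Suc n"]) (simp del: funpow.simps)
qed (use q points_in_I[OF n] L_ge in auto)

lemma hits_right_of_xpt:
  assumes n: "n \<ge> 1" and q: "q \<in> I" "xpt n < q" shows "hits (xpt n) q"
proof (rule hits_by_growth_at[where \<kappa> = "2 * L" and P = "\<lambda>q. xpt n \<le> q"])
  fix q assume q: "q \<in> I" "xpt n \<le> q" "q \<noteq> xpt n" "\<not> hits (xpt n) q"
  define g where "g = gap n / M n"
  have g: "0 < g" "g * M n = gap n" using gap_over_M_pos[OF n] M_ge[OF n] by (auto simp: g_def)
  have second_lap: "hits (xpt n) p" if "p \<in> I" "node n 2 \<le> p" for p
  proof (rule hits_lap[OF n, of 1])
    show "node n (real 1) \<in> closed_segment (xpt n) p" "node n (real (Suc 1)) \<in> closed_segment (xpt n) p"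
      using that g node_eq[of n] unfolding g_def[symmetric] by (auto simp: mem_segment_iff)
  qed (use that points_in_I[OF n] laps_ge[OF n] in auto)
  have near: "q < node n d"
  proof (rule ccontr)
    assume "\<not> q < node n d"
    then have "node n d \<in> closed_segment (xpt n) q"
      using node_eq[of n d] g d_pos unfolding g_def[symmetric] by (simp add: mem_segment_iff)
    moreover have "(f ^^ Suc n) (node n d) = node n 2"
    proof -
      have "k_seq l r n * d = 2 / M n" using d_L by (simp add: k_seq_def)
      then have "s n d = 2 / M n" using s_start[OF n, of d] d_pos by simp
      then have "(f ^^ Suc n) (node n d) = xpt n + gap n * (2 / M n)"
        using return_node[OF n, of d] M_ge[OF n] d_pos d_le by simp
      then show ?thesis by (simp add: node_def del: funpow.simps)
    qed
    moreover have "hits (xpt n) (node n 2)"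
      using M_ge[OF n] by (intro second_lap node_in_I[OF n]) auto
    ultimately have "hits (xpt n) q"
      using hits_image[of "Suc n" "xpt n" "node n d" "xpt n" q] return_xpt[OF n] q(1) points_in_I[OF n]
      by (simp del: funpow.simps)
    then show False using q(4) by simp
  qed
  define t where "t = (q - xpt n) / g"
  have t: "q = node n t" using node_eq[of n t] g by (simp add: t_def g_def[symmetric])
  have tb: "0 \<le> t" "t \<le> d"
    using near g q(2) unfolding t node_eq g_def[symmetric] by (auto simp: zero_le_mult_iff)
  have "s n t = k_seq l r n * t" using s_start[OF n, of t] tb by simp
  then have "(f ^^ Suc n) q = xpt n + gap n * (k_seq l r n * t)"
    unfolding t using return_node[OF n, of t] tb d_le M_ge[OF n] by simp
  also have "gap n * (k_seq l r n * t) = g * (M n * k_seq l r n) * t"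
    unfolding g(2)[symmetric] by (simp only: mult.assoc)
  also have "\<dots> = 2 * L * (q - xpt n)"
    using M_k[OF n] g by (simp add: t_def)
  finally have R: "(f ^^ Suc n) q = xpt n + 2 * L * (q - xpt n)" .
  have "0 \<le> 2 * L * (q - xpt n)" using q L_ge by simp
  then show "\<exists>k. (f ^^ k) (xpt n) = xpt n \<and> xpt n \<le> (f ^^ k) q \<and> 2 * L * \<bar>q - xpt n\<bar> \<le> \<bar>(f ^^ k) q - xpt n\<bar>"
    using return_xpt[OF n] R q(2) by (intro exI[of _ "Suc n"]) (simp del: funpow.simps)
qed (use q points_in_I[OF n] L_ge in auto)

text \<open>The point \<open>y_1 = 5/2\<close> has period \<open>2\<close>, and \<open>f^2\<close> has slope at least \<open>9/4\<close> to its right until \<open>f\<close> reaches the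
  fold at \<open>1/2\<close>. Once the image under \<open>f\<close> contains \<open>1/2 - d\<close>, the image under \<open>f^2\<close> contains
  \<open>[5/2, 4 - 3/2 d]\<close>, which \<open>f\<close> maps onto \<open>[5/2 d, 5/2]\<close>.\<close>

lemma hits_right_of_ypt_1:
  assumes q: "q \<in> I" "5/2 < q" shows "hits (5/2) q"
proof (rule hits_by_growth_at[where \<kappa> = "9/4" and P = "\<lambda>q. 5/2 \<le> q"])
  fix q assume q: "q \<in> I" "5/2 \<le> q" "q \<noteq> 5/2" "\<not> hits (5/2) q"
  have seg: "5/2 \<in> closed_segment (5/2) q" "q \<in> closed_segment (5/2) q" "5/2 \<in> I" by (auto simp: I_def)
  have fq: "5/2 * d + 3/2 * (q - 5/2) \<le> f q"
    using f_right_expand[OF order_refl q(2)] q(1) f_special_values(10)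
    unfolding I_def atLeastAtMost_iff by linarith
  have "f q \<le> 1/2 - d"
  proof (rule ccontr)
    assume "\<not> f q \<le> 1/2 - d"
    then have s1: "5/2 * d \<in> closed_segment (f (5/2)) (f q)" "1/2 - d \<in> closed_segment (f (5/2)) (f q)"
      using fq d_le by (auto simp: mem_segment_iff f_special_values)
    have "hits (5/2 * d) (5/2)" using d_le by (intro hits_1) (simp add: mem_segment_iff)
    then have "hits ((f ^^ 2) (5/2 * d)) ((f ^^ 2) (1/2 - d))"
      by (simp only: funpow_2 f_special_values)
    then have "hits (f (5/2)) (f q)"
      by (rule hits_image) (use f_maps_I[OF seg(3)] f_maps_I[OF q(1)] s1 in auto)
    then have "hits (5/2) q"
      using hits_image[of 1 "5/2" q "5/2" q] seg q(1) by simp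
    then show False using q(4) by simp
  qed
  moreover have "5/2 * d \<le> f q"
  proof -
    have "0 \<le> 3/2 * (q - 5/2)" using q(2) by simp
    then show ?thesis using fq by argo
  qed
  ultimately have "3/2 * (f q - 5/2 * d) \<le> f (f q) - 5/2"
    using f_left_expand[OF order_refl, of "f q"] unfolding f_special_values(1) by simp
  then have "9/4 * (q - 5/2) \<le> (f ^^ 2) q - 5/2"
    unfolding funpow_2 using fq by argo
  moreover have "(f ^^ 2) (5/2) = 5/2" by (simp only: funpow_2 f_special_values)
  ultimately show "\<exists>k. (f ^^ k) (5/2) = 5/2 \<and> 5/2 \<le> (f ^^ k) q \<and> 9/4 * \<bar>q - 5/2\<bar> \<le> \<bar>(f ^^ k) q - 5/2\<bar>"
    using q(2) by (intro exI[of _ 2]) auto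
qed (use q in \<open>auto simp: I_def\<close>)

lemma covers_0: "covers 0"
  unfolding covers_def hits_def by (intro ballI impI exI[of _ 0]) auto

lemma covers_1: "covers 1"
  unfolding covers_def by (intro ballI impI hits_1) auto

lemma covers_4: "covers 4"
  unfolding covers_def
proof (intro ballI impI)
  fix q assume q: "q \<in> I" "q \<noteq> 4"
  show "hits 4 q"
  proof (rule hits_by_growth_at[where \<kappa> = L and P = "\<lambda>q. q \<in> I"])
    fix q assume q: "q \<in> I" "q \<noteq> 4" "\<not> hits 4 q"
    have "4 - 3/2 * d < q"
    proof (rule ccontr)
      assume "\<not> 4 - 3/2 * d < q"
      then have "4 - 3/2 * d \<in> closed_segment 4 q" using d_pos by (simp add: mem_segment_iff)
      moreover have "hits 4 (5/2 * d)" using d_le by (intro hits_1) (simp add: mem_segment_iff)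
      then have "hits ((f ^^ 2) 4) ((f ^^ 2) (4 - 3/2 * d))"
        by (simp only: funpow_2 f_special_values)
      ultimately have "hits 4 q"
        using q(1) four_in_I hits_image by (metis ends_in_segment(1))
      then show False using q(3) by simp
    qed
    then have "f q = 4 - L * (4 - q)" using f_near_4[of "4 - q"] q(1) by (auto simp: I_def)
    moreover have "0 \<le> L * (4 - q)" using q(1) L_ge by (auto simp: I_def)
    ultimately show "\<exists>k. (f ^^ k) 4 = 4 \<and> (f ^^ k) q \<in> I \<and> L * \<bar>q - 4\<bar> \<le> \<bar>(f ^^ k) q - 4\<bar>"
      using f_special_values(7) f_maps_I[OF q(1)] q(1) by (intro exI[of _ 1]) (auto simp: I_def)
  qed (use q four_in_I L_ge in auto)
qed

lemma covers_xpt: "n \<ge> 1 \<Longrightarrow> covers (xpt n)"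
  unfolding covers_def using hits_left_of_xpt hits_right_of_xpt by (metis linorder_neqE_linordered_idom)

lemma covers_ypt:
  assumes "n \<ge> 1" shows "covers (ypt n)"
  unfolding covers_def
proof (intro ballI impI)
  fix q assume q: "q \<in> I" "q \<noteq> ypt n"
  obtain m where m: "n = Suc m" using assms by (cases n) auto
  consider "q < ypt n" | "ypt n < q" "m = 0" | "ypt n < q" "m \<ge> 1"
    using q(2) by linarith
  then show "hits (ypt n) q"
  proof cases
    case 1
    then show ?thesis using hits_left_of_ypt[OF assms q(1)] by simp
  next
    case 2
    then show ?thesis using hits_right_of_ypt_1[OF q(1)] m by (simp add: ypt_1)
  next
    case 3
    then show ?thesis using hits_right_of_ypt_Suc[OF _ q(1), of m] m by simp
  qed
qed

section \<open>Expansion on the pieces\<close>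

text \<open>By the intermediate value theorem, \<open>f^n\<close> of the segment contains the segment between the two
  image points.\<close>

definition expands :: "real \<Rightarrow> real \<Rightarrow> bool" where
  "expands a b \<longleftrightarrow> (\<exists>n. \<exists>p\<in>closed_segment a b. \<exists>q\<in>closed_segment a b.
     4/3 * \<bar>a - b\<bar> \<le> \<bar>(f ^^ n) p - (f ^^ n) q\<bar>)"

lemma expandsI:
  assumes "p \<in> closed_segment a b" "q \<in> closed_segment a b" "4/3 * \<bar>a - b\<bar> \<le> \<bar>(f ^^ n) p - (f ^^ n) q\<bar>"
  shows "expands a b"
  using assms unfolding expands_def by blast

text \<open>Near a repelling fixed point \<open>p\<close> of \<open>f^N\<close>, on the side \<open>\<sigma> = 1\<close> or \<open>\<sigma> = - 1\<close>: all points up to distance \<open>c\<close> follow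
  the linear map until the outermost one is farther than \<open>e\<close>. If \<open>c > e\<close>
  from the start, then \<open>j = 0\<close>.\<close>

lemma escape:
  assumes lin: "\<And>v. 0 \<le> v \<Longrightarrow> v \<le> e \<Longrightarrow> (f ^^ N) (p + \<sigma> * v) = p + \<sigma> * (\<kappa> * v)"
    and "1 < \<kappa>" and "0 < c"
  shows "\<exists>j. e < \<kappa> ^ j * c \<and> (\<forall>v\<in>{0..c}. (f ^^ (N * j)) (p + \<sigma> * v) = p + \<sigma> * (\<kappa> ^ j * v))"
proof -
  have ex: "\<exists>j. e < \<kappa> ^ j * c"
    using real_arch_pow[OF \<open>1 < \<kappa>\<close>, of "e / c"] \<open>0 < c\<close> by (auto simp: divide_less_eq)
  define j where "j = (LEAST j. e < \<kappa> ^ j * c)"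
  have "(f ^^ (N * i)) (p + \<sigma> * v) = p + \<sigma> * (\<kappa> ^ i * v)" if "i \<le> j" and v: "v \<in> {0..c}" for i v
    using that(1)
  proof (induction i)
    case (Suc i)
    have "\<kappa> ^ i * v \<le> \<kappa> ^ i * c" using v \<open>1 < \<kappa>\<close> by (intro mult_left_mono) auto
    also have "\<dots> \<le> e"
      using not_less_Least[of i "\<lambda>j. e < \<kappa> ^ j * c"] Suc.prems by (simp add: j_def)
    finally have "(f ^^ N) (p + \<sigma> * (\<kappa> ^ i * v)) = p + \<sigma> * (\<kappa> * (\<kappa> ^ i * v))"
      using v \<open>1 < \<kappa>\<close> by (intro lin) auto
    moreover have "(f ^^ (N * Suc i)) (p + \<sigma> * v) = (f ^^ N) ((f ^^ (N * i)) (p + \<sigma> * v))"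
      by (simp add: funpow_add)
    ultimately show ?case using Suc by simp
  qed simp
  moreover have "e < \<kappa> ^ j * c"
    unfolding j_def using LeastI_ex[OF ex] .
  ultimately show ?thesis by blast
qed

text \<open>The key estimate at a fold of order \<open>m\<close>. The image distances \<open>c u^m < c v^m\<close> are magnified by \<open>\<kappa>^j\<close> to \<open>U < V\<close>. As
  \<open>u^m / v^m \<le> u / v\<close>, the relative distance does not shrink: \<open>(V - U) / V \<ge> (v - u) / v\<close>. With \<open>V > e\<close> this means
  expansion by at least \<open>e / v\<close>, whatever \<open>c\<close> is.\<close>

lemma fold_escape:
  assumes lin: "\<And>v. 0 \<le> v \<Longrightarrow> v \<le> e \<Longrightarrow> (f ^^ N) (p + \<sigma> * v) = p + \<sigma> * (\<kappa> * v)"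
    and "1 < \<kappa>" and "0 < c" and "m \<ge> 1" and u: "0 \<le> u" "u < v"
    and P: "(f ^^ k) P = p + \<sigma> * (c * u ^ m)" and Q: "(f ^^ k) Q = p + \<sigma> * (c * v ^ m)"
  obtains n U V where "e < V" "0 \<le> U" "V * (v - u) \<le> (V - U) * v"
    "(f ^^ n) P = p + \<sigma> * U" "(f ^^ n) Q = p + \<sigma> * V"
proof -
  have cv: "0 < c * v ^ m" using u \<open>0 < c\<close> by simp
  obtain j where j: "e < \<kappa> ^ j * (c * v ^ m)"
    "\<And>x. x \<in> {0..c * v ^ m} \<Longrightarrow> (f ^^ (N * j)) (p + \<sigma> * x) = p + \<sigma> * (\<kappa> ^ j * x)"
    using escape[OF lin \<open>1 < \<kappa>\<close> cv] by blast
  have "u ^ m \<le> v ^ m" using u by (intro power_mono) auto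
  then have "c * u ^ m \<in> {0..c * v ^ m}" "c * v ^ m \<in> {0..c * v ^ m}"
    using u \<open>0 < c\<close> by auto
  note eqs = this[THEN j(2)]
  obtain i where i: "m = Suc i" using \<open>m \<ge> 1\<close> by (cases m) auto
  let ?K = "\<kappa> ^ j * c"
  have K: "0 \<le> ?K" using \<open>1 < \<kappa>\<close> \<open>0 < c\<close> by simp
  have "u ^ i \<le> v ^ i" using u by (intro power_mono) auto
  then have "?K * (u ^ i * (u * v)) \<le> ?K * (v ^ i * (u * v))"
    using K u by (intro mult_left_mono mult_right_mono) auto
  then have "?K * v ^ m * (v - u) \<le> (?K * v ^ m - ?K * u ^ m) * v"
    unfolding i by (simp add: algebra_simps)
  moreover have "(f ^^ (N * j + k)) P = p + \<sigma> * (?K * u ^ m)" "(f ^^ (N * j + k)) Q = p + \<sigma> * (?K * v ^ m)"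
    using eqs P Q by (simp_all add: funpow_add mult.assoc)
  moreover have "e < ?K * v ^ m" using j(1) by (simp add: mult.assoc)
  moreover have "0 \<le> ?K * u ^ m" using \<open>1 < \<kappa>\<close> \<open>0 < c\<close> u(1) by simp
  ultimately show thesis using that by blast
qed

lemma fold_escape_expands:
  assumes lin: "\<And>v. 0 \<le> v \<Longrightarrow> v \<le> e \<Longrightarrow> (f ^^ N) (p + \<sigma> * v) = p + \<sigma> * (\<kappa> * v)"
    and "1 < \<kappa>" and "0 < c" and "m \<ge> 1" and u: "0 \<le> u" "u < v" "A * v \<le> e"
    and P: "(f ^^ k) P = p + \<sigma> * (c * u ^ m)" and Q: "(f ^^ k) Q = p + \<sigma> * (c * v ^ m)"
    and \<sigma>: "\<bar>\<sigma>\<bar> = 1"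
  shows "\<exists>n. A * (v - u) \<le> \<bar>(f ^^ n) P - (f ^^ n) Q\<bar>"
proof -
  obtain n U V where n: "e < V" "0 \<le> U" "V * (v - u) \<le> (V - U) * v"
    "(f ^^ n) P = p + \<sigma> * U" "(f ^^ n) Q = p + \<sigma> * V"
    using fold_escape[OF lin \<open>1 < \<kappa>\<close> \<open>0 < c\<close> \<open>m \<ge> 1\<close> u(1,2) P Q] by blast
  have "(A * v) * (v - u) \<le> V * (v - u)" using n(1) u by (intro mult_right_mono) auto
  then have "(A * (v - u)) * v \<le> (V - U) * v" using n(3) by (simp add: algebra_simps)
  then have "A * (v - u) \<le> V - U" using u by simp
  also have "\<dots> \<le> \<bar>\<sigma> * (U - V)\<bar>" using \<sigma> by (simp add: abs_mult)
  finally show ?thesis using n(4,5) by (intro exI[of _ n]) (simp add: algebra_simps)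
qed

lemma return_node_middle:
  assumes n: "n \<ge> 1" and i: "i < laps n" and ab: "real i \<le> a" "a < b" "b \<le> real i + 1"
    and lo: "i \<noteq> 0 \<Longrightarrow> real i + d \<le> a" and hi: "i + 1 \<noteq> laps n \<Longrightarrow> b \<le> real i + 1 - d"
  shows "13/2 * (gap n / M n) * (b - a) \<le> \<bar>(f ^^ Suc n) (node n a) - (f ^^ Suc n) (node n b)\<bar>"
proof -
  have iM: "real i + 1 \<le> M n" using i n by (simp add: M_eq)
  have "(gap n / M n) * (13/2) * (b - a) \<le> (gap n / M n) * (M n * min (1/2) (k_seq l r n)) * (b - a)"
    using M_slope[OF n] gap_over_M_pos[OF n] ab by (intro mult_left_mono mult_right_mono) auto
  also have "\<dots> = gap n * (min (1/2) (k_seq l r n) * (b - a))"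
    using M_ge[OF n] by simp
  also have "\<dots> \<le> gap n * \<bar>s n b - s n a\<bar>"
    using s_expand_middle[OF n i ab lo hi] gap_pos[OF n] by (intro mult_left_mono) auto
  also have "\<dots> = \<bar>gap n * s n a - gap n * s n b\<bar>"
    using gap_pos[OF n] by (simp add: abs_mult abs_minus_commute flip: right_diff_distrib)
  also have "\<dots> = \<bar>(f ^^ Suc n) (node n a) - (f ^^ Suc n) (node n b)\<bar>"
    using return_node[OF n, of a] return_node[OF n, of b] ab iM by (simp del: funpow.simps)
  finally show ?thesis by (simp only: mult_ac)
qed

lemma return_end_of_last_lap:
  assumes n: "n \<ge> 1" and v: "0 \<le> v" "v \<le> gap n / M n * d"
  shows "(f ^^ Suc n) (ypt n + (- 1) * v) = ypt n + (- 1) * (2 * L * v)"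
proof -
  define g where "g = gap n / M n"
  have g: "0 < g" "gap n = g * M n" using gap_over_M_pos[OF n] M_ge[OF n] by (auto simp: g_def)
  define t where "t = v / g"
  have t: "0 \<le> t" "t \<le> d"
    using v g(1) unfolding g_def[symmetric] by (auto simp: t_def divide_le_eq mult.commute)
  have t3: "ypt n + (- 1) * v = node n (M n - t)"
    using node_M_minus[OF n, of t] g(1) unfolding g_def[symmetric] by (simp add: t_def)
  have "s n (M n - t) = 1 - k_seq l r n * t" using s_end[OF n, of "M n - t"] t by simp
  then have "(f ^^ Suc n) (node n (M n - t)) = xpt n + gap n * (1 - k_seq l r n * t)"
    using return_node[OF n, of "M n - t"] t d_le M_ge[OF n] by simp
  also have "\<dots> = ypt n - gap n * (k_seq l r n * t)" by (simp only: right_diff_distrib) simp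
  also have "gap n * (k_seq l r n * t) = (M n * k_seq l r n) * (g * t)"
    unfolding g(2) by (simp only: mult_ac)
  also have "\<dots> = 2 * L * v"
    using M_k[OF n] g(1) by (simp add: t_def)
  finally show ?thesis unfolding t3 by simp
qed

text \<open>Maxima of \<open>s_n\<close> are sent to \<open>y_n\<close>. In units of one lap, the linear stretch left of \<open>y_n\<close> has length \<open>d\<close>, which
  only gives expansion by \<open>d / v \<ge> 1\<close>. If the escaping point ends close to \<open>y_n\<close>, one more return gains
  the factor \<open>13/2\<close>; otherwise it has gone almost a whole lap or more, and \<open>(1 - d) / v\<close> is large. The factor
  \<open>4\<close> leaves room for the loss of a factor \<open>3\<close> when a segment is cut into three parts.\<close>

lemma node_near_odd_expands:
  assumes n: "n \<ge> 1" and i: "odd i" "i < laps n" and \<tau>: "\<bar>\<tau>\<bar> = 1" and u: "0 \<le> u" "u < v" "v \<le> d"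
  shows "\<exists>k. 4 * (gap n / M n) * (v - u) \<le>
    \<bar>(f ^^ k) (node n (real i + \<tau> * u)) - (f ^^ k) (node n (real i + \<tau> * v))\<bar>"
proof -
  define g where "g = gap n / M n"
  have g: "0 < g" using gap_over_M_pos[OF n] by (simp add: g_def)
  let ?P = "node n (real i + \<tau> * u)" and ?Q = "node n (real i + \<tau> * v)"
  have sq: "(\<tau> * x)^2 = x^2" for x using \<tau> by (metis abs_mult_self_eq mult_1 power2_eq_square power_mult_distrib)
  have img: "(f ^^ Suc n) (node n (real i + \<tau> * x)) = ypt n + (- 1) * (gap n * C_const l r * x^2)"
    if "0 \<le> x" "x \<le> d" for x
    using return_node_odd[OF n i, of "\<tau> * x"] that \<tau> by (simp add: abs_mult sq del: funpow.simps)
  have c: "0 < gap n * C_const l r" using gap_pos[OF n] d_pos by (simp add: C_const_def)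
  obtain k U V where k: "g * d < V" "0 \<le> U" "V * (v - u) \<le> (V - U) * v"
    "(f ^^ k) ?P = ypt n + (- 1) * U" "(f ^^ k) ?Q = ypt n + (- 1) * V"
    by (rule fold_escape[where N = "Suc n" and k = "Suc n" and m = 2 and p = "ypt n" and \<sigma> = "- 1" and e = "g * d"
          and \<kappa> = "2 * L" and c = "gap n * C_const l r" and u = u and v = v and P = ?P and Q = ?Q])
       (use return_end_of_last_lap[OF n] img[of u] img[of v] u c L_ge in \<open>auto simp: g_def\<close>)
  have v0: "0 < v" using u by simp
  show ?thesis
  proof (cases "V \<le> g * (1 - d)")
    case False
    have "4 * g * v \<le> g * (1 - d)" using g u(3) d_le by simp
    then have "(4 * g * v) * (v - u) \<le> V * (v - u)"
      using False u by (intro mult_right_mono) auto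
    then have "(4 * g * (v - u)) * v \<le> (V - U) * v" using k(3) by (simp add: algebra_simps)
    then have "4 * g * (v - u) \<le> V - U" using v0 by simp
    then have "4 * g * (v - u) \<le> \<bar>(f ^^ k) ?P - (f ^^ k) ?Q\<bar>" using k(4,5) by simp
    then show ?thesis unfolding g_def[symmetric] by blast
  next
    case True
    \<comment> \<open>The image lies in the last lap, away from its lower end, so one more return expands it.\<close>
    have "0 < V" using k(1) g d_pos by (smt (verit) mult_pos_pos)
    have "g * v \<le> g * d" using u g by (intro mult_left_mono) auto
    then have "g * v \<le> V" using k(1) by linarith
    then have "(g * v) * (v - u) \<le> V * (v - u)"
      using u by (intro mult_right_mono) auto
    then have "(g * (v - u)) * v \<le> (V - U) * v" using k(3) by (simp add: algebra_simps)
    then have UV: "g * (v - u) \<le> V - U" using v0 by simp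
    have "U < V" using UV g u by (smt (verit) mult_pos_pos)
    let ?a = "M n - V / g" and ?b = "M n - U / g"
    have "V / g \<le> 1 - d" using True g by (simp add: divide_le_eq mult.commute)
    have "13/2 * (gap n / M n) * (?b - ?a) \<le> \<bar>(f ^^ Suc n) (node n ?a) - (f ^^ Suc n) (node n ?b)\<bar>"
    proof (rule return_node_middle[OF n])
      have "real (laps n - 1) = M n - 1" using laps_ge[OF n] M_eq[OF n] by auto
      moreover have "0 \<le> U / g" using k(2) g by simp
      ultimately show "real (laps n - 1) \<le> ?a" "?b \<le> real (laps n - 1) + 1" "real (laps n - 1) + d \<le> ?a"
        using \<open>V / g \<le> 1 - d\<close> d_pos by linarith+
      show "?a < ?b" using \<open>U < V\<close> g by (simp add: divide_strict_right_mono)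
    qed (use laps_ge[OF n] in auto)
    moreover have "node n ?a = (f ^^ k) ?Q" "node n ?b = (f ^^ k) ?P"
      using node_M_minus[OF n] k(4,5) g unfolding g_def[symmetric] by auto
    moreover have "13/2 * (gap n / M n) * (?b - ?a) = 13/2 * (V - U)"
      unfolding g_def[symmetric] using g by (simp add: field_simps)
    ultimately have grow: "13/2 * (V - U) \<le> \<bar>(f ^^ (Suc n + k)) ?Q - (f ^^ (Suc n + k)) ?P\<bar>"
      by (simp only: funpow_add o_apply)
    have "4 * (g * (v - u)) \<le> 13/2 * (V - U)" using UV \<open>U < V\<close> by argo
    then have "4 * g * (v - u) \<le> 13/2 * (V - U)" by (simp only: mult.assoc)
    then have "4 * g * (v - u) \<le> \<bar>(f ^^ (Suc n + k)) ?P - (f ^^ (Suc n + k)) ?Q\<bar>"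
      using grow by (subst abs_minus_commute) (rule order_trans)
    then show ?thesis unfolding g_def[symmetric] by blast
  qed
qed

text \<open>Minima of \<open>s_n\<close> are sent to \<open>y_(n+1)\<close>, where the linear stretch up to \<open>w_n\<close> is \<open>m_n M_n d / 2\<close> laps long. As
  \<open>m_n M_n \<ge> 39/4\<close>, this exceeds \<open>4 d\<close> at once.\<close>

lemma node_near_even_expands:
  assumes n: "n \<ge> 1" and i: "even i" "0 < i" "i < laps n" and \<tau>: "\<bar>\<tau>\<bar> = 1" and u: "0 \<le> u" "u < v" "v \<le> d"
  shows "\<exists>k. 4 * (gap n / M n) * (v - u) \<le>
    \<bar>(f ^^ k) (node n (real i + \<tau> * u)) - (f ^^ k) (node n (real i + \<tau> * v))\<bar>"
proof -
  have sq: "(\<tau> * x)^2 = x^2" for x using \<tau> by (metis abs_mult_self_eq mult_1 power2_eq_square power_mult_distrib)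
  have img: "(f ^^ Suc n) (node n (real i + \<tau> * x)) = ypt (Suc n) + 1 * (gap n * C_const l r * x^2)"
    if "0 \<le> x" "x \<le> d" for x
    using return_node_even[OF n i, of "\<tau> * x"] that \<tau> by (simp add: abs_mult sq del: funpow.simps)
  have c: "0 < gap n * C_const l r" using gap_pos[OF n] d_pos by (simp add: C_const_def)
  have lin: "(f ^^ Suc (Suc n)) (ypt (Suc n) + 1 * x) = ypt (Suc n) + 1 * (2 * L * x)"
    if "0 \<le> x" "x \<le> w n - ypt (Suc n)" for x
    using return_affine[OF n, of "ypt (Suc n) + x"] that by (simp del: funpow.simps)
  have "4 * (gap n / M n) * v \<le> w n - ypt (Suc n)"
  proof -
    have "(3/4) * 13 \<le> m_seq n * M n" using m_bounds[OF n] M_ge[OF n] by (intro mult_mono) auto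
    moreover have "0 \<le> (gap n / M n) * (m_seq n * M n)"
      using gap_over_M_pos[OF n] m_bounds[OF n] M_ge[OF n] by (intro mult_nonneg_nonneg) auto
    ultimately have "(gap n / M n) * 8 * v \<le> (gap n / M n) * (m_seq n * M n) * d"
      using gap_over_M_pos[OF n] u by (intro mult_mono mult_left_mono) auto
    also have "\<dots> = m_seq n * gap n * d" using M_ge[OF n] by simp
    finally show ?thesis unfolding order_points(4)[OF n] by argo
  qed
  then show ?thesis
    by (intro fold_escape_expands[where N = "Suc (Suc n)" and k = "Suc n" and m = 2 and p = "ypt (Suc n)" and \<sigma> = 1
          and e = "w n - ypt (Suc n)" and \<kappa> = "2 * L" and c = "gap n * C_const l r"])
       (use lin img[of u] img[of v] u c L_ge in auto)
qed

lemma node_near_integer_expands: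
  assumes n: "n \<ge> 1" and i: "0 < i" "i < laps n" and \<tau>: "\<bar>\<tau>\<bar> = 1" and u: "0 \<le> u" "u < v" "v \<le> d"
  shows "\<exists>k. 4 * (gap n / M n) * (v - u) \<le>
    \<bar>(f ^^ k) (node n (real i + \<tau> * u)) - (f ^^ k) (node n (real i + \<tau> * v))\<bar>"
  using node_near_odd_expands[OF n _ i(2) \<tau> u] node_near_even_expands[OF n _ i \<tau> u] by blast

text \<open>A segment in a lap is cut at distance \<open>d\<close> from the folds at the ends of the lap. One of the at most three
  parts has at least a third of its length, and that part is expanded by the factor \<open>4\<close>.\<close>

lemma lap_expands:
  assumes n: "n \<ge> 1" and i: "i < laps n" and ab: "real i \<le> a" "a < b" "b \<le> real i + 1"
  shows "expands (node n a) (node n b)"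
proof -
  define g where "g = gap n / M n"
  have g: "0 < g" using gap_over_M_pos[OF n] by (simp add: g_def)
  define lo where "lo = (if i = 0 then real i else real i + d)"
  define hi where "hi = (if i + 1 = laps n then real i + 1 else real i + 1 - d)"
  have lohi: "real i \<le> lo" "lo < hi" "hi \<le> real i + 1" using d_pos d_le by (auto simp: lo_def hi_def)
  define t1 where "t1 = min b (max a lo)"
  define t2 where "t2 = min b (max a hi)"
  have t: "a \<le> t1" "t1 \<le> t2" "t2 \<le> b" using ab lohi by (auto simp: t1_def t2_def)
  have len: "\<bar>node n a - node n b\<bar> = g * (b - a)"
    using node_diff[of n a b] g ab by (simp add: g_def[symmetric] abs_mult)
  have seg: "node n x \<in> closed_segment (node n a) (node n b)" if "a \<le> x" "x \<le> b" for x
    using that node_mono[OF n] by (simp add: mem_segment_iff)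
  have part: "expands (node n a) (node n b)"
    if "a \<le> x" "x \<le> b" "a \<le> y" "y \<le> b" "b - a \<le> 3 * z" "4 * g * z \<le> \<bar>(f ^^ k) (node n x) - (f ^^ k) (node n y)\<bar>" 
    for x y z k
  proof (rule expandsI[OF seg[OF that(1,2)] seg[OF that(3,4)]])
    have "g * (b - a) \<le> g * (3 * z)" using that(5) g by (intro mult_left_mono) auto
    then show "4/3 * \<bar>node n a - node n b\<bar> \<le> \<bar>(f ^^ k) (node n x) - (f ^^ k) (node n y)\<bar>"
      using that(6) unfolding len by argo
  qed
  consider "b - a \<le> 3 * (t1 - a)" | "b - a \<le> 3 * (t2 - t1)" | "b - a \<le> 3 * (b - t2)"
    by argo
  then show ?thesis
  proof cases
    case 1
    then have "a < t1" using ab by simp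
    then have *: "i \<noteq> 0" "t1 \<le> real i + d" "a < t1"
      using ab(1) by (auto simp: t1_def lo_def min_def max_def split: if_splits)
    then obtain k where "4 * g * ((t1 - i) - (a - i)) \<le>
        \<bar>(f ^^ k) (node n (real i + 1 * (a - i))) - (f ^^ k) (node n (real i + 1 * (t1 - i)))\<bar>"
      using node_near_integer_expands[OF n _ i, of 1 "a - i" "t1 - i"] ab unfolding g_def by auto
    then show ?thesis
      using part[of a t1 "t1 - a" k] 1 t by simp
  next
    case 2
    then have *: "t1 < t2" using ab by simp
    have "13/2 * (gap n / M n) * (t2 - t1) \<le> \<bar>(f ^^ Suc n) (node n t1) - (f ^^ Suc n) (node n t2)\<bar>"
    proof (rule return_node_middle[OF n i])
      have "lo \<le> t1" "t2 \<le> hi" using * lohi ab by (auto simp: t1_def t2_def min_def max_def split: if_splits)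
      then show "i \<noteq> 0 \<Longrightarrow> real i + d \<le> t1" "i + 1 \<noteq> laps n \<Longrightarrow> t2 \<le> real i + 1 - d"
        by (auto simp: lo_def hi_def)
    qed (use * t ab in auto)
    moreover have "4 * g * (t2 - t1) \<le> 13/2 * g * (t2 - t1)" using g * by (intro mult_right_mono) auto
    ultimately show ?thesis
      using part[of t1 t2 "t2 - t1" "Suc n"] 2 t unfolding g_def[symmetric] by (simp del: funpow.simps)
  next
    case 3
    then have "t2 < b" using ab by simp
    then have *: "i + 1 \<noteq> laps n" "real i + 1 - d \<le> t2"
      using ab(3) by (auto simp: t2_def hi_def min_def max_def split: if_splits)
    then obtain k where "4 * g * ((i + 1 - t2) - (i + 1 - b)) \<le>
        \<bar>(f ^^ k) (node n (real (i + 1) + (- 1) * (i + 1 - b))) - (f ^^ k) (node n (real (i + 1) + (- 1) * (i + 1 - t2)))\<bar>"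
      using node_near_integer_expands[OF n, of "i + 1" "- 1" "i + 1 - b" "i + 1 - t2"] ab i \<open>t2 < b\<close>
      unfolding g_def by auto
    then show ?thesis
      using part[of b t2 "b - t2" k] 3 t ab by simp
  qed
qed

text \<open>The end points are chosen so that each of them is eventually sent to \<open>0\<close>, \<open>1\<close>, \<open>4\<close>, or some \<open>x_n\<close> or \<open>y_n\<close>.\<close>

inductive piece :: "real \<Rightarrow> real \<Rightarrow> bool" where
  "piece 0 (5/2 * d)"
| "piece (5/2 * d) (1/2 - d)"
| "piece (1/2 - d) (1/2)"
| "piece (1/2) (1/2 + d)"
| "piece (1/2 + d) (1 - d)"
| "piece (1 - d) 1"
| "piece (5/2) 4"
| "n \<ge> 1 \<Longrightarrow> piece (ypt (Suc n)) (w n)"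
| "n \<ge> 1 \<Longrightarrow> piece (w n) (xpt n)"
| "n \<ge> 1 \<Longrightarrow> i < laps n \<Longrightarrow> piece (node n (real i)) (node n (real i + 1))"

lemma abs_image_expands:
  assumes "4/3 * \<bar>a - b\<bar> \<le> \<bar>(f ^^ n) a - (f ^^ n) b\<bar>" shows "expands a b"
  using assms by (intro expandsI[of a _ _ b]) auto

lemma piece_expands:
  assumes "piece p q" "p \<le> a" "a < b" "b \<le> q"
  shows "expands a b"
  using assms(1)
proof cases
  case 1
  have "4/3 * (b - a) \<le> L * (b - a)" using assms L_ge by (intro mult_right_mono) auto
  then show ?thesis
    using abs_image_expands[of a b 1] 1 assms f_near_0[of a] f_near_0[of b]
    by (simp add: right_diff_distrib)
next
  case 2
  then show ?thesis
    using abs_image_expands[of a b 1] assms f_left_expand[of a b] by simp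
next
  case 3
  have "\<exists>k. 3/2 * ((1/2 - a) - (1/2 - b)) \<le> \<bar>(f ^^ k) b - (f ^^ k) a\<bar>"
    by (rule fold_escape_expands[where N = 1 and k = 1 and m = 2 and p = 4 and \<sigma> = "- 1" and e = "3/2 * d"
          and \<kappa> = L and c = "3/2 * L"])
       (use 3 assms L_ge f_near_4 f_near_half[of "b - 1/2"] f_near_half[of "a - 1/2"] in \<open>auto simp: power2_commute\<close>)
  then obtain k where "3/2 * (b - a) \<le> \<bar>(f ^^ k) b - (f ^^ k) a\<bar>" by auto
  then show ?thesis
    using abs_image_expands[of a b k] assms by (simp add: abs_minus_commute)
next
  case 4
  have "\<exists>k. 3/2 * ((b - 1/2) - (a - 1/2)) \<le> \<bar>(f ^^ k) a - (f ^^ k) b\<bar>"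
    by (rule fold_escape_expands[where N = 1 and k = 1 and m = 2 and p = 4 and \<sigma> = "- 1" and e = "3/2 * d"
          and \<kappa> = L and c = "3/2 * L"])
       (use 4 assms L_ge f_near_4 f_near_half[of "b - 1/2"] f_near_half[of "a - 1/2"] in auto)
  then obtain k where "3/2 * (b - a) \<le> \<bar>(f ^^ k) a - (f ^^ k) b\<bar>" by auto
  then show ?thesis
    using abs_image_expands[of a b k] assms by simp
next
  case 5
  then show ?thesis
    using abs_image_expands[of a b 1] assms f_mid_expand[of a b] by simp
next
  case 6
  have "\<exists>k. 5/2 * ((1 - a) - (1 - b)) \<le> \<bar>(f ^^ k) b - (f ^^ k) a\<bar>"
    by (rule fold_escape_expands[where N = 1 and k = 1 and m = "2 * r" and p = 0 and \<sigma> = 1 and e = "5/2 * d"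
          and \<kappa> = L and c = "1 / d ^ (2 * r - 1)"])
       (use 6 assms L_ge r_ge d_pos f_near_0 f_left_of_1[of "1 - b"] f_left_of_1[of "1 - a"] in auto)
  then obtain k where "5/2 * (b - a) \<le> \<bar>(f ^^ k) b - (f ^^ k) a\<bar>" by auto
  then show ?thesis
    using abs_image_expands[of a b k] assms by (simp add: abs_minus_commute)
next
  case 7
  then show ?thesis
    using abs_image_expands[of a b 1] assms f_right_expand[of a b] by simp
next
  case (8 n)
  have "4/3 * (b - a) \<le> 2 * L * (b - a)" using assms L_ge by (intro mult_right_mono) auto
  then show ?thesis
    using abs_image_expands[of a b "Suc (Suc n)"] 8 assms return_affine[of n a] return_affine[of n b]
    by (simp add: right_diff_distrib del: funpow.simps)
next
  case (9 n)
  then show ?thesis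
    using abs_image_expands[of a b "Suc n"] assms return_phi_expand[of n a b]
    by (simp del: funpow.simps)
next
  case (10 n i)
  have M: "real i + 1 \<le> M n" using 10 by (simp add: M_eq)
  have "a \<in> {xpt n..ypt n}" "b \<in> {xpt n..ypt n}"
    using 10 assms node_mono[of n 0 i] node_mono[of n "real i + 1" "M n"] M by (auto simp: node_0 node_M)
  then obtain t u where t: "a = node n t" and u: "b = node n u"
    using node_coord[of n] 10 by metis
  have "real i \<le> t" "u \<le> real i + 1" "\<not> u \<le> t"
    using 10 assms node_mono[of n "real i" t] node_mono[of n u "real i + 1"] node_mono[of n u t]
    unfolding t u by auto
  then show ?thesis
    unfolding t u using 10 by (intro lap_expands[of n i]) auto
qed

section \<open>Every segment is eventually mapped onto I\<close>

lemma piece_bounds: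
  assumes "piece p q" shows "p < q" "p \<in> I" "q \<in> I"
proof -
  have "p < q \<and> p \<in> I \<and> q \<in> I" using assms
  proof cases
    case (8 n)
    then show ?thesis using order_points[of n] points_in_I[of n] by auto
  next
    case (9 n)
    then show ?thesis using order_points[of n] points_in_I[of n] by auto
  next
    case (10 n i)
    have M: "real i + 1 \<le> M n" using 10 by (simp add: M_eq)
    then show ?thesis
      using node_mono[OF 10(3), of "real i + 1" "real i"] node_in_I[OF 10(3)] 10(1,2) by auto
  qed (use d_pos d_le in \<open>auto simp: I_def\<close>)
  then show "p < q" "p \<in> I" "q \<in> I" by auto
qed

lemma pieces_cover_I:
  assumes "x \<in> I" "x \<noteq> 1"
  obtains p q where "piece p q" "p \<le> x" "x \<le> q"
proof -
  have half: thesis if "\<bar>x - 1/2\<bar> \<le> d"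
    using that piece.intros(3,4)[THEN \<open>\<And>p q. piece p q \<Longrightarrow> p \<le> x \<Longrightarrow> x \<le> q \<Longrightarrow> thesis\<close>]
    by (cases "x \<le> 1/2") (auto simp: abs_le_iff)
  from assms(1) show thesis
  proof (cases rule: I_cases)
    case 7
    then obtain n where n: "n \<ge> 1" "ypt (Suc n) \<le> x" "x \<le> ypt n"
      using piece_cover[of 1 x] ypt_1 by auto
    consider "x \<le> w n" | "w n \<le> x" "x \<le> xpt n" | "x \<in> {xpt n..ypt n}"
      using n by fastforce
    then show thesis
    proof cases
      case 1 then show thesis using that[OF piece.intros(8)[OF n(1)]] n by simp
    next
      case 2 then show thesis using that[OF piece.intros(9)[OF n(1)]] by simp
    next
      case 3
      then obtain t where t: "0 \<le> t" "t \<le> M n" "x = node n t" using node_coord[OF n(1)] by blast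
      \<comment> \<open>The right end point \<open>t = M_n\<close> has to be put into the last lap.\<close>
      define i where "i = (if t = M n then laps n - 1 else nat \<lfloor>t\<rfloor>)"
      have i: "i < laps n" "real i \<le> t" "t \<le> real i + 1"
      proof -
        have "i < laps n \<and> real i \<le> t \<and> t \<le> real i + 1"
        proof (cases "t = M n")
          case True
          then show ?thesis using laps_ge[OF n(1)] M_eq[OF n(1)] by (auto simp: i_def)
        next
          case False
          then have "real i \<le> t" "t \<le> real i + 1" using t(1) by (auto simp: i_def)
          then show ?thesis using False t(2) M_eq[OF n(1)] by auto
        qed
        then show "i < laps n" "real i \<le> t" "t \<le> real i + 1" by auto
      qed
      then show thesis
        using that[OF piece.intros(10)[OF n(1) i(1)]] t(3) node_mono[OF n(1)] by blast
    qed
  qed (use assms(2) half that piece.intros(1,2,5,6,7) in \<open>fastforce+\<close>)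
qed

text \<open>The midpoint will do, unless it is the point \<open>1\<close>, at which the pieces accumulate.\<close>

lemma subsegment_in_piece:
  assumes "a \<in> I" "b \<in> I" "a < b"
  obtains p q x where "piece p q" "a < x" "x < b" "p \<le> x" "x \<le> q"
proof -
  define x where "x = (if (a + b) / 2 = 1 then (3 * a + b) / 4 else (a + b) / 2)"
  have "a < x" "x < b" "x \<noteq> 1" using assms(3) by (auto simp: x_def)
  moreover from this have "x \<in> I" using assms by (auto simp: I_def)
  ultimately show thesis using pieces_cover_I[of x] that by blast
qed

text \<open>If \<open>f\<close> were constant on a segment, so would be all its iterates, against the expansion on the pieces.\<close>

lemma f_not_constant:
  assumes "a \<in> I" "b \<in> I" "a \<noteq> b"
  shows "\<exists>q\<in>closed_segment a b. f q \<noteq> f a"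
proof (rule ccontr)
  assume "\<not> ?thesis"
  then have const: "f x = f a" if "x \<in> closed_segment a b" for x using that by blast
  define u v where "u = min a b" and "v = max a b"
  have uv: "u < v" "u \<in> I" "v \<in> I" "closed_segment a b = {u..v}"
    using assms by (auto simp: u_def v_def closed_segment_eq_real_ivl min_def max_def)
  obtain p q x where x: "piece p q" "u < x" "x < v" "p \<le> x" "x \<le> q"
    using subsegment_in_piece[OF uv(2,3,1)] by blast
  define a' b' where "a' = max p u" and "b' = min q v"
  have ab': "a' < b'" "p \<le> a'" "b' \<le> q" "u \<le> a'" "b' \<le> v"
    using x piece_bounds(1)[OF x(1)] by (auto simp: a'_def b'_def)
  then have "expands a' b'" using piece_expands[OF x(1)] by simp
  then obtain n s t where n: "s \<in> closed_segment a' b'" "t \<in> closed_segment a' b'"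
    "4/3 * \<bar>a' - b'\<bar> \<le> \<bar>(f ^^ n) s - (f ^^ n) t\<bar>"
    unfolding expands_def by blast
  have st: "a' \<le> s" "s \<le> b'" "a' \<le> t" "t \<le> b'"
    using n(1,2) ab'(1) by (auto simp: mem_segment_iff)
  then have "f s = f t" using const[of s] const[of t] ab' unfolding uv(4) by simp
  then have "(f ^^ Suc m) s = (f ^^ Suc m) t" for m by (simp only: funpow_Suc_apply)
  then have "n = 0" using n(3) ab'(1) by (cases n) auto
  moreover have "\<bar>s - t\<bar> \<le> b' - a'" using st by (simp add: abs_le_iff)
  ultimately show False using n(3) ab'(1) by simp
qed

lemma funpow_not_constant:
  assumes "a \<in> I" "b \<in> I" "a \<noteq> b"
  shows "\<exists>p\<in>closed_segment a b. \<exists>q\<in>closed_segment a b. (f ^^ n) p \<noteq> (f ^^ n) q"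
proof (induction n)
  case 0
  then show ?case using assms by auto
next
  case (Suc n)
  then obtain p q where pq: "p \<in> closed_segment a b" "q \<in> closed_segment a b" "(f ^^ n) p \<noteq> (f ^^ n) q" by blast
  then have "p \<in> I" "q \<in> I" using segment_in_I[OF assms(1,2)] by auto
  then obtain y where y: "y \<in> closed_segment ((f ^^ n) p) ((f ^^ n) q)" "f y \<noteq> f ((f ^^ n) p)"
    using f_not_constant funpow_in_I pq(3) by meson
  then obtain x where "x \<in> closed_segment a b" "y = (f ^^ n) x"
    using segment_subset_funpow_image[OF assms(1,2) pq(1,2)] by blast
  then show ?case using y pq(1) by (intro bexI[of _ x] bexI[of _ p]) auto
qed

text \<open>Since \<open>f\<close> is not constant near \<open>z\<close>, a segment ending at \<open>z\<close> is sent to a segment that contains a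
  nondegenerate one ending at \<open>f z\<close>.\<close>

lemma covers_preimage:
  assumes z: "z \<in> I" and "covers (f z)" shows "covers z"
  unfolding covers_def
proof (intro ballI impI)
  fix q assume q: "q \<in> I" "q \<noteq> z"
  obtain y where y: "y \<in> closed_segment z q" "f y \<noteq> f z"
    using f_not_constant[OF z q(1)] q(2) by auto
  then have "y \<in> I" using segment_in_I[OF z q(1)] by auto
  then have "hits (f z) (f y)"
    using assms(2) y(2) f_maps_I unfolding covers_def by blast
  then show "hits z q" using hits_image[of 1 z y z q] z q y by simp
qed

lemma covers_preimage_funpow: "z \<in> I \<Longrightarrow> covers ((f ^^ n) z) \<Longrightarrow> covers z"
  by (induction n) (auto intro: covers_preimage funpow_in_I)

lemma piece_ends_cover:
  assumes "piece p q" shows "covers p" "covers q"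
proof -
  have in_I: "5/2 * d \<in> I" "1/2 - d \<in> I" "1/2 + d \<in> I" "1 - d \<in> I" "4 - 3/2 * d \<in> I" "d \<in> I" "1/2 \<in> I"
    using d_pos d_le by (auto simp: I_def)
  have c_y1: "covers (5/2)" using covers_ypt[of 1] by (simp add: ypt_1)
  have c1: "covers (5/2 * d)" by (rule covers_preimage) (simp_all only: in_I f_special_values c_y1)
  have c2: "covers (4 - 3/2 * d)" by (rule covers_preimage) (simp_all only: in_I f_special_values c_y1)
  have c3: "covers (1/2 - d)" "covers (1/2 + d)"
    by (rule covers_preimage; simp only: in_I f_special_values c2)+
  have c4: "covers (1/2)" by (rule covers_preimage) (simp_all only: in_I f_special_values covers_4)
  have c6: "covers d" by (rule covers_preimage) (simp_all only: in_I f_special_values covers_1)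
  have c5: "covers (1 - d)" by (rule covers_preimage) (simp_all only: in_I f_special_values c6)
  have c_w: "covers (w n)" if "n \<ge> 1" for n
    using covers_preimage_funpow[of "w n" "Suc (Suc n)"] return_w(2)[OF that] covers_xpt[OF that] points_in_I[OF that]
    by simp
  have c_node_le: "covers (node n (real i))" if "n \<ge> 1" "i \<le> laps n" for n i
  proof (rule covers_preimage_funpow)
    show "node n (real i) \<in> I" using that M_eq by (intro node_in_I) auto
    show "covers ((f ^^ Suc n) (node n (real i)))"
      unfolding return_node_integer[OF that] using covers_xpt[of n] covers_ypt[of n] covers_ypt[of "Suc n"] that(1) by auto
  qed
  have c_node': "covers (node n (real i + 1))" if "n \<ge> 1" "i < laps n" for n i
    using c_node_le[of n "Suc i"] that by (simp add: add.commute)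
  have c_node: "covers (node n (real i))" if "n \<ge> 1" "i < laps n" for n i
    using c_node_le that by simp
  have c_y: "covers (ypt (Suc n))" for n by (rule covers_ypt) simp
  have "covers p \<and> covers q"
    using assms
    by cases (simp_all only: simp_thms c1 c2 c3 c4 c5 c_y1 c_w c_node c_node' c_y covers_0 covers_1 covers_4 covers_xpt)
  then show "covers p" "covers q" by auto
qed

text \<open>A segment meeting the end point of a piece hits; any other segment around an interior point of a
  piece lies in that piece and expands.\<close>

lemma hits_all:
  assumes "a \<in> I" "b \<in> I" "a \<noteq> b"
  shows "hits a b"
proof (rule hits_by_growth[where \<kappa> = "4/3" and D = "\<lambda>_ _. True"])
  fix a b assume ab: "a \<in> I" "b \<in> I" "a \<noteq> b" "\<not> hits a b"
  define u v where "u = min a b" and "v = max a b"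
  have uv: "u < v" "u \<in> I" "v \<in> I" "\<not> hits u v" "closed_segment a b = closed_segment u v" "\<bar>a - b\<bar> = \<bar>u - v\<bar>"
    using ab hits_commute by (auto simp: u_def v_def min_def max_def closed_segment_commute)
  obtain p q x where x: "piece p q" "u < x" "x < v" "p \<le> x" "x \<le> q"
    using subsegment_in_piece[OF uv(2,3,1)] by blast
  have outside: False if c: "covers z" and z: "u \<le> z" "z \<le> v" for z
  proof (cases "z = u")
    case True
    then show ?thesis using c uv unfolding covers_def by auto
  next
    case False
    then have "hits z u" using c uv(2) unfolding covers_def by auto
    then have "hits u v" by (rule hits_mono) (use z uv(1) in \<open>auto simp: mem_segment_iff\<close>)
    then show ?thesis using uv(4) by simp
  qed
  have "p \<le> u" using outside[OF piece_ends_cover(1)[OF x(1)]] x by (cases "p \<le> u") auto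
  moreover have "v \<le> q" using outside[OF piece_ends_cover(2)[OF x(1)]] x by (cases "v \<le> q") auto
  ultimately have "expands u v" using piece_expands[OF x(1)] uv(1) by simp
  then show "\<exists>n p' q'. p' \<in> closed_segment a b \<and> q' \<in> closed_segment a b \<and> True \<and>
      4/3 * \<bar>a - b\<bar> \<le> \<bar>(f ^^ n) p' - (f ^^ n) q'\<bar>"
    unfolding expands_def uv(5,6) by blast
qed (use assms in auto)

lemma I_subset_f_image:
  assumes "I \<subseteq> S" shows "I \<subseteq> f ` S"
proof -
  have "I = closed_segment (f 0) (f (1/2))"
    by (simp add: f_special_values closed_segment_eq_real_ivl I_def)
  also have "\<dots> \<subseteq> f ` closed_segment 0 (1/2)"
    using segment_subset_funpow_image[OF zero_in_I half_in_I, of 0 "1/2" 1] by simp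
  also have "\<dots> \<subseteq> f ` S"
    using segment_in_I[OF zero_in_I half_in_I] assms by blast
  finally show ?thesis .
qed

lemma funpow_Suc_image: "(f ^^ Suc n) ` S = f ` (f ^^ n) ` S"
  by (simp add: image_comp)

text \<open>Once an iterate contains \<open>0\<close> and another point, it contains a neighbourhood of \<open>0\<close>. This grows to
  \<open>[0, 5/2 d]\<close>, whose image contains \<open>[0, 1/2]\<close>, whose image is \<open>I\<close>.\<close>

theorem eventually_onto:
  assumes ab: "a \<in> I" "b \<in> I" "a \<noteq> b"
  shows "\<exists>N. \<forall>n\<ge>N. I \<subseteq> (f ^^ n) ` closed_segment a b"
proof -
  obtain k z where z: "z \<in> closed_segment a b" "(f ^^ k) z = 0"
    using hits_all[OF ab] unfolding hits_def by auto
  obtain q where q: "q \<in> closed_segment a b" "(f ^^ k) q \<noteq> 0"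
    using funpow_not_constant[OF ab, of k] by metis
  define \<eta> where "\<eta> = (f ^^ k) q"
  have "q \<in> I" using q(1) segment_in_I[OF ab(1,2)] by auto
  then have \<eta>: "0 < \<eta>" using funpow_in_I[of q k] q(2) by (auto simp: \<eta>_def I_def)
  obtain j where j: "5/2 * d < L ^ j * \<eta>" "\<forall>v\<in>{0..\<eta>}. (f ^^ (1 * j)) (0 + 1 * v) = 0 + 1 * (L ^ j * v)"
    using escape[of "5/2 * d" 1 0 1 L \<eta>] f_near_0 L_ge \<eta> by auto
  have "closed_segment ((f ^^ (j + k)) z) ((f ^^ (j + k)) q) \<subseteq> (f ^^ (j + k)) ` closed_segment a b"
    by (rule segment_subset_funpow_image[OF ab(1,2) z(1) q(1)])
  moreover have "(f ^^ (j + k)) z = 0" "(f ^^ (j + k)) q = L ^ j * \<eta>"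
    using j(2) z(2) \<eta> by (auto simp: funpow_add \<eta>_def[symmetric])
  moreover have "{0..5/2 * d} \<subseteq> closed_segment 0 (L ^ j * \<eta>)"
    using j(1) by (auto simp: mem_segment_iff)
  ultimately have "{0..5/2 * d} \<subseteq> (f ^^ (j + k)) ` closed_segment a b"
    by simp
  then have "f ` {0..5/2 * d} \<subseteq> (f ^^ Suc (j + k)) ` closed_segment a b"
    unfolding funpow_Suc_image by (rule image_mono)
  moreover have "{0..1/2} \<subseteq> f ` {0..5/2 * d}"
  proof
    fix y :: real assume y: "y \<in> {0..1/2}"
    have "y * d \<le> 5/2 * d" using y d_pos by (intro mult_right_mono) auto
    then have "y * d \<in> {0..5/2 * d}" using y d_pos by auto
    moreover from this have "f (y * d) = y" using f_near_0[of "y * d"] d_L by (simp add: mult.left_commute)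
    ultimately show "y \<in> f ` {0..5/2 * d}" by (metis image_eqI)
  qed
  ultimately have "{0..1/2} \<subseteq> (f ^^ Suc (j + k)) ` closed_segment a b" by (rule subset_trans[rotated])
  then have "f ` {0..1/2} \<subseteq> (f ^^ Suc (Suc (j + k))) ` closed_segment a b"
    unfolding funpow_Suc_image[of "Suc (j + k)"] by (rule image_mono)
  moreover have "I \<subseteq> f ` {0..1/2}"
    using segment_subset_funpow_image[OF zero_in_I half_in_I, of 0 "1/2" 1]
    by (simp add: f_special_values closed_segment_eq_real_ivl I_def)
  ultimately have base: "I \<subseteq> (f ^^ Suc (Suc (j + k))) ` closed_segment a b" by blast
  have "I \<subseteq> (f ^^ n) ` closed_segment a b" if "n \<ge> Suc (Suc (j + k))" for n
    using that
  proof (induction n rule: dec_induct)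
    case base
    then show ?case using \<open>I \<subseteq> (f ^^ Suc (Suc (j + k))) ` closed_segment a b\<close> .
  next
    case (step n)
    then show ?case
      using I_subset_f_image[of "(f ^^ n) ` closed_segment a b"] by (simp only: funpow_Suc_image)
  qed
  then show ?thesis by blast
qed

theorem f_mixing: "topologically_mixing_on I f"
  unfolding topologically_mixing_on_def
proof (intro conjI allI impI)
  show "compact I" by (simp add: I_def)
  show "f ` I \<subseteq> I" using f_maps_I by blast
  show "continuous_on I f" by (rule f_continuous)
  fix U V :: "real set"
  assume UV: "openin (top_of_set I) U \<and> U \<noteq> {} \<and> openin (top_of_set I) V \<and> V \<noteq> {}"
  then obtain u v where u: "u \<in> U" "u \<in> I" and v: "v \<in> V" "v \<in> I"
    using openin_imp_subset by blast
  obtain e where e: "e > 0" "\<And>x. x \<in> I \<Longrightarrow> \<bar>x - v\<bar> < e \<Longrightarrow> x \<in> V"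
    using UV v(1) unfolding openin_euclidean_subtopology_iff dist_real_def by blast
  \<comment> \<open>Step from \<open>v\<close> towards the middle of \<open>I\<close>, so as not to leave it.\<close>
  define b where "b = (if v < 2 then v + min 1 (e / 2) else v - min 1 (e / 2))"
  have b: "b \<in> I" "v \<noteq> b" "\<bar>b - v\<bar> < e" using v(2) e(1) by (auto simp: b_def I_def)
  have sub: "closed_segment v b \<subseteq> V"
  proof
    fix x assume x: "x \<in> closed_segment v b"
    then have "\<bar>x - v\<bar> < e" using b(3) by (auto simp: mem_segment_iff)
    then show "x \<in> V" using e(2) x segment_in_I[OF v(2) b(1)] by blast
  qed
  obtain N where N: "\<And>n. n \<ge> N \<Longrightarrow> I \<subseteq> (f ^^ n) ` closed_segment v b"
    using eventually_onto[OF v(2) b(1,2)] by blast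
  have "{x \<in> I. (f ^^ n) x \<in> U} \<inter> V \<noteq> {}" if "n \<ge> N" for n
  proof -
    have "u \<in> (f ^^ n) ` closed_segment v b" using N[OF that] u(2) by (rule subsetD)
    then obtain x where "x \<in> closed_segment v b" "(f ^^ n) x = u" by (auto elim!: imageE)
    moreover from this have "x \<in> I" "x \<in> V" using sub segment_in_I[OF v(2) b(1)] by auto
    ultimately show ?thesis using u(1) by auto
  qed
  then show "\<exists>N. \<forall>n\<ge>N. {x \<in> I. (f ^^ n) x \<in> U} \<inter> V \<noteq> {}" by blast
qed

end

theorem proposition1p13:
  fixes l :: real and r :: nat and f :: "real \<Rightarrow> real"
  assumes "l \<ge> 14" and "r \<ge> 1" and "is_fr l r f"
  shows "f ` I \<subseteq> I \<and> C_k_on r I f \<and> topologically_mixing_on I f \<and>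
    sup_norm_on I (nderiv_on I 1 f) = l ^ r"
proof -
  from assms(3) obtain s \<phi> where "ruette_map l r f s \<phi>"
    unfolding is_fr_def ruette_map_def using assms(1,2) by blast
  then interpret ruette_map l r f s \<phi> .
  show ?thesis
    using f_maps_I f_C_r f_mixing sup_norm_derivative by blast
qed

end
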